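(* Let $n \geq 2$ and let $\varphi_1$ and $\varphi_2$ be inner functions in $H^{\infty}(\mathbb{D}^n)$. Then the following hold: (1) If $n = 2$, then $P_{\mathcal{Q}_{\varphi_1}} P_{\mathcal{Q}_{\varphi_2}}$ is a finite rank projection if and only if at least one of the following conditions holds: (a) $\varphi_1$ or $\varphi_2$ is a constant function; (b) $\varphi_1$ and $\varphi_2$ are separated and finite Blaschke products. (2) If $n > 2$, then it is impossible for $P_{\mathcal{Q}_{\varphi_1}} P_{\mathcal{Q}_{\varphi_2}}$ to be a finite rank projection unless $P_{\mathcal{Q}_{\varphi_1}} P_{\mathcal{Q}_{\varphi_2}} = 0$.
   Context: $\mathbb{D}^n$ is the open unit polydisc in $\mathbb{C}^n$ and $\mathbb{T}^n$ its distinguished boundary. $H^\infty(\mathbb{D}^n)$ is the algebra of bounded analytic functions on $\mathbb{D}^n$. $H^2(\mathbb{D}^n)$ is the Hardy space of analytic functions $f$ on $\mathbb{D}^n$ with $\|f\|^2 = \sup_{0 \le r < 1} \int_{\mathbb{T}^n} |f(rz_1,\ldots,rz_n)|^2\, dm(z) < \infty$, where $m$ is normalized Lebesgue measure on $\mathbb{T}^n$. A function $\varphi \in H^\infty(\mathbb{D}^n)$ is inner if its radial boundary values satisfy $|\varphi(z)| = 1$ for almost every $z \in \mathbb{T}^n$. For an inner function $\varphi$, the model space is $\mathcal{Q}_\varphi = H^2(\mathbb{D}^n) \ominus \varphi H^2(\mathbb{D}^n)$ (the orthogonal complement of the closed subspace $\varphi H^2(\mathbb{D}^n)$; it is $\{0\}$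 when $\varphi$ is constant). $P_{\mathcal{S}}$ denotes the orthogonal projection of $H^2(\mathbb{D}^n)$ onto the closed subspace $\mathcal{S}$, and "projection" means orthogonal projection, i.e. a bounded operator $P$ with $P = P^* = P^2$. Two functions on $\mathbb{D}^n$ are separated if they do not depend on common variables, i.e. no coordinate $z_i$ is such that both functions depend on $z_i$. A function in $H^\infty(\mathbb{D}^2)$ is called a finite Blaschke product if it depends on one variable only and is a (one-variable) finite Blaschke product in that variable. *)

theory Defs
  imports "HOL-Probability.Probability"
begin

text \<open>
  The dimension is the cardinality of the finite index type \<open>'n\<close>. Functions on the polydisc are
  total functions on \<open>complex ^ 'n\<close>. Members of the Hardy space vanish off the polydisc, so that they
  are determined by their values on it; for elements of \<open>Hinf\<close> the values off the polydisc
  are irrelevant.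
\<close>

definition polydisc :: "(complex ^ 'n::finite) set" where
  "polydisc = {z. \<forall>i. cmod (z $ i) < 1}"

text \<open>Real (total) differentiability with complex-linear derivative.\<close>

definition analytic_polydisc :: "(complex ^ 'n::finite \<Rightarrow> complex) \<Rightarrow> bool" where
  "analytic_polydisc f \<longleftrightarrow>
     (\<forall>z\<in>polydisc. \<exists>D. (f has_derivative D) (at z) \<and> (\<forall>c v. D (c *s v) = c * D v))"

text \<open>
  Normalized Lebesgue measure on the torus, as a probability measure on \<open>complex ^ 'n\<close> that is
  concentrated on the torus.
\<close>

definition torus_measure :: "(complex ^ 'n::finite) measure" where
  "torus_measure =
     distr (Pi\<^sub>M (UNIV :: 'n set) (\<lambda>_. uniform_measure lborel {0..2 * pi})) borel
       (\<lambda>\<theta>. \<chi> i. cis (\<theta> i))"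

definition Hinf :: "(complex ^ 'n::finite \<Rightarrow> complex) set" where
  "Hinf = {f. analytic_polydisc f \<and> (\<exists>K. \<forall>z\<in>polydisc. cmod (f z) \<le> K)}"

definition inner_function :: "(complex ^ 'n::finite \<Rightarrow> complex) \<Rightarrow> bool" where
  "inner_function \<phi> \<longleftrightarrow> \<phi> \<in> Hinf \<and>
     (AE z in torus_measure.
        \<exists>w. ((\<lambda>r::real. \<phi> (r *\<^sub>R z)) \<longlongrightarrow> w) (at_left 1) \<and> cmod w = 1)"

definition hardy_sup :: "(complex ^ 'n::finite \<Rightarrow> complex) \<Rightarrow> ennreal" where
  "hardy_sup f =
     (SUP r\<in>{0..<1::real}. \<integral>\<^sup>+ z. ennreal ((cmod (f (r *\<^sub>R z)))\<^sup>2) \<partial>torus_measure)"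

definition H2 :: "(complex ^ 'n::finite \<Rightarrow> complex) set" where
  "H2 = {f. analytic_polydisc f \<and> (\<forall>z. z \<notin> polydisc \<longrightarrow> f z = 0) \<and> hardy_sup f < \<infinity>}"

definition hardy_norm :: "(complex ^ 'n::finite \<Rightarrow> complex) \<Rightarrow> real" where
  "hardy_norm f = sqrt (enn2real (hardy_sup f))"

text \<open>
  The inner product inducing \<open>hardy_norm\<close>, recovered from it by polarization; it is linear in the
  first and conjugate-linear in the second argument.
\<close>

definition hardy_inner ::
  "(complex ^ 'n::finite \<Rightarrow> complex) \<Rightarrow> (complex ^ 'n \<Rightarrow> complex) \<Rightarrow> complex" where
  "hardy_inner f g =
     (\<Sum>k<4. \<i> ^ k * of_real ((hardy_norm (\<lambda>z. f z + \<i> ^ k * g z))\<^sup>2)) / 4"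

definition model_space ::
  "(complex ^ 'n::finite \<Rightarrow> complex) \<Rightarrow> (complex ^ 'n \<Rightarrow> complex) set" where
  "model_space \<phi> = {f \<in> H2. \<forall>g\<in>H2. hardy_inner f (\<lambda>z. \<phi> z * g z) = 0}"

text \<open>
  Orthogonal projection onto a closed subspace \<open>S\<close> of \<open>H2\<close>; only meaningful for such \<open>S\<close> and for
  \<open>f \<in> H2\<close>.
\<close>

definition proj_onto ::
  "(complex ^ 'n::finite \<Rightarrow> complex) set \<Rightarrow> (complex ^ 'n \<Rightarrow> complex) \<Rightarrow> complex ^ 'n \<Rightarrow> complex" where
  "proj_onto S f = (THE g. g \<in> S \<and> (\<forall>h\<in>S. hardy_inner (\<lambda>z. f z - g z) h = 0))"

text \<open>Operators on \<open>H2\<close> are maps between functions of which only the restriction to \<open>H2\<close> matters.\<close>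

definition bounded_operator ::
  "((complex ^ 'n::finite \<Rightarrow> complex) \<Rightarrow> complex ^ 'n \<Rightarrow> complex) \<Rightarrow> bool" where
  "bounded_operator T \<longleftrightarrow>
     (\<forall>f\<in>H2. T f \<in> H2) \<and>
     (\<forall>f\<in>H2. \<forall>g\<in>H2. T (\<lambda>z. f z + g z) = (\<lambda>z. T f z + T g z)) \<and>
     (\<forall>f\<in>H2. \<forall>c. T (\<lambda>z. c * f z) = (\<lambda>z. c * T f z)) \<and>
     (\<exists>K. \<forall>f\<in>H2. hardy_norm (T f) \<le> K * hardy_norm f)"

definition is_projection ::
  "((complex ^ 'n::finite \<Rightarrow> complex) \<Rightarrow> complex ^ 'n \<Rightarrow> complex) \<Rightarrow> bool" where
  "is_projection T \<longleftrightarrow> bounded_operator T \<and>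
     (\<forall>f\<in>H2. \<forall>g\<in>H2. hardy_inner (T f) g = hardy_inner f (T g)) \<and>
     (\<forall>f\<in>H2. T (T f) = T f)"

definition finite_rank ::
  "((complex ^ 'n::finite \<Rightarrow> complex) \<Rightarrow> complex ^ 'n \<Rightarrow> complex) \<Rightarrow> bool" where
  "finite_rank T \<longleftrightarrow>
     (\<exists>B. finite B \<and> B \<subseteq> H2 \<and> T ` H2 = {\<lambda>z. \<Sum>b\<in>B. c b * b z | c. True})"

definition constant_on_polydisc :: "(complex ^ 'n::finite \<Rightarrow> complex) \<Rightarrow> bool" where
  "constant_on_polydisc f \<longleftrightarrow> (\<exists>c. \<forall>z\<in>polydisc. f z = c)"

definition depends_on :: "(complex ^ 'n::finite \<Rightarrow> complex) \<Rightarrow> 'n \<Rightarrow> bool" where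
  "depends_on f i \<longleftrightarrow>
     (\<exists>z\<in>polydisc. \<exists>w\<in>polydisc. (\<forall>j. j \<noteq> i \<longrightarrow> z $ j = w $ j) \<and> f z \<noteq> f w)"

definition separated ::
  "(complex ^ 'n::finite \<Rightarrow> complex) \<Rightarrow> (complex ^ 'n \<Rightarrow> complex) \<Rightarrow> bool" where
  "separated f g \<longleftrightarrow> \<not> (\<exists>i. depends_on f i \<and> depends_on g i)"

text \<open>The list \<open>as\<close> contains the zeros with multiplicity; it may be empty (unimodular constants).\<close>

definition blaschke :: "complex \<Rightarrow> complex list \<Rightarrow> complex \<Rightarrow> complex" where
  "blaschke c as w = c * (\<Prod>a\<leftarrow>as. (w - a) / (1 - cnj a * w))"

definition finite_blaschke_product :: "(complex ^ 'n::finite \<Rightarrow> complex) \<Rightarrow> bool" where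
  "finite_blaschke_product f \<longleftrightarrow>
     (\<exists>i c as. cmod c = 1 \<and> (\<forall>a\<in>set as. cmod a < 1) \<and>
        (\<forall>z\<in>polydisc. f z = blaschke c as (z $ i)))"

end

theory Submission
  imports Defs "HOL-Complex_Analysis.Conformal_Mappings" "HOL-Computational_Algebra.Fundamental_Theorem_Algebra"
begin

text \<open>
  Let \<open>f\<close> and \<open>g\<close> be the two inner functions, \<open>M\<^sub>f\<close>
  multiplication by \<open>f\<close>, and \<open>P\<^sub>f = 1 - M\<^sub>f M\<^sub>f\<^sup>*\<close> the
  projection onto the model space of \<open>f\<close>. The product \<open>P\<^sub>f P\<^sub>g\<close> is a
  projection if and only if \<open>P\<^sub>f\<close> and \<open>P\<^sub>g\<close> commute, and its range
  \<open>E\<close> is then the intersection of the model spaces. Cauchy's formula on the torus and Parseval's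
  identity identify the Hardy space with the square summable families of Taylor coefficients, and
  \<open>norm_mult_inner\<close> shows that \<open>M\<^sub>f\<close> is an isometry; from there on the
  argument is about operators and their matrices in the basis of monomials.

  Let \<open>P\<^sub>f P\<^sub>g\<close> be a projection of finite rank. The powers of the backward shifts
  tend to \<open>0\<close>, uniformly so on the finite-dimensional space \<open>E\<close>; hence the
  projections of \<open>z\<^sub>i\<^sup>m\<close> onto \<open>E\<close> tend to \<open>0\<close>, and the
  elements of \<open>E\<close> are bounded functions. If \<open>f\<close> divides \<open>g h\<close>, multiply
  the decomposition of \<open>z\<^sub>i\<^sup>m\<close> along \<open>P\<^sub>f\<close> and
  \<open>P\<^sub>g\<close> by \<open>h\<close>: up to an error that tends to \<open>0\<close>, also
  \<open>z\<^sub>i\<^sup>m h\<close> is a multiple of \<open>f\<close>. As this holds for two different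
  coordinates, \<open>h\<close> itself is a multiple of \<open>f\<close>
  (\<open>range_of_shift_limits\<close>, \<open>coprime\<close>). In this sense \<open>f\<close> and
  \<open>g\<close> are relatively prime, and commutativity of the projections improves to
  \<open>M\<^sub>f\<^sup>* M\<^sub>g = M\<^sub>g M\<^sub>f\<^sup>*\<close> (\<open>doubly_commute\<close>).
  The commutator of \<open>M\<^sub>f\<^sup>*\<close> with a coordinate then shows that no coordinate occurs in
  both functions (\<open>separated_coordinate\<close>). If two coordinates do not occur in \<open>g\<close>,
  multiplication by their powers commutes with \<open>P\<^sub>g\<close>, and the same division argument gives
  that \<open>f\<close> divides all of the model space of \<open>g\<close>, so
  \<open>P\<^sub>f P\<^sub>g = 0\<close> (\<open>joint_proj_zero\<close>). In more than two variables this
  applies to \<open>f\<close> or to \<open>g\<close>.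

  In two variables, if neither function is constant, \<open>f\<close> depends on one variable only and
  \<open>g\<close> on the other one. The functions \<open>P\<^sub>g v\<^sub>k\<close>, where
  \<open>v\<^sub>k\<close> is the \<open>k\<close>-th backward shift of \<open>f\<close>, lie in
  \<open>E\<close> for \<open>k \<ge> 1\<close>. They are linearly dependent, so the Taylor coefficients of
  \<open>f\<close> satisfy a linear recurrence and \<open>f\<close> is rational
  (\<open>finite_dim_imp_recurrence\<close>). A rational function that is unimodular on the circle and bounded
  in the disc is a finite Blaschke product (\<open>rational_inner_is_blaschke\<close>).

  Conversely, the model projection of a constant inner function is \<open>0\<close>. For finite Blaschke
  products in different variables, \<open>M\<^sub>f\<^sup>*\<close> and \<open>M\<^sub>g\<close> commute, so
  the projections commute; and the elements of \<open>E\<close> satisfy a recurrence in each variable, so they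
  are determined by finitely many Taylor coefficients.
\<close>

section \<open>Integration over the circle\<close>

abbreviation circ :: "real measure" where
  "circ \<equiv> uniform_measure lborel {0..2 * pi}"

lemma circ_eq_density: "circ = density lborel (\<lambda>t. ennreal (indicator {0..2 * pi} t / (2 * pi)))"
proof -
  have "emeasure lborel {0..2 * pi} = ennreal (2 * pi)"
    by simp
  then show ?thesis
    unfolding uniform_measure_def
    by (intro arg_cong2[where f = density] ext refl) (auto simp: indicator_def simp flip: ennreal_1 divide_ennreal)
qed

lemma prob_space_circ: "prob_space circ"
  by (rule prob_space_uniform_measure) auto

lemma circ_integral:
  fixes h :: "real \<Rightarrow> complex"
  assumes "continuous_on UNIV h" and "(h has_integral I) {0..2 * pi}"
  shows "(LINT t|circ. h t) = I / (2 * pi)"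
proof -
  have [measurable]: "h \<in> borel_measurable borel"
    using assms(1) by (rule borel_measurable_continuous_onI)
  have si: "set_integrable lborel {0..2 * pi} h"
    using assms(1) continuous_on_subset by (intro borel_integrable_atLeastAtMost') blast
  have "(LINT t|circ. h t) = (LINT t|lborel. (indicator {0..2 * pi} t / (2 * pi)) *\<^sub>R h t)"
    unfolding circ_eq_density by (rule integral_density) auto
  also have "\<dots> = (LINT t|lborel. (1 / (2 * pi)) *\<^sub>R (indicator {0..2 * pi} t *\<^sub>R h t))"
    by (intro Bochner_Integration.integral_cong refl) simp
  also have "\<dots> = (1 / (2 * pi)) *\<^sub>R (LINT t : {0..2*pi}|lborel. h t)"
    unfolding set_lebesgue_integral_def by (rule integral_scaleR_right)
  also have "(LINT t : {0..2*pi}|lborel. h t) = I"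
    using set_borel_integral_eq_integral[OF si] assms(2) by (simp add: integral_unique)
  finally show ?thesis by (simp add: scaleR_conv_of_real)
qed

text \<open>
  Cauchy's formula in the form that generalises to several variables: the kernel is written with
  \<open>cis (- t)\<close>, so that its geometric expansion pairs \<open>F\<close> with the characters of the
  circle.
\<close>
lemma cauchy_circ:
  assumes hol: "F holomorphic_on ball 0 1" and r: "0 < r" "r < 1" and w: "cmod w < r"
  shows "(LINT t|circ. F (of_real r * cis t) / (1 - w * cis (- t) / of_real r)) = F w"
proof -
  have cont: "continuous_on (ball 0 1) F"
    using hol by (rule holomorphic_on_imp_continuous_on)
  have nz: "1 - w * cis (- t) / of_real r \<noteq> 0" for t
  proof
    assume "1 - w * cis (- t) / of_real r = 0"
    then have "cmod (w * cis (- t) / of_real r) = 1" by (metis eq_iff_diff_eq_0 norm_one)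
    then show False using w r by (simp add: norm_mult norm_divide)
  qed
  have "((\<lambda>u. F u / (u - w)) has_contour_integral (2 * of_real pi * \<i> * F w)) (circlepath 0 r)"
  proof (rule Cauchy_integral_circlepath_simple)
    show "F holomorphic_on cball 0 r" using hol r by (auto intro: holomorphic_on_subset)
  qed (use w in auto)
  then have "((\<lambda>t. F (of_real r * cis t) / (of_real r * cis t - w) * of_real r * \<i> * cis t)
      has_integral (2 * of_real pi * \<i> * F w)) {0..2 * pi}"
    unfolding circlepath_def by (subst (asm) has_contour_integral_part_circlepath_iff) auto
  then have "((\<lambda>t. (1 / \<i>) * (F (of_real r * cis t) / (of_real r * cis t - w) * of_real r * \<i> * cis t))
      has_integral (1 / \<i>) * (2 * of_real pi * \<i> * F w)) {0..2 * pi}"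
    by (rule has_integral_mult_right)
  then have "((\<lambda>t. F (of_real r * cis t) / (1 - w * cis (- t) / of_real r))
      has_integral (2 * of_real pi * F w)) {0..2 * pi}"
  proof (rule has_integral_eq_rhs[OF has_integral_eq, rotated])
    fix t :: real
    have gen: "(1 / \<i>) * (X / (a * c * D) * a * \<i> * c) = X / D"
      if "D \<noteq> 0" "a \<noteq> 0" "c \<noteq> 0" for X D a c :: complex
      using that by (simp add: field_simps)
    have "of_real r * cis t - w = of_real r * cis t * (1 - w * cis (- t) / of_real r)"
      using r by (simp add: field_simps flip: cis_inverse)
    moreover have "cis t \<noteq> 0" by simp
    ultimately show "(1 / \<i>) * (F (of_real r * cis t) / (of_real r * cis t - w) * of_real r * \<i> * cis t) =
        F (of_real r * cis t) / (1 - w * cis (- t) / of_real r)"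
      using r nz[of t] gen[of "1 - w * cis (- t) / of_real r" "of_real r" "cis t"] by simp
  qed simp
  moreover have "continuous_on UNIV (\<lambda>t. F (of_real r * cis t) / (1 - w * cis (- t) / of_real r))"
    using r nz by (intro continuous_intros continuous_on_compose2[OF cont]) (auto simp: norm_mult)
  ultimately show ?thesis by (subst circ_integral) auto
qed

lemma circ_integral_cis:
  "(LINT t|circ. cis t ^ m * cnj (cis t) ^ k) = (if m = k then 1 else 0)"
proof -
  have *: "cis t ^ m * cnj (cis t) ^ k = cis ((real m - real k) * t)" for t
    by (simp add: Complex.DeMoivre cis_cnj cis_mult algebra_simps)
  show ?thesis
  proof (cases "m = k")
    case True
    then show ?thesis using prob_space.prob_space[OF prob_space_circ]
      unfolding * by simp
  next
    case False
    define c where "c = real m - real k"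
    have c: "c \<noteq> 0" using False by (simp add: c_def)
    have "((\<lambda>t. cis (c * t)) has_integral (cis (c * (2 * pi)) / (\<i> * c) - cis (c * 0) / (\<i> * c))) {0..2 * pi}"
    proof (rule fundamental_theorem_of_calculus)
      fix x :: real
      have "((\<lambda>t. exp (\<i> * of_real c * t) / (\<i> * c)) has_field_derivative exp (\<i> * of_real c * complex_of_real x)) (at (of_real x))"
        using c by (auto intro!: derivative_eq_intros)
      then have "((\<lambda>t. exp (\<i> * of_real c * of_real t) / (\<i> * c)) has_vector_derivative exp (\<i> * of_real c * complex_of_real x)) (at x within {0..2 * pi})"
        by (rule has_vector_derivative_real_field)
      then show "((\<lambda>t. cis (c * t) / (\<i> * c)) has_vector_derivative cis (c * x)) (at x within {0..2 * pi})"
        by (simp add: cis_conv_exp mult.assoc)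
    qed simp
    moreover have "cis (c * (2 * pi)) = 1"
      using cis_multiple_2pi[of c] by (auto simp: c_def mult.commute)
    ultimately have "((\<lambda>t. cis (c * t)) has_integral 0) {0..2 * pi}" by simp
    then have "(LINT t|circ. cis (c * t)) = 0"
      by (subst circ_integral) (auto intro!: continuous_intros)
    then show ?thesis using False by (simp add: * c_def)
  qed
qed

section \<open>Series indexed by multiindices\<close>

text \<open>
  The partial sums over finite index sets converge to \<open>S\<close> uniformly, since their error is at most
  \<open>B\<close> times a tail of the convergent series of the \<open>\<bar>c i\<bar>\<close>. Uniformity
  makes the exchange work along the filter of finite subsets, which need not be a sequence.
\<close>
lemma has_sum_integral:
  fixes c :: "'i \<Rightarrow> complex" and S :: "'a \<Rightarrow> complex"
  assumes "prob_space M" and S: "integrable M S" and u: "\<And>i. i \<in> I \<Longrightarrow> integrable M (u i)"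
    and bound: "\<And>i \<theta>. i \<in> I \<Longrightarrow> \<theta> \<in> space M \<Longrightarrow> cmod (u i \<theta>) \<le> B"
    and c: "(\<lambda>i. cmod (c i)) summable_on I"
    and sum: "\<And>\<theta>. \<theta> \<in> space M \<Longrightarrow> ((\<lambda>i. c i * u i \<theta>) has_sum S \<theta>) I"
  shows "((\<lambda>i. c i * (LINT \<theta>|M. u i \<theta>)) has_sum (LINT \<theta>|M. S \<theta>)) I"
proof -
  interpret prob_space M by fact
  define N where "N = infsum (\<lambda>i. cmod (c i)) I"
  have N: "((\<lambda>i. cmod (c i)) has_sum N) I" unfolding N_def using c by (rule has_sum_infsum)
  have B: "0 \<le> B \<or> I = {}"
    using bound not_empty by (meson all_not_in_conv dual_order.trans norm_ge_zero)
  have tail: "cmod (S \<theta> - (\<Sum>i\<in>F. c i * u i \<theta>)) \<le> B * (N - (\<Sum>i\<in>F. cmod (c i)))"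
    if F: "finite F" "F \<subseteq> I" and \<theta>: "\<theta> \<in> space M" for F \<theta>
  proof -
    have 1: "((\<lambda>i. c i * u i \<theta>) has_sum (S \<theta> - (\<Sum>i\<in>F. c i * u i \<theta>))) (I - F)"
      using sum[OF \<theta>] F by (intro has_sum_Diff has_sum_finite) auto
    have 2: "((\<lambda>i. B * cmod (c i)) has_sum (B * (N - (\<Sum>i\<in>F. cmod (c i))))) (I - F)"
      using N F by (intro has_sum_cmult_right has_sum_Diff has_sum_finite) auto
    show ?thesis
    proof (rule norm_infsum_le[OF 1 2])
      fix i assume "i \<in> I - F"
      then show "cmod (c i * u i \<theta>) \<le> B * cmod (c i)"
        using bound[of i \<theta>] \<theta> mult_left_mono[of "cmod (u i \<theta>)" B "cmod (c i)"]
        by (simp add: norm_mult mult.commute)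
    qed
  qed
  have le: "cmod ((\<Sum>i\<in>F. c i * (LINT \<theta>|M. u i \<theta>)) - (LINT \<theta>|M. S \<theta>)) \<le> B * (N - (\<Sum>i\<in>F. cmod (c i)))"
    if F: "finite F" "F \<subseteq> I" for F
  proof -
    have int: "integrable M (\<lambda>\<theta>. \<Sum>i\<in>F. c i * u i \<theta>)"
      by (intro Bochner_Integration.integrable_sum Bochner_Integration.integrable_mult_right u) (use F in auto)
    have "(LINT \<theta>|M. S \<theta>) - (\<Sum>i\<in>F. c i * (LINT \<theta>|M. u i \<theta>)) = (LINT \<theta>|M. S \<theta> - (\<Sum>i\<in>F. c i * u i \<theta>))"
      using u F S int by (subst Bochner_Integration.integral_diff)
        (auto simp: subset_iff Bochner_Integration.integral_sum)
    also have "cmod \<dots> \<le> (LINT \<theta>|M. B * (N - (\<Sum>i\<in>F. cmod (c i))))"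
      using Bochner_Integration.integrable_diff[OF S int] tail[OF F]
      by (intro order.trans[OF integral_norm_bound] integral_mono) auto
    also have "\<dots> = B * (N - (\<Sum>i\<in>F. cmod (c i)))" by (simp add: prob_space)
    finally show ?thesis by (simp add: norm_minus_commute)
  qed
  have "((\<lambda>F. (\<Sum>i\<in>F. c i * (LINT \<theta>|M. u i \<theta>)) - (LINT \<theta>|M. S \<theta>)) \<longlongrightarrow> 0) (finite_subsets_at_top I)"
  proof (rule Lim_null_comparison)
    show "\<forall>\<^sub>F F in finite_subsets_at_top I. norm ((\<Sum>i\<in>F. c i * (LINT \<theta>|M. u i \<theta>)) - (LINT \<theta>|M. S \<theta>)) \<le> B * (N - (\<Sum>i\<in>F. cmod (c i)))"
      using le by (intro eventually_finite_subsets_at_top_weakI) auto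
    have "((\<lambda>F. \<Sum>i\<in>F. cmod (c i)) \<longlongrightarrow> N) (finite_subsets_at_top I)"
      using N by (simp add: has_sum_def)
    then have "((\<lambda>F. B * (N - (\<Sum>i\<in>F. cmod (c i)))) \<longlongrightarrow> B * (N - N)) (finite_subsets_at_top I)"
      by (intro tendsto_intros)
    then show "((\<lambda>F. B * (N - (\<Sum>i\<in>F. cmod (c i)))) \<longlongrightarrow> 0) (finite_subsets_at_top I)" by simp
  qed
  then show ?thesis unfolding has_sum_def by (simp add: LIM_zero_iff)
qed

lemma abs_summable_prod:
  fixes b :: "'n::finite \<Rightarrow> nat \<Rightarrow> 'c::{real_normed_field,banach,second_countable_topology}"
  assumes "\<And>i. (\<lambda>k. norm (b i k)) summable_on UNIV"
  shows "(\<lambda>\<alpha>. norm (\<Prod>i\<in>UNIV. b i (\<alpha> i))) summable_on (UNIV :: ('n \<Rightarrow> nat) set)"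
proof -
  have "Infinite_Set_Sum.abs_summable_on (\<lambda>\<alpha>. \<Prod>i\<in>UNIV. b i (\<alpha> i)) (PiE UNIV (\<lambda>_. UNIV))"
    using assms by (intro abs_summable_on_prod_PiE) (auto simp: abs_summable_equivalent)
  then show ?thesis by (simp add: abs_summable_equivalent PiE_UNIV_domain)
qed

lemma has_sum_prod_geometric:
  fixes x :: "'n::finite \<Rightarrow> complex"
  assumes x: "\<And>i. cmod (x i) < 1"
  shows "((\<lambda>\<alpha>. \<Prod>i\<in>UNIV. x i ^ \<alpha> i) has_sum (\<Prod>i\<in>UNIV. 1 / (1 - x i))) (UNIV :: ('n \<Rightarrow> nat) set)"
proof -
  have geo: "((\<lambda>k. x i ^ k) has_sum 1 / (1 - x i)) UNIV" for i
    using x[of i] geometric_sums[OF x[of i]]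
    by (intro norm_summable_imp_has_sum) (auto simp: norm_power)
  have ab: "(\<lambda>k. norm (x i ^ k)) summable_on UNIV" for i
    using geo[of i] summable_on_iff_abs_summable_on_complex has_sum_imp_summable by blast
  have "(\<lambda>\<alpha>. norm (\<Prod>i\<in>UNIV. x i ^ \<alpha> i)) summable_on (UNIV :: ('n \<Rightarrow> nat) set)"
    by (rule abs_summable_prod[OF ab])
  then have s: "(\<lambda>\<alpha>. \<Prod>i\<in>UNIV. x i ^ \<alpha> i) summable_on (UNIV :: ('n \<Rightarrow> nat) set)"
    by (rule abs_summable_summable)
  have "infsum (\<lambda>\<alpha>. \<Prod>i\<in>UNIV. x i ^ \<alpha> i) (PiE UNIV (\<lambda>_. UNIV)) = (\<Prod>i\<in>UNIV. infsum (\<lambda>k. x i ^ k) UNIV)"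
    using ab by (intro infsum_prod_PiE_abs) auto
  also have "\<dots> = (\<Prod>i\<in>UNIV. 1 / (1 - x i))"
    by (intro prod.cong refl infsumI geo)
  finally show ?thesis using has_sum_infsum[OF s] by (simp add: PiE_UNIV_domain)
qed

section \<open>The torus and the Cauchy formula on the polydisc\<close>

definition monomial_at :: "('n::finite \<Rightarrow> nat) \<Rightarrow> complex ^ 'n \<Rightarrow> complex" where
  "monomial_at \<alpha> z = (\<Prod>i\<in>UNIV. (z $ i) ^ \<alpha> i)"

abbreviation angles :: "('n::finite \<Rightarrow> real) measure" where
  "angles \<equiv> Pi\<^sub>M UNIV (\<lambda>_. circ)"

definition torus_point :: "('n::finite \<Rightarrow> real) \<Rightarrow> complex ^ 'n" where
  "torus_point \<theta> = (\<chi> i. cis (\<theta> i))"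

lemma torus_point_nth [simp]: "torus_point \<theta> $ i = cis (\<theta> i)"
  by (simp add: torus_point_def)

lemma prob_space_angles: "prob_space (angles :: ('n::finite \<Rightarrow> real) measure)"
  by (intro prob_space_PiM prob_space_circ)

lemma product_sigma_finite_circ: "product_sigma_finite (\<lambda>_. circ)"
  by (intro product_sigma_finite.intro prob_space_imp_sigma_finite prob_space_circ)

lemma measurable_angle [measurable]: "(\<lambda>\<theta>. \<theta> i) \<in> borel_measurable (Pi\<^sub>M (UNIV :: 'n::finite set) (\<lambda>_. circ))"
proof -
  have "(\<lambda>\<theta>. \<theta> i) \<in> measurable (Pi\<^sub>M (UNIV :: 'n::finite set) (\<lambda>_. circ)) circ"
    by (rule measurable_component_singleton) simp
  then show ?thesis by (simp add: measurable_def)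
qed

lemma borel_measurable_vecI:
  fixes g :: "'a \<Rightarrow> complex ^ 'n::finite"
  assumes "\<And>i. (\<lambda>x. g x $ i) \<in> borel_measurable M"
  shows "g \<in> borel_measurable M"
proof -
  have "(\<lambda>x. g x \<bullet> b) \<in> borel_measurable M" if "b \<in> Basis" for b
  proof -
    obtain i u where "b = axis i u" using \<open>b \<in> Basis\<close> unfolding Basis_vec_def by blast
    moreover have [measurable]: "(\<lambda>x. g x $ i) \<in> borel_measurable M" by (rule assms)
    ultimately show ?thesis by (simp add: inner_axis)
  qed
  then show ?thesis using borel_measurable_euclidean_space by blast
qed

lemma measurable_torus_point [measurable]:
  "(torus_point :: ('n::finite \<Rightarrow> real) \<Rightarrow> _) \<in> borel_measurable angles"
  by (rule borel_measurable_vecI) (simp add: measurable_compose[OF measurable_angle borel_measurable_continuous_onI[OF continuous_on_cis[OF continuous_on_id]]])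

lemma torus_measure_eq: "torus_measure = distr angles borel (torus_point :: ('n::finite \<Rightarrow> real) \<Rightarrow> _)"
  unfolding torus_measure_def torus_point_def by simp

lemma scaleR_torus_point_in_polydisc: "0 \<le> r \<Longrightarrow> r < 1 \<Longrightarrow> r *\<^sub>R torus_point \<theta> \<in> polydisc"
  by (simp add: polydisc_def vector_scaleR_component)

lemma polydisc_radius:
  assumes "z \<in> polydisc"
  obtains r where "1/2 < r" "r < 1" "\<And>i. cmod (z $ i) < r"
proof -
  define m where "m = Max (insert (1/2) (range (\<lambda>i. cmod (z $ i))))"
  have m: "cmod (z $ i) \<le> m" "1/2 \<le> m" for i unfolding m_def by (intro Max_ge; simp)+
  have "m < 1" using assms by (simp add: m_def polydisc_def)
  show ?thesis
  proof (rule that[of "(m + 1) / 2"])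
    show "cmod (z $ i) < (m + 1) / 2" for i using m(1)[of i] \<open>m < 1\<close> by simp
  qed (use m(2) \<open>m < 1\<close> in auto)
qed

lemma open_polydisc: "open (polydisc :: (complex ^ 'n::finite) set)"
proof -
  have "open (\<Inter>i. {z :: complex ^ 'n. cmod (z $ i) < 1})"
    by (intro open_INT ballI finite open_Collect_less continuous_intros)
  then show ?thesis by (simp add: polydisc_def Collect_all_eq)
qed

lemma analytic_polydisc_continuous_on: "analytic_polydisc f \<Longrightarrow> continuous_on polydisc f"
  unfolding analytic_polydisc_def
  by (meson continuous_at_imp_continuous_on has_derivative_continuous)

text \<open>
  Functions on the polydisc have arbitrary values elsewhere, so that only their compositions with maps into
  the polydisc can be expected to be measurable.
\<close>
lemma measurable_on_polydisc:
  fixes f :: "complex ^ 'n::finite \<Rightarrow> complex"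
  assumes f: "continuous_on polydisc f" and [measurable]: "g \<in> borel_measurable M"
    and g: "\<And>x. x \<in> space M \<Longrightarrow> g x \<in> polydisc"
  shows "(\<lambda>x. f (g x)) \<in> borel_measurable M"
proof -
  have [measurable]: "(\<lambda>z. indicator polydisc z *\<^sub>R f z) \<in> borel_measurable borel"
    using f by (intro borel_measurable_continuous_on_indicator borel_open open_polydisc)
  have "(\<lambda>x. indicator polydisc (g x) *\<^sub>R f (g x)) \<in> borel_measurable M"
    by measurable
  then show ?thesis
    by (rule measurable_cong[THEN iffD1, rotated]) (simp add: g)
qed

lemma closed_subpolydisc_compact: "compact {z :: complex ^ 'n::finite. \<forall>i. cmod (z $ i) \<le> r}"
proof -
  have "closed {z :: complex ^ 'n. \<forall>i. cmod (z $ i) \<le> r}"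
    by (intro closed_Collect_all closed_Collect_le continuous_intros)
  moreover have "bounded {z :: complex ^ 'n. \<forall>i. cmod (z $ i) \<le> r}"
  proof (rule boundedI)
    fix z :: "complex ^ 'n" assume "z \<in> {z. \<forall>i. cmod (z $ i) \<le> r}"
    then have z: "cmod (z $ i) \<le> r" for i by simp
    have "norm z \<le> (\<Sum>i\<in>UNIV. cmod (z $ i))"
      by (simp add: norm_vec_def L2_set_le_sum)
    also have "\<dots> \<le> (\<Sum>i\<in>(UNIV :: 'n set). r)" using z by (intro sum_mono)
    finally show "norm z \<le> (\<Sum>i\<in>(UNIV :: 'n set). r)" .
  qed
  ultimately show ?thesis by (simp add: compact_eq_bounded_closed)
qed

lemma analytic_bounded_on_subpolydisc:
  fixes f :: "complex ^ 'n::finite \<Rightarrow> complex"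
  assumes "continuous_on polydisc f" and "r < 1"
  obtains K where "\<And>z. (\<And>i. cmod (z $ i) \<le> r) \<Longrightarrow> cmod (f z) \<le> K"
proof -
  let ?C = "{z :: complex ^ 'n::finite. \<forall>i. cmod (z $ i) \<le> r}"
  have "?C \<subseteq> polydisc" using assms(2) by (auto simp: polydisc_def intro: le_less_trans)
  then have "compact (f ` ?C)"
    using assms(1) by (intro compact_continuous_image closed_subpolydisc_compact) (rule continuous_on_subset)
  then obtain K where "\<And>w. w \<in> f ` ?C \<Longrightarrow> cmod w \<le> K"
    using compact_imp_bounded bounded_iff by metis
  then show ?thesis using that[of K] by auto
qed

text \<open>
  Complex linearity of the total derivative enters here: it turns the derivative along the \<open>i\<close>-th
  axis into multiplication by a complex number.
\<close>
lemma holomorphic_in_coordinate: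
  fixes f :: "complex ^ 'n::finite \<Rightarrow> complex"
  assumes f: "analytic_polydisc f" and z: "\<And>j. j \<noteq> i \<Longrightarrow> cmod (z $ j) < 1"
  shows "(\<lambda>u. f (\<chi> j. if j = i then u else z $ j)) holomorphic_on ball 0 1"
  unfolding holomorphic_on_def
proof
  fix u :: complex assume u: "u \<in> ball 0 1"
  define c where "c = (\<lambda>u. (\<chi> j. if j = i then u else z $ j))"
  have "c u \<in> polydisc" using u z by (auto simp: polydisc_def c_def)
  then obtain D where D: "(f has_derivative D) (at (c u))" and lin: "\<And>c v. D (c *s v) = c * D v"
    using f unfolding analytic_polydisc_def by blast
  have "c = (\<lambda>u. (\<chi> j. if j = i then 0 else z $ j) + axis i u)"
    by (auto simp: c_def axis_def vec_eq_iff)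
  moreover have "bounded_linear (axis i :: complex \<Rightarrow> complex ^ 'n)"
  proof (rule bounded_linear_intro[where K = 1])
    fix x y :: complex and r :: real
    show "axis i (x + y) = axis i x + (axis i y :: complex ^ 'n)" by (simp add: vec_eq_iff axis_def)
    show "axis i (r *\<^sub>R x) = r *\<^sub>R (axis i x :: complex ^ 'n)" by (simp add: vec_eq_iff axis_def)
    have "norm (axis i x :: complex ^ 'n) \<le> (\<Sum>j\<in>UNIV. norm (axis i x $ j))"
      by (simp add: norm_vec_def L2_set_le_sum)
    also have "\<dots> = norm x" by (simp add: axis_def if_distrib[of norm] cong: if_cong)
    finally show "norm (axis i x :: complex ^ 'n) \<le> norm x * 1" by simp
  qed
  then have "(axis i has_derivative (axis i :: complex \<Rightarrow> complex ^ 'n)) (at u)"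
    by (rule bounded_linear_imp_has_derivative)
  from has_derivative_add[OF has_derivative_const this]
  have "((\<lambda>u. (\<chi> j. if j = i then 0 else z $ j) + axis i u) has_derivative axis i) (at u)"
    by simp
  ultimately have "(c has_derivative axis i) (at u)" by simp
  then have "((f \<circ> c) has_derivative (D \<circ> axis i)) (at u)"
    using D by (rule diff_chain_at)
  moreover have "D \<circ> axis i = (*) (D (axis i 1))"
  proof
    fix h
    have "axis i h = h *s (axis i 1 :: complex ^ 'n)" by (simp add: vec_eq_iff axis_def)
    then show "(D \<circ> axis i) h = D (axis i 1) * h" by (simp add: lin mult.commute)
  qed
  ultimately have "((f \<circ> c) has_field_derivative D (axis i 1)) (at u)"
    by (simp add: has_field_derivative_def)
  then show "(\<lambda>u. f (\<chi> j. if j = i then u else z $ j)) field_differentiable at u within ball 0 1"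
    unfolding c_def o_def by (meson field_differentiable_at_within field_differentiable_def)
qed

lemma integrable_cauchy_kernel:
  fixes f :: "complex ^ 'n::finite \<Rightarrow> complex" and z :: "complex ^ 'n"
  assumes f: "analytic_polydisc f" and r: "0 < r" "r < 1" and z: "\<And>i. cmod (z $ i) < r"
  shows "integrable angles (\<lambda>\<theta>. f (\<chi> i. if i \<in> B then of_real r * cis (\<theta> i) else z $ i) *
      (\<Prod>i\<in>B. 1 / (1 - z $ i * cis (- \<theta> i) / of_real r)))"
proof -
  define v where "v = (\<lambda>B (\<theta> :: 'n \<Rightarrow> real). (\<chi> j. if j \<in> B then of_real r * cis (\<theta> j) else z $ j) :: complex ^ 'n)"
  define G where "G = (\<lambda>B \<theta>. f (v B \<theta>) * (\<Prod>j\<in>B. 1 / (1 - z $ j * cis (- \<theta> j) / of_real r)))"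
  have cf: "continuous_on polydisc f" using f by (rule analytic_polydisc_continuous_on)
  have vr: "cmod (v B \<theta> $ j) \<le> r" for B \<theta> j
    using r z[of j] by (auto simp: v_def norm_mult less_imp_le)
  have vp: "v B \<theta> \<in> polydisc" for B \<theta>
    using vr r by (auto simp: polydisc_def intro: le_less_trans)
  have vm: "v B \<in> borel_measurable angles" for B
  proof (rule borel_measurable_vecI)
    fix j
    have "(\<lambda>x. cis (x j)) \<in> borel_measurable (angles :: ('n \<Rightarrow> real) measure)"
      by (rule measurable_compose[OF measurable_angle borel_measurable_continuous_onI[OF continuous_on_cis[OF continuous_on_id]]])
    then show "(\<lambda>x. v B x $ j) \<in> borel_measurable angles"
      by (cases "j \<in> B") (auto simp: v_def)
  qed
  obtain K where K: "\<And>u. (\<And>j. cmod (u $ j) \<le> r) \<Longrightarrow> cmod (f u) \<le> K"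
    using analytic_bounded_on_subpolydisc[OF cf r(2)] by metis
  have fac: "cmod (1 / (1 - z $ j * cis t / of_real r)) \<le> 1 / (1 - cmod (z $ j) / r)" for j t
  proof -
    have "1 - cmod (z $ j) / r \<le> cmod (1 - z $ j * cis t / of_real r)"
      using norm_triangle_ineq2[of 1 "z $ j * cis t / of_real r"] r by (simp add: norm_mult norm_divide)
    moreover have "0 < 1 - cmod (z $ j) / r" using z[of j] r by simp
    ultimately show ?thesis by (simp add: norm_divide frac_le)
  qed
  interpret prob_space "angles :: ('n \<Rightarrow> real) measure" by (rule prob_space_angles)
  have m1: "(\<lambda>\<theta>. f (v B \<theta>)) \<in> borel_measurable angles"
    by (rule measurable_on_polydisc[OF cf vm vp])
  have m2: "(\<lambda>\<theta>. 1 / (1 - z $ j * cis (- \<theta> j) / of_real r)) \<in> borel_measurable (angles :: ('n \<Rightarrow> real) measure)" for j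
  proof -
    have "(\<lambda>t. cis (- t)) \<in> borel_measurable borel"
      by (intro borel_measurable_continuous_onI continuous_intros)
    from measurable_compose[OF measurable_angle this]
    have "(\<lambda>\<theta>. cis (- \<theta> j)) \<in> borel_measurable (angles :: ('n \<Rightarrow> real) measure)" .
    then show ?thesis by measurable
  qed
  have "integrable angles (G B)"
  proof (rule integrable_const_bound)
    show "AE \<theta> in angles. cmod (G B \<theta>) \<le> K * (\<Prod>j\<in>B. 1 / (1 - cmod (z $ j) / r))"
    proof (rule AE_I2)
      fix \<theta>
      have "0 \<le> K" using K[OF vr] norm_ge_zero order_trans by blast
      then show "cmod (G B \<theta>) \<le> K * (\<Prod>j\<in>B. 1 / (1 - cmod (z $ j) / r))"
        unfolding G_def norm_mult prod_norm[symmetric]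
        by (intro mult_mono K vr prod_mono prod_nonneg) (auto intro: fac)
    qed
    show "G B \<in> borel_measurable angles"
      unfolding G_def using m1 m2 by (intro borel_measurable_times borel_measurable_prod) auto
  qed
  then show ?thesis by (simp add: G_def v_def)
qed

text \<open>
  The coordinates are replaced by points of the circle one at a time. The induction is over the set
  \<open>A\<close> of coordinates that have been replaced; a step integrates over the new angle only, by
  Fubini, and is Cauchy's formula in that coordinate.
\<close>
lemma cauchy_torus:
  fixes f :: "complex ^ 'n::finite \<Rightarrow> complex" and z :: "complex ^ 'n"
  assumes f: "analytic_polydisc f" and r: "0 < r" "r < 1" and z: "\<And>i. cmod (z $ i) < r"
    and A: "finite A"
  shows "(LINT \<theta>|angles. f (\<chi> i. if i \<in> A then of_real r * cis (\<theta> i) else z $ i) *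
      (\<Prod>i\<in>A. 1 / (1 - z $ i * cis (- \<theta> i) / of_real r))) = f z"
  using A
proof induction
  case empty
  then show ?case using prob_space.prob_space[OF prob_space_angles[where 'n = 'n]] by simp
next
  case (insert i A)
  define v where "v = (\<lambda>B (\<theta> :: 'n \<Rightarrow> real). (\<chi> j. if j \<in> B then of_real r * cis (\<theta> j) else z $ j) :: complex ^ 'n)"
  define G where "G = (\<lambda>B \<theta>. f (v B \<theta>) * (\<Prod>j\<in>B. 1 / (1 - z $ j * cis (- \<theta> j) / of_real r)))"
  have vr: "cmod (v B \<theta> $ j) \<le> r" for B \<theta> j
    using r z[of j] by (auto simp: v_def norm_mult less_imp_le)
  have vp: "v B \<theta> \<in> polydisc" for B \<theta>
    using vr r by (auto simp: polydisc_def intro: le_less_trans)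
  have int: "integrable angles (G B)" for B
    unfolding G_def v_def using f r z by (rule integrable_cauchy_kernel)
  interpret PS: product_sigma_finite "\<lambda>_ :: 'n. circ" by (rule product_sigma_finite_circ)
  have split: "(LINT \<theta>|angles. G B \<theta>) = (LINT x|Pi\<^sub>M (UNIV - {i}) (\<lambda>_. circ). LINT y|circ. G B (x(i := y)))" for B
    using PS.product_integral_insert[of "UNIV - {i}" i "G B"] int[of B] by (simp add: insert_absorb)
  have inner: "(LINT y|circ. G (insert i A) (x(i := y))) = (LINT y|circ. G A (x(i := y)))" for x
  proof -
    define F where "F = (\<lambda>u. f (\<chi> j. if j = i then u else v A x $ j))"
    define p where "p = (\<Prod>j\<in>A. 1 / (1 - z $ j * cis (- x j) / of_real r))"
    have pA: "(\<Prod>j\<in>A. 1 / (1 - z $ j * cis (- (x(i := y)) j) / of_real r)) = p" for y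
      unfolding p_def using insert.hyps by (intro prod.cong) auto
    have "v (insert i A) (x(i := y)) = (\<chi> j. if j = i then of_real r * cis y else v A x $ j)" for y
      by (auto simp: v_def vec_eq_iff)
    then have 1: "G (insert i A) (x(i := y)) = p * (F (of_real r * cis y) / (1 - z $ i * cis (- y) / of_real r))" for y
      using insert.hyps pA[of y] by (simp add: G_def F_def)
    have "v A (x(i := y)) = v A x" for y
      using insert.hyps by (auto simp: v_def vec_eq_iff)
    moreover have "(\<chi> j. if j = i then z $ i else v A x $ j) = v A x"
      using insert.hyps by (auto simp: v_def vec_eq_iff)
    ultimately have 2: "G A (x(i := y)) = p * F (z $ i)" for y
      using pA[of y] by (simp add: G_def F_def)
    have "F holomorphic_on ball 0 1"
      unfolding F_def using vp[of A x] by (intro holomorphic_in_coordinate f) (simp add: polydisc_def)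
    then have "(LINT y|circ. F (of_real r * cis y) / (1 - z $ i * cis (- y) / of_real r)) = F (z $ i)"
      using r z by (intro cauchy_circ) auto
    then show ?thesis
      using prob_space.prob_space[OF prob_space_circ] by (simp add: 1 2 del: times_divide_eq_right)
  qed
  have "(LINT \<theta>|angles. G (insert i A) \<theta>) = (LINT \<theta>|angles. G A \<theta>)"
    by (simp add: split inner)
  also have "\<dots> = f z" using insert.IH by (simp add: G_def v_def)
  finally show ?case by (simp add: G_def v_def)
qed

section \<open>Taylor series on the polydisc\<close>

lemma monomial_at_scaleR:
  "monomial_at \<alpha> (r *\<^sub>R z) = of_real (r ^ (\<Sum>i\<in>UNIV. \<alpha> i)) * monomial_at \<alpha> z"
proof -
  have "monomial_at \<alpha> (r *\<^sub>R z) = (\<Prod>i\<in>UNIV. of_real r ^ \<alpha> i * (z $ i) ^ \<alpha> i)"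
    by (simp add: monomial_at_def vector_scaleR_component scaleR_conv_of_real[where 'a = complex] power_mult_distrib)
  then show ?thesis by (simp add: prod.distrib monomial_at_def power_sum)
qed

lemma norm_monomial_torus [simp]: "cmod (monomial_at \<alpha> (torus_point \<theta>)) = 1"
  by (simp add: monomial_at_def norm_power flip: prod_norm)

lemma measurable_monomial:
  "(\<lambda>\<theta>. monomial_at \<alpha> (torus_point \<theta>)) \<in> borel_measurable angles"
  "(\<lambda>\<theta>. cnj (monomial_at \<alpha> (torus_point \<theta>))) \<in> borel_measurable angles"
proof -
  have "continuous_on UNIV (monomial_at \<alpha> :: complex ^ 'a \<Rightarrow> complex)"
    unfolding monomial_at_def by (intro continuous_intros)
  then show "(\<lambda>\<theta>. monomial_at \<alpha> (torus_point \<theta>)) \<in> borel_measurable angles"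
    "(\<lambda>\<theta>. cnj (monomial_at \<alpha> (torus_point \<theta>))) \<in> borel_measurable angles"
    by (intro measurable_compose[OF measurable_torus_point borel_measurable_continuous_onI] continuous_intros; assumption)+
qed

lemma integrable_bounded_angles:
  fixes h :: "('n::finite \<Rightarrow> real) \<Rightarrow> complex"
  assumes "h \<in> borel_measurable angles" "\<And>\<theta>. cmod (h \<theta>) \<le> K"
  shows "integrable angles h"
proof -
  interpret prob_space "angles :: ('n \<Rightarrow> real) measure" by (rule prob_space_angles)
  show ?thesis using assms by (intro integrable_const_bound[where B = K]) auto
qed

lemma monomials_orthonormal:
  "(LINT \<theta>|angles. monomial_at \<alpha> (torus_point \<theta>) * cnj (monomial_at \<beta> (torus_point \<theta>))) =
    (if \<alpha> = \<beta> then 1 else 0)"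
proof -
  interpret PS: product_sigma_finite "\<lambda>_ :: 'a. circ" by (rule product_sigma_finite_circ)
  interpret prob_space circ by (rule prob_space_circ)
  have int: "integrable circ (\<lambda>t. cis t ^ m * cnj (cis t) ^ k)" for m k
  proof (rule integrable_const_bound[where B = 1])
    have "(\<lambda>t. cis t ^ m * cnj (cis t) ^ k) \<in> borel_measurable borel"
      by (intro borel_measurable_continuous_onI continuous_intros)
    then show "(\<lambda>t. cis t ^ m * cnj (cis t) ^ k) \<in> borel_measurable circ"
      by (simp add: measurable_def)
  qed (simp add: norm_mult norm_power)
  have "(LINT \<theta>|angles. monomial_at \<alpha> (torus_point \<theta>) * cnj (monomial_at \<beta> (torus_point \<theta>))) =
      (LINT \<theta>|angles. (\<Prod>i\<in>UNIV. cis (\<theta> i) ^ \<alpha> i * cnj (cis (\<theta> i)) ^ \<beta> i))"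
    by (simp add: monomial_at_def prod.distrib)
  also have "\<dots> = (\<Prod>i\<in>UNIV. LINT t|circ. cis t ^ \<alpha> i * cnj (cis t) ^ \<beta> i)"
    using int by (intro PS.product_integral_prod) auto
  also have "\<dots> = (\<Prod>i\<in>UNIV. if \<alpha> i = \<beta> i then 1 else 0)"
    by (simp only: circ_integral_cis)
  also have "\<dots> = (if \<alpha> = \<beta> then 1 else 0)"
    by (auto simp: fun_eq_iff)
  finally show ?thesis .
qed

lemma measurable_slice:
  fixes f :: "complex ^ 'n::finite \<Rightarrow> complex"
  assumes "continuous_on polydisc f" "0 \<le> r" "r < 1"
  shows "(\<lambda>\<theta>. f (r *\<^sub>R torus_point \<theta>)) \<in> borel_measurable angles"
  using assms by (intro measurable_on_polydisc scaleR_torus_point_in_polydisc) auto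

lemma slice_bounded:
  fixes f :: "complex ^ 'n::finite \<Rightarrow> complex"
  assumes "continuous_on polydisc f" "0 \<le> r" "r < 1"
  obtains K where "\<And>\<theta>. cmod (f (r *\<^sub>R torus_point \<theta>)) \<le> K"
  using analytic_bounded_on_subpolydisc[OF assms(1,3)] assms(2)
  by (metis abs_of_nonneg mult.right_neutral norm_cis norm_scaleR order_refl torus_point_nth vector_scaleR_component)

definition fourier_coeff :: "(complex ^ 'n::finite \<Rightarrow> complex) \<Rightarrow> real \<Rightarrow> ('n \<Rightarrow> nat) \<Rightarrow> complex" where
  "fourier_coeff f r \<alpha> = (LINT \<theta>|angles. f (r *\<^sub>R torus_point \<theta>) * cnj (monomial_at \<alpha> (torus_point \<theta>)))"

lemma integrable_slice_monomial:
  fixes f :: "complex ^ 'n::finite \<Rightarrow> complex"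
  assumes "continuous_on polydisc f" "0 \<le> r" "r < 1"
  shows "integrable angles (\<lambda>\<theta>. f (r *\<^sub>R torus_point \<theta>) * cnj (monomial_at \<alpha> (torus_point \<theta>)))"
proof -
  obtain K where K: "\<And>\<theta> :: 'n \<Rightarrow> real. cmod (f (r *\<^sub>R torus_point \<theta>)) \<le> K"
    using slice_bounded[OF assms] by blast
  show ?thesis
  proof (rule integrable_bounded_angles)
    show "(\<lambda>\<theta>. f (r *\<^sub>R torus_point \<theta>) * cnj (monomial_at \<alpha> (torus_point \<theta>))) \<in> borel_measurable angles"
      by (intro borel_measurable_times measurable_monomial measurable_slice assms)
  qed (use K in \<open>simp add: norm_mult\<close>)
qed

text \<open>
  The Cauchy kernel is a product of geometric series. Integrating its expansion term by term gives a power
  series whose coefficients are Fourier coefficients of \<open>f\<close> on the torus of radius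
  \<open>r\<close>.
\<close>
lemma power_series_from_slice:
  fixes f :: "complex ^ 'n::finite \<Rightarrow> complex"
  assumes f: "analytic_polydisc f" and r: "0 < r" "r < 1" and z: "\<And>i. cmod (z $ i) < r"
  shows "((\<lambda>\<alpha>. fourier_coeff f r \<alpha> / of_real (r ^ (\<Sum>i\<in>UNIV. \<alpha> i)) * monomial_at \<alpha> z) has_sum f z) UNIV"
proof -
  have cf: "continuous_on polydisc f" using f by (rule analytic_polydisc_continuous_on)
  obtain K where K: "\<And>\<theta> :: 'n \<Rightarrow> real. cmod (f (r *\<^sub>R torus_point \<theta>)) \<le> K"
    using slice_bounded[OF cf] r by (metis less_imp_le)
  define c where "c = (\<lambda>\<alpha>. monomial_at \<alpha> z / of_real (r ^ (\<Sum>i\<in>UNIV. \<alpha> i)))"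
  have c: "c \<alpha> = (\<Prod>i\<in>UNIV. (z $ i / of_real r) ^ \<alpha> i)" for \<alpha>
    by (simp add: c_def monomial_at_def power_divide prod_dividef power_sum)
  have "cmod (z $ i / of_real r) < 1" for i
    using r z[of i] by (simp add: norm_divide)
  from has_sum_prod_geometric[where x = "\<lambda>i. z $ i / of_real r", OF this]
  have "c summable_on UNIV"
    unfolding c by (rule has_sum_imp_summable)
  then have csum: "(\<lambda>\<alpha>. cmod (c \<alpha>)) summable_on UNIV"
    by (simp only: summable_on_iff_abs_summable_on_complex)
  define S where "S = (\<lambda>\<theta>. f (r *\<^sub>R torus_point \<theta>) * (\<Prod>i\<in>UNIV. 1 / (1 - z $ i * cis (- \<theta> i) / of_real r)))"
  have tp: "r *\<^sub>R torus_point \<theta> = (\<chi> i. if i \<in> UNIV then of_real r * cis (\<theta> i) else z $ i)" for \<theta> :: "'n \<Rightarrow> real"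
    by (simp add: vec_eq_iff vector_scaleR_component scaleR_conv_of_real[where 'a = complex])
  have S: "integrable angles S" "(LINT \<theta>|angles. S \<theta>) = f z"
    using integrable_cauchy_kernel[OF f r z, where B = UNIV] cauchy_torus[OF f r z, of UNIV]
    unfolding S_def tp by simp_all
  have "((\<lambda>\<alpha>. c \<alpha> * (LINT \<theta>|angles. f (r *\<^sub>R torus_point \<theta>) * cnj (monomial_at \<alpha> (torus_point \<theta>)))) has_sum (LINT \<theta>|angles. S \<theta>)) UNIV"
  proof (rule has_sum_integral[OF prob_space_angles S(1) _ _ csum])
    show "integrable angles (\<lambda>\<theta>. f (r *\<^sub>R torus_point \<theta>) * cnj (monomial_at \<alpha> (torus_point \<theta>)))" for \<alpha>
      using r by (intro integrable_slice_monomial cf) auto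
    show "cmod (f (r *\<^sub>R torus_point \<theta>) * cnj (monomial_at \<alpha> (torus_point \<theta>))) \<le> K" for \<alpha> and \<theta> :: "'n \<Rightarrow> real"
      using K by (simp add: norm_mult)
    fix \<theta> :: "'n \<Rightarrow> real"
    have "cmod (z $ i * cis (- \<theta> i) / of_real r) < 1" for i
      using r z[of i] by (simp add: norm_divide norm_mult)
    from has_sum_cmult_right[OF has_sum_prod_geometric[where x = "\<lambda>i. z $ i * cis (- \<theta> i) / of_real r", OF this], of "f (r *\<^sub>R torus_point \<theta>)"]
    have "((\<lambda>\<alpha>. f (r *\<^sub>R torus_point \<theta>) * (\<Prod>i\<in>UNIV. (z $ i * cis (- \<theta> i) / of_real r) ^ \<alpha> i)) has_sum S \<theta>) UNIV"
      by (simp add: S_def)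
    moreover have "(\<Prod>i\<in>UNIV. (z $ i * cis (- \<theta> i) / of_real r) ^ \<alpha> i) = c \<alpha> * cnj (monomial_at \<alpha> (torus_point \<theta>))" for \<alpha>
      by (simp add: c monomial_at_def power_mult_distrib power_divide cis_cnj flip: prod.distrib)
    ultimately show "((\<lambda>\<alpha>. c \<alpha> * (f (r *\<^sub>R torus_point \<theta>) * cnj (monomial_at \<alpha> (torus_point \<theta>)))) has_sum S \<theta>) UNIV"
      by (simp add: mult_ac)
  qed
  then show ?thesis
    unfolding S fourier_coeff_def c_def by (simp add: mult_ac)
qed

text \<open>
  For complex series unconditional and absolute convergence agree; evaluation at the point with all
  coordinates equal to \<open>r\<close> therefore bounds the series on the whole torus of radius
  \<open>r\<close>.
\<close>
lemma abs_summable_on_slice: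
  fixes a :: "('n::finite \<Rightarrow> nat) \<Rightarrow> complex"
  assumes sum: "\<And>z. (\<And>i. cmod (z $ i) < s) \<Longrightarrow> (\<lambda>\<alpha>. a \<alpha> * monomial_at \<alpha> z) summable_on UNIV"
    and r: "0 \<le> r" "r < s"
  shows "(\<lambda>\<alpha>. cmod (a \<alpha> * of_real (r ^ (\<Sum>i\<in>UNIV. \<alpha> i)))) summable_on UNIV"
proof -
  have "(\<lambda>\<alpha>. a \<alpha> * monomial_at \<alpha> (r *\<^sub>R (\<chi> i. 1))) summable_on UNIV"
    using r by (intro sum) (simp add: vector_scaleR_component)
  then have "(\<lambda>\<alpha>. a \<alpha> * of_real (r ^ (\<Sum>i\<in>UNIV. \<alpha> i))) summable_on UNIV"
    by (simp add: monomial_at_scaleR) (simp add: monomial_at_def)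
  then show ?thesis by (simp only: summable_on_iff_abs_summable_on_complex)
qed

lemma fourier_coeff_power_series:
  fixes f :: "complex ^ 'n::finite \<Rightarrow> complex"
  assumes cf: "continuous_on polydisc f" and s: "s \<le> 1"
    and sum: "\<And>z. (\<And>i. cmod (z $ i) < s) \<Longrightarrow> ((\<lambda>\<alpha>. a \<alpha> * monomial_at \<alpha> z) has_sum f z) UNIV"
    and r: "0 \<le> r" "r < s"
  shows "fourier_coeff f r \<beta> = a \<beta> * of_real (r ^ (\<Sum>i\<in>UNIV. \<beta> i))"
proof -
  define c where "c = (\<lambda>\<alpha>. a \<alpha> * complex_of_real (r ^ (\<Sum>i\<in>UNIV. \<alpha> i)))"
  let ?e = "\<lambda>\<alpha> (\<theta> :: 'n \<Rightarrow> real). monomial_at \<alpha> (torus_point \<theta>)"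
  have "((\<lambda>\<alpha>. c \<alpha> * (LINT \<theta>|angles. ?e \<alpha> \<theta> * cnj (?e \<beta> \<theta>))) has_sum fourier_coeff f r \<beta>) UNIV"
    unfolding fourier_coeff_def
  proof (rule has_sum_integral[OF prob_space_angles])
    show "(\<lambda>\<alpha>. cmod (c \<alpha>)) summable_on UNIV"
      unfolding c_def using sum has_sum_imp_summable r by (intro abs_summable_on_slice) blast+
    show "integrable angles (\<lambda>\<theta>. f (r *\<^sub>R torus_point \<theta>) * cnj (?e \<beta> \<theta>))"
      using r s by (intro integrable_slice_monomial cf) auto
    show "integrable angles (\<lambda>\<theta>. ?e \<alpha> \<theta> * cnj (?e \<beta> \<theta>))" for \<alpha>
      by (rule integrable_bounded_angles[where K = 1]) (auto simp: norm_mult intro!: borel_measurable_times measurable_monomial)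
    show "cmod (?e \<alpha> \<theta> * cnj (?e \<beta> \<theta>)) \<le> 1" for \<alpha> \<theta> by (simp add: norm_mult)
    fix \<theta> :: "'n \<Rightarrow> real"
    have "((\<lambda>\<alpha>. a \<alpha> * monomial_at \<alpha> (r *\<^sub>R torus_point \<theta>)) has_sum f (r *\<^sub>R torus_point \<theta>)) UNIV"
      using r by (intro sum) (simp add: vector_scaleR_component)
    from has_sum_cmult_left[OF this, of "cnj (?e \<beta> \<theta>)"]
    show "((\<lambda>\<alpha>. c \<alpha> * (?e \<alpha> \<theta> * cnj (?e \<beta> \<theta>))) has_sum f (r *\<^sub>R torus_point \<theta>) * cnj (?e \<beta> \<theta>)) UNIV"
      by (simp add: c_def monomial_at_scaleR mult.assoc)
  qed
  then have "((\<lambda>\<alpha>. if \<alpha> = \<beta> then c \<alpha> else 0) has_sum fourier_coeff f r \<beta>) UNIV"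
    by (simp only: monomials_orthonormal if_distrib[of "\<lambda>t. _ * t"] mult_1_right mult_zero_right)
  moreover have "((\<lambda>\<alpha>. if \<alpha> = \<beta> then c \<alpha> else 0) has_sum c \<beta>) UNIV"
    using has_sum_finite_neutralI[of "{\<beta>}" UNIV "\<lambda>\<alpha>. if \<alpha> = \<beta> then c \<alpha> else 0"] by simp
  ultimately show ?thesis unfolding c_def using has_sum_unique by blast
qed

text \<open>
  The radius \<open>1/2\<close> is an arbitrary choice; every radius below \<open>1\<close> yields the same
  coefficients.
\<close>
definition taylor_coeff :: "(complex ^ 'n::finite \<Rightarrow> complex) \<Rightarrow> ('n \<Rightarrow> nat) \<Rightarrow> complex" where
  "taylor_coeff f \<alpha> = fourier_coeff f (1/2) \<alpha> / of_real ((1/2) ^ (\<Sum>i\<in>UNIV. \<alpha> i))"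

text \<open>
  The series obtained from a radius \<open>r > 1/2\<close> also represents \<open>f\<close> on the torus of
  radius \<open>1/2\<close>, and the orthogonality of the monomials there identifies its coefficients with
  \<open>taylor_coeff f\<close>.
\<close>
lemma taylor_series:
  fixes f :: "complex ^ 'n::finite \<Rightarrow> complex"
  assumes f: "analytic_polydisc f" and z: "z \<in> polydisc"
  shows "((\<lambda>\<alpha>. taylor_coeff f \<alpha> * monomial_at \<alpha> z) has_sum f z) UNIV"
proof -
  have cf: "continuous_on polydisc f" using f by (rule analytic_polydisc_continuous_on)
  obtain r where r: "1/2 < r" "r < 1" "\<And>i. cmod (z $ i) < r" using polydisc_radius[OF z] by blast
  have r0: "0 < r" using r(1) by simp
  have "fourier_coeff f (1/2) \<alpha> = fourier_coeff f r \<alpha> / of_real (r ^ (\<Sum>i\<in>UNIV. \<alpha> i)) * of_real ((1/2) ^ (\<Sum>i\<in>UNIV. \<alpha> i))" for \<alpha>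
  proof (rule fourier_coeff_power_series[OF cf, where s = r])
    show "((\<lambda>\<alpha>. fourier_coeff f r \<alpha> / of_real (r ^ (\<Sum>i\<in>UNIV. \<alpha> i)) * monomial_at \<alpha> z) has_sum f z) UNIV"
      if "\<And>i. cmod (z $ i) < r" for z
      using that r r0 by (intro power_series_from_slice f) auto
  qed (use r in auto)
  then have "taylor_coeff f \<alpha> = fourier_coeff f r \<alpha> / of_real (r ^ (\<Sum>i\<in>UNIV. \<alpha> i))" for \<alpha>
    by (simp add: taylor_coeff_def)
  then show ?thesis using power_series_from_slice[OF f r0 r(2,3)] by simp
qed

lemma taylor_coeff_unique:
  fixes f :: "complex ^ 'n::finite \<Rightarrow> complex"
  assumes "continuous_on polydisc f"
    and "\<And>z. z \<in> polydisc \<Longrightarrow> ((\<lambda>\<alpha>. a \<alpha> * monomial_at \<alpha> z) has_sum f z) UNIV"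
  shows "taylor_coeff f = a"
proof
  fix \<alpha>
  have "fourier_coeff f (1/2) \<alpha> = a \<alpha> * of_real ((1/2) ^ (\<Sum>i\<in>UNIV. \<alpha> i))"
    using assms by (intro fourier_coeff_power_series[where s = 1]) (auto simp: polydisc_def)
  then show "taylor_coeff f \<alpha> = a \<alpha>" by (simp add: taylor_coeff_def)
qed

section \<open>The Hardy norm in terms of Taylor coefficients\<close>

definition slice_integral :: "(complex ^ 'n::finite \<Rightarrow> complex) \<Rightarrow> real \<Rightarrow> real" where
  "slice_integral f r = (LINT \<theta>|angles. (cmod (f (r *\<^sub>R torus_point \<theta>)))\<^sup>2)"

lemma integrable_slice_square:
  fixes f :: "complex ^ 'n::finite \<Rightarrow> complex"
  assumes "continuous_on polydisc f" "0 \<le> r" "r < 1"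
  shows "integrable angles (\<lambda>\<theta>. (cmod (f (r *\<^sub>R torus_point \<theta>)))\<^sup>2)"
proof -
  interpret prob_space "angles :: ('n \<Rightarrow> real) measure" by (rule prob_space_angles)
  obtain K where K: "\<And>\<theta> :: 'n \<Rightarrow> real. cmod (f (r *\<^sub>R torus_point \<theta>)) \<le> K"
    using slice_bounded[OF assms] by blast
  have m: "(\<lambda>\<theta>. f (r *\<^sub>R torus_point \<theta>)) \<in> borel_measurable angles"
    using assms by (rule measurable_slice)
  show ?thesis
    using K by (intro integrable_const_bound[where B = "K\<^sup>2"] borel_measurable_power[OF measurable_compose[OF m borel_measurable_norm]])
      (auto intro!: power_mono)
qed

lemma parseval_slice:
  fixes f :: "complex ^ 'n::finite \<Rightarrow> complex"
  assumes f: "analytic_polydisc f" and r: "0 \<le> r" "r < 1"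
  shows "((\<lambda>\<alpha>. (cmod (taylor_coeff f \<alpha>))\<^sup>2 * r ^ (2 * (\<Sum>i\<in>UNIV. \<alpha> i))) has_sum slice_integral f r) UNIV"
proof -
  have cf: "continuous_on polydisc f" using f by (rule analytic_polydisc_continuous_on)
  let ?e = "\<lambda>\<alpha> (\<theta> :: 'n \<Rightarrow> real). monomial_at \<alpha> (torus_point \<theta>)"
  let ?f = "\<lambda>\<theta> :: 'n \<Rightarrow> real. f (r *\<^sub>R torus_point \<theta>)"
  define c where "c = (\<lambda>\<alpha>. cnj (taylor_coeff f \<alpha>) * complex_of_real (r ^ (\<Sum>i\<in>UNIV. \<alpha> i)))"
  obtain K where K: "\<And>\<theta> :: 'n \<Rightarrow> real. cmod (?f \<theta>) \<le> K"
    using slice_bounded[OF cf r] by blast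
  have sum1: "(\<lambda>\<alpha>. taylor_coeff f \<alpha> * monomial_at \<alpha> z) summable_on UNIV" if "\<And>i. cmod (z $ i) < 1" for z
    using taylor_series[OF f, of z] that has_sum_imp_summable by (auto simp: polydisc_def)
  have "((\<lambda>\<alpha>. c \<alpha> * (LINT \<theta>|angles. ?f \<theta> * cnj (?e \<alpha> \<theta>))) has_sum
      (LINT \<theta>|angles. complex_of_real ((cmod (?f \<theta>))\<^sup>2))) UNIV"
  proof (rule has_sum_integral[OF prob_space_angles])
    have "(\<lambda>\<alpha>. cmod (taylor_coeff f \<alpha> * of_real (r ^ (\<Sum>i\<in>UNIV. \<alpha> i)))) summable_on UNIV"
      using sum1 r by (rule abs_summable_on_slice)
    then show "(\<lambda>\<alpha>. cmod (c \<alpha>)) summable_on UNIV"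
      by (simp add: c_def norm_mult)
    show "integrable angles (\<lambda>\<theta>. complex_of_real ((cmod (?f \<theta>))\<^sup>2))"
      by (intro integrable_of_real integrable_slice_square cf r)
    show "integrable angles (\<lambda>\<theta>. ?f \<theta> * cnj (?e \<alpha> \<theta>))" for \<alpha>
      by (intro integrable_slice_monomial cf r)
    show "cmod (?f \<theta> * cnj (?e \<alpha> \<theta>)) \<le> K" for \<alpha> \<theta> using K by (simp add: norm_mult)
    fix \<theta> :: "'n \<Rightarrow> real"
    have "((\<lambda>\<alpha>. taylor_coeff f \<alpha> * monomial_at \<alpha> (r *\<^sub>R torus_point \<theta>)) has_sum ?f \<theta>) UNIV"
      using f scaleR_torus_point_in_polydisc[OF r] by (rule taylor_series)
    then have "((\<lambda>\<alpha>. cnj (taylor_coeff f \<alpha> * monomial_at \<alpha> (r *\<^sub>R torus_point \<theta>))) has_sum cnj (?f \<theta>)) UNIV"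
      by (simp only: has_sum_cnj_iff)
    from has_sum_cmult_left[OF this, of "?f \<theta>"]
    show "((\<lambda>\<alpha>. c \<alpha> * (?f \<theta> * cnj (?e \<alpha> \<theta>))) has_sum complex_of_real ((cmod (?f \<theta>))\<^sup>2)) UNIV"
      by (simp add: c_def monomial_at_scaleR complex_norm_square mult_ac del: of_real_power)
  qed
  moreover have "c \<alpha> * (LINT \<theta>|angles. ?f \<theta> * cnj (?e \<alpha> \<theta>)) =
      complex_of_real ((cmod (taylor_coeff f \<alpha>))\<^sup>2 * r ^ (2 * (\<Sum>i\<in>UNIV. \<alpha> i)))" for \<alpha>
  proof -
    have "fourier_coeff f r \<alpha> = taylor_coeff f \<alpha> * of_real (r ^ (\<Sum>i\<in>UNIV. \<alpha> i))"
      by (rule fourier_coeff_power_series[OF cf order_refl]) (use r f taylor_series in \<open>auto simp: polydisc_def\<close>)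
    then have "c \<alpha> * (LINT \<theta>|angles. ?f \<theta> * cnj (?e \<alpha> \<theta>)) =
        (taylor_coeff f \<alpha> * cnj (taylor_coeff f \<alpha>)) * complex_of_real (r ^ (\<Sum>i\<in>UNIV. \<alpha> i) * r ^ (\<Sum>i\<in>UNIV. \<alpha> i))"
      unfolding fourier_coeff_def c_def by simp
    then show ?thesis
      by (simp only: complex_norm_square[symmetric] of_real_mult[symmetric] power_add[symmetric] mult_2)
  qed
  moreover have "(LINT \<theta>|angles. complex_of_real ((cmod (?f \<theta>))\<^sup>2)) = complex_of_real (slice_integral f r)"
    unfolding slice_integral_def by (rule integral_complex_of_real)
  ultimately have "((\<lambda>\<alpha>. complex_of_real ((cmod (taylor_coeff f \<alpha>))\<^sup>2 * r ^ (2 * (\<Sum>i\<in>UNIV. \<alpha> i)))) has_sum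
      complex_of_real (slice_integral f r)) UNIV"
    by (simp only:)
  then show ?thesis by (simp only: has_sum_of_real_iff)
qed

lemma slice_integral_mono:
  assumes "analytic_polydisc f" "0 \<le> r" "r \<le> s" "s < 1"
  shows "slice_integral f r \<le> slice_integral f s"
  using assms by (intro has_sum_mono[OF parseval_slice parseval_slice] mult_left_mono power_mono) auto

lemma slice_integral_nonneg: "0 \<le> slice_integral f r"
  unfolding slice_integral_def by (rule integral_nonneg_AE) simp

lemma hardy_sup_slice_integral:
  fixes f :: "complex ^ 'n::finite \<Rightarrow> complex"
  assumes f: "analytic_polydisc f" and off: "\<And>z. z \<notin> polydisc \<Longrightarrow> f z = 0"
  shows "hardy_sup f = (SUP r\<in>{0..<1}. ennreal (slice_integral f r))"
  unfolding hardy_sup_def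
proof (intro SUP_cong refl)
  fix r :: real assume r: "r \<in> {0..<1}"
  have cf: "continuous_on polydisc f" using f by (rule analytic_polydisc_continuous_on)
  have "(\<lambda>z. indicator polydisc z *\<^sub>R f z) \<in> borel_measurable borel"
    using cf by (intro borel_measurable_continuous_on_indicator borel_open open_polydisc)
  moreover have "(\<lambda>z. indicator polydisc z *\<^sub>R f z) = f"
    using off by (auto simp: fun_eq_iff indicator_def)
  ultimately have [measurable]: "f \<in> borel_measurable borel" by simp
  have "(\<integral>\<^sup>+ z. ennreal ((cmod (f (r *\<^sub>R z)))\<^sup>2) \<partial>torus_measure) =
      (\<integral>\<^sup>+ \<theta>. ennreal ((cmod (f (r *\<^sub>R torus_point \<theta>)))\<^sup>2) \<partial>angles)"
    unfolding torus_measure_eq by (rule nn_integral_distr[OF measurable_torus_point]) measurable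
  also have "\<dots> = ennreal (slice_integral f r)"
    unfolding slice_integral_def
    using r by (intro nn_integral_eq_integral integrable_slice_square cf) auto
  finally show "(\<integral>\<^sup>+ z. ennreal ((cmod (f (r *\<^sub>R z)))\<^sup>2) \<partial>torus_measure) = ennreal (slice_integral f r)" .
qed

lemma power_to_one_tendsto:
  "((\<lambda>k. (1 - 1 / (real k + 2)) ^ m) \<longlonglongrightarrow> 1)"
proof -
  have "(\<lambda>k. 1 / (real k + 2)) \<longlonglongrightarrow> 0" by real_asymp
  then have "(\<lambda>k. (1 - 1 / (real k + 2)) ^ m) \<longlonglongrightarrow> (1 - 0) ^ m" by (intro tendsto_intros)
  then show ?thesis by simp
qed

lemma taylor_partial_sum_le:
  fixes f :: "complex ^ 'n::finite \<Rightarrow> complex"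
  assumes f: "analytic_polydisc f" and off: "\<And>z. z \<notin> polydisc \<Longrightarrow> f z = 0"
    and fin: "hardy_sup f < \<infinity>" and F: "finite F"
  shows "(\<Sum>\<alpha>\<in>F. (cmod (taylor_coeff f \<alpha>))\<^sup>2) \<le> enn2real (hardy_sup f)"
proof -
  have sup_eq: "hardy_sup f = (SUP r\<in>{0..<1}. ennreal (slice_integral f r))"
    using f off by (rule hardy_sup_slice_integral)
  have le: "slice_integral f r \<le> enn2real (hardy_sup f)" if "0 \<le> r" "r < 1" for r
  proof -
    have "ennreal (slice_integral f r) \<le> hardy_sup f"
      unfolding sup_eq using that by (intro SUP_upper) auto
    then have "enn2real (ennreal (slice_integral f r)) \<le> enn2real (hardy_sup f)"
      using fin by (intro enn2real_mono) auto
    then show ?thesis by (simp add: slice_integral_nonneg)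
  qed
  let ?S = "\<lambda>k. \<Sum>\<alpha>\<in>F. (cmod (taylor_coeff f \<alpha>))\<^sup>2 * (1 - 1 / (real k + 2)) ^ (2 * (\<Sum>i\<in>UNIV. \<alpha> i))"
  have "?S k \<le> enn2real (hardy_sup f)" for k
    by (rule order_trans[OF finite_sum_le_has_sum[OF parseval_slice[OF f]] le]) (use F in auto)
  moreover have "?S \<longlonglongrightarrow> (\<Sum>\<alpha>\<in>F. (cmod (taylor_coeff f \<alpha>))\<^sup>2 * 1)"
    by (intro tendsto_sum tendsto_mult tendsto_const power_to_one_tendsto)
  ultimately show ?thesis
    by (intro LIMSEQ_le_const2[of ?S]) auto
qed

lemma hardy_sup_finiteD:
  fixes f :: "complex ^ 'n::finite \<Rightarrow> complex"
  assumes f: "analytic_polydisc f" and off: "\<And>z. z \<notin> polydisc \<Longrightarrow> f z = 0" and fin: "hardy_sup f < \<infinity>"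
  shows "(\<lambda>\<alpha>. (cmod (taylor_coeff f \<alpha>))\<^sup>2) summable_on UNIV"
proof (rule nonneg_bdd_above_summable_on)
  show "bdd_above (sum (\<lambda>\<alpha>. (cmod (taylor_coeff f \<alpha>))\<^sup>2) ` {F. F \<subseteq> UNIV \<and> finite F})"
    using taylor_partial_sum_le[OF f _ fin] off by (intro bdd_aboveI2) auto
qed simp

lemma hardy_sup_eq_infsum:
  fixes f :: "complex ^ 'n::finite \<Rightarrow> complex"
  assumes f: "analytic_polydisc f" and off: "\<And>z. z \<notin> polydisc \<Longrightarrow> f z = 0"
    and sum: "(\<lambda>\<alpha>. (cmod (taylor_coeff f \<alpha>))\<^sup>2) summable_on UNIV"
  shows "hardy_sup f = ennreal (\<Sum>\<^sub>\<infinity>\<alpha>. (cmod (taylor_coeff f \<alpha>))\<^sup>2)"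
proof -
  define N where "N = (\<Sum>\<^sub>\<infinity>\<alpha>. (cmod (taylor_coeff f \<alpha>))\<^sup>2)"
  have N: "((\<lambda>\<alpha>. (cmod (taylor_coeff f \<alpha>))\<^sup>2) has_sum N) UNIV"
    unfolding N_def using sum by (rule has_sum_infsum)
  have sup_eq: "hardy_sup f = (SUP r\<in>{0..<1}. ennreal (slice_integral f r))"
    using f off by (rule hardy_sup_slice_integral)
  have "slice_integral f r \<le> N" if "0 \<le> r" "r < 1" for r
    using that by (intro has_sum_mono[OF parseval_slice[OF f] N]) (auto intro!: mult_left_le power_le_one)
  then have up: "hardy_sup f \<le> ennreal N"
    unfolding sup_eq by (intro SUP_least ennreal_leI) auto
  then have fin: "hardy_sup f < \<infinity>" by (metis ennreal_less_top infinity_ennreal_def order_le_less_trans)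
  have "N \<le> enn2real (hardy_sup f)"
    using taylor_partial_sum_le[OF f _ fin] off by (intro has_sum_le_finite_sums[OF N]) auto
  then have "ennreal N \<le> hardy_sup f" using fin by (metis ennreal_enn2real ennreal_leI infinity_ennreal_def)
  with up show ?thesis unfolding N_def[symmetric] by (rule antisym)
qed

lemma hardy_sup_eq_limit:
  fixes f :: "complex ^ 'n::finite \<Rightarrow> complex"
  assumes f: "analytic_polydisc f" and off: "\<And>z. z \<notin> polydisc \<Longrightarrow> f z = 0"
    and lim: "(\<lambda>k. slice_integral f (1 - 1 / (real k + 2))) \<longlonglongrightarrow> C"
  shows "hardy_sup f = ennreal C"
proof -
  have sup_eq: "hardy_sup f = (SUP r\<in>{0..<1}. ennreal (slice_integral f r))"
    using f off by (rule hardy_sup_slice_integral)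
  let ?r = "\<lambda>k. 1 - 1 / (real k + 2)"
  \<comment> \<open>the means increase with the radius, so their limit is their supremum\<close>
  have "incseq (\<lambda>k. slice_integral f (?r k))"
    by (intro incseq_SucI slice_integral_mono f) (auto simp: field_simps)
  then have le: "slice_integral f (?r k) \<le> C" for k using lim by (rule incseq_le)
  show ?thesis
    unfolding sup_eq
  proof (rule antisym)
    show "(SUP r\<in>{0..<1}. ennreal (slice_integral f r)) \<le> ennreal C"
    proof (intro SUP_least ennreal_leI)
      fix r :: real assume r: "r \<in> {0..<1}"
      have "?r \<longlonglongrightarrow> 1" using power_to_one_tendsto[of 1] by simp
      then have "\<forall>\<^sub>F k in sequentially. r < ?r k" using r by (intro order_tendstoD(1)[of _ 1]) auto
      then obtain k where "r < ?r k" using eventually_happens' sequentially_bot by blast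
      then have "slice_integral f r \<le> slice_integral f (?r k)"
        using r by (intro slice_integral_mono f) auto
      then show "slice_integral f r \<le> C" using le order_trans by blast
    qed
    show "ennreal C \<le> (SUP r\<in>{0..<1}. ennreal (slice_integral f r))"
    proof (rule LIMSEQ_le_const2)
      show "(\<lambda>k. ennreal (slice_integral f (?r k))) \<longlonglongrightarrow> ennreal C" using lim by (rule tendsto_ennrealI)
      show "\<exists>N. \<forall>k\<ge>N. ennreal (slice_integral f (?r k)) \<le> (SUP r\<in>{0..<1}. ennreal (slice_integral f r))"
        by (intro exI[of _ 0] allI impI SUP_upper) auto
    qed
  qed
qed

text \<open>
  On the torus the radial limits of an inner function are unimodular almost everywhere, so by dominated
  convergence the means of \<open>\<bar>\<phi> G\<bar>\<^sup>2\<close> over the tori of radius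
  \<open>r\<close> tend to the mean of \<open>\<bar>G\<bar>\<^sup>2\<close> as
  \<open>r \<rightarrow> 1\<close>. Continuity of \<open>G\<close> on the closed polydisc is what makes its
  boundary values available; general Hardy functions are reached later by density.
\<close>
lemma hardy_sup_inner_times:
  fixes \<phi> h G :: "complex ^ 'n::finite \<Rightarrow> complex"
  assumes \<phi>: "inner_function \<phi>" and h: "analytic_polydisc h" and off: "\<And>z. z \<notin> polydisc \<Longrightarrow> h z = 0"
    and G: "continuous_on UNIV G" and hG: "\<And>z. z \<in> polydisc \<Longrightarrow> h z = \<phi> z * G z"
  shows "hardy_sup h = ennreal (LINT \<theta>|angles. (cmod (G (torus_point \<theta>)))\<^sup>2)"
proof (rule hardy_sup_eq_limit[OF h])
  let ?r = "\<lambda>k. 1 - 1 / (real k + 2)"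
  show "h z = 0" if "z \<notin> polydisc" for z using off that .
  interpret prob_space "angles :: ('n \<Rightarrow> real) measure" by (rule prob_space_angles)
  obtain K where K: "\<And>z. z \<in> polydisc \<Longrightarrow> cmod (\<phi> z) \<le> K"
    using \<phi> by (auto simp: inner_function_def Hinf_def)
  have "compact (G ` {z. \<forall>i. cmod (z $ i) \<le> 1})"
    using G by (intro compact_continuous_image closed_subpolydisc_compact) (rule continuous_on_subset, auto)
  then obtain L where "\<And>w. w \<in> G ` {z. \<forall>i. cmod (z $ i) \<le> 1} \<Longrightarrow> cmod w \<le> L"
    using compact_imp_bounded bounded_iff by metis
  then have L: "cmod (G z) \<le> L" if "\<And>i. cmod (z $ i) \<le> 1" for z using that by auto
  have rp: "?r k *\<^sub>R torus_point \<theta> \<in> polydisc" for k and \<theta> :: "'n \<Rightarrow> real"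
    by (rule scaleR_torus_point_in_polydisc) auto
  have "(0 :: complex ^ 'n) \<in> polydisc" by (simp add: polydisc_def)
  then have "0 \<le> K" using K norm_ge_zero order_trans by blast
  have r1: "?r \<longlonglongrightarrow> 1" using power_to_one_tendsto[of 1] by simp
  have Gm: "G \<in> borel_measurable borel" using G by (rule borel_measurable_continuous_onI)
  show "(\<lambda>k. slice_integral h (?r k)) \<longlonglongrightarrow> (LINT \<theta>|angles. (cmod (G (torus_point \<theta>)))\<^sup>2)"
    unfolding slice_integral_def
  proof (rule integral_dominated_convergence[where w = "\<lambda>_. (K * L)\<^sup>2"])
    show "(\<lambda>\<theta>. (cmod (G (torus_point \<theta>)))\<^sup>2) \<in> borel_measurable angles"
      by (intro borel_measurable_power measurable_compose[OF measurable_compose[OF measurable_torus_point Gm] borel_measurable_norm])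
    show "(\<lambda>\<theta>. (cmod (h (?r k *\<^sub>R torus_point \<theta>)))\<^sup>2) \<in> borel_measurable angles" for k
      by (intro borel_measurable_power measurable_compose[OF measurable_slice borel_measurable_norm] analytic_polydisc_continuous_on h) auto
    show "integrable angles (\<lambda>_ :: 'n \<Rightarrow> real. (K * L)\<^sup>2)" by simp
    show "AE \<theta> in angles. norm ((cmod (h (?r k *\<^sub>R torus_point \<theta>)))\<^sup>2) \<le> (K * L)\<^sup>2" for k
    proof (rule AE_I2)
      fix \<theta> :: "'n \<Rightarrow> real"
      have "cmod (G (?r k *\<^sub>R torus_point \<theta>)) \<le> L"
        using rp[of k \<theta>] by (intro L) (simp add: polydisc_def less_imp_le)
      then have "cmod (h (?r k *\<^sub>R torus_point \<theta>)) \<le> K * L"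
        using rp[of k \<theta>] K \<open>0 \<le> K\<close> by (simp add: hG norm_mult mult_mono)
      then show "norm ((cmod (h (?r k *\<^sub>R torus_point \<theta>)))\<^sup>2) \<le> (K * L)\<^sup>2"
        by (simp add: power_mono)
    qed
    have "AE \<theta> in angles. \<exists>w. ((\<lambda>r::real. \<phi> (r *\<^sub>R torus_point \<theta>)) \<longlongrightarrow> w) (at_left 1) \<and> cmod w = 1"
      using \<phi> unfolding inner_function_def torus_measure_eq by (auto dest: AE_distrD[OF measurable_torus_point])
    then show "AE \<theta> in angles. (\<lambda>k. (cmod (h (?r k *\<^sub>R torus_point \<theta>)))\<^sup>2) \<longlonglongrightarrow> (cmod (G (torus_point \<theta>)))\<^sup>2"
    proof (rule AE_mp, intro AE_I2 impI)
      fix \<theta> :: "'n \<Rightarrow> real"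
      assume "\<exists>w. ((\<lambda>r::real. \<phi> (r *\<^sub>R torus_point \<theta>)) \<longlongrightarrow> w) (at_left 1) \<and> cmod w = 1"
      then obtain w where w: "((\<lambda>r::real. \<phi> (r *\<^sub>R torus_point \<theta>)) \<longlongrightarrow> w) (at_left 1)" "cmod w = 1" by blast
      have "filterlim ?r (at_left 1) sequentially"
        by (rule tendsto_imp_filterlim_at_left[OF r1]) simp
      then have 1: "(\<lambda>k. \<phi> (?r k *\<^sub>R torus_point \<theta>)) \<longlonglongrightarrow> w"
        by (rule filterlim_compose[OF w(1)])
      have 2: "(\<lambda>k. G (?r k *\<^sub>R torus_point \<theta>)) \<longlonglongrightarrow> G (1 *\<^sub>R torus_point \<theta>)"
        using G by (intro isCont_tendsto_compose[where g = G] tendsto_scaleR r1 tendsto_const)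
          (simp add: continuous_on_eq_continuous_at)
      have "(\<lambda>k. (cmod (\<phi> (?r k *\<^sub>R torus_point \<theta>) * G (?r k *\<^sub>R torus_point \<theta>)))\<^sup>2) \<longlonglongrightarrow> (cmod (w * G (1 *\<^sub>R torus_point \<theta>)))\<^sup>2"
        by (intro tendsto_intros 1 2)
      then show "(\<lambda>k. (cmod (h (?r k *\<^sub>R torus_point \<theta>)))\<^sup>2) \<longlonglongrightarrow> (cmod (G (torus_point \<theta>)))\<^sup>2"
        using rp by (simp add: hG norm_mult w(2))
    qed
  qed
qed

section \<open>Analyticity of power series\<close>

definition monomial_derivative :: "('n::finite \<Rightarrow> nat) \<Rightarrow> complex ^ 'n \<Rightarrow> complex ^ 'n \<Rightarrow> complex" where
  "monomial_derivative \<alpha> z v =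
     (\<Sum>i\<in>UNIV. of_nat (\<alpha> i) * (z $ i) ^ (\<alpha> i - 1) * (v $ i) * (\<Prod>j\<in>UNIV - {i}. (z $ j) ^ \<alpha> j))"

lemma monomial_has_derivative: "(monomial_at \<alpha> has_derivative monomial_derivative \<alpha> z) (at z)"
proof -
  have nth: "((\<lambda>z. z $ i) has_derivative (\<lambda>v. v $ i)) (at z)" for i
    by (rule bounded_linear_imp_has_derivative[OF bounded_linear_vec_nth])
  have "((\<lambda>z. (z $ i) ^ \<alpha> i) has_derivative (\<lambda>v. of_nat (\<alpha> i) * (z $ i) ^ (\<alpha> i - 1) * (v $ i))) (at z)" for i
    using has_derivative_power[OF nth[of i], of "\<alpha> i"] by (simp add: mult_ac)
  then have "((\<lambda>z. \<Prod>i\<in>UNIV. (z $ i) ^ \<alpha> i) has_derivative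
      (\<lambda>v. \<Sum>i\<in>UNIV. of_nat (\<alpha> i) * (z $ i) ^ (\<alpha> i - 1) * (v $ i) * (\<Prod>j\<in>UNIV - {i}. (z $ j) ^ \<alpha> j))) (at z)"
    by (rule has_derivative_prod)
  then show ?thesis by (simp add: monomial_at_def[abs_def] monomial_derivative_def[abs_def])
qed

lemma monomial_derivative_scale: "monomial_derivative \<alpha> z (c *s v) = c * monomial_derivative \<alpha> z v"
  by (simp add: monomial_derivative_def sum_distrib_left mult_ac)

lemma summable_monomials:
  fixes z :: "complex ^ 'n::finite"
  assumes "z \<in> polydisc"
  shows "(\<lambda>\<alpha>. cmod (monomial_at \<alpha> z)) summable_on UNIV"
proof -
  have "cmod (z $ i) < 1" for i using assms by (simp add: polydisc_def)
  from has_sum_prod_geometric[where x = "\<lambda>i. z $ i", OF this]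
  have "(\<lambda>\<alpha>. monomial_at \<alpha> z) summable_on UNIV"
    unfolding monomial_at_def by (rule has_sum_imp_summable)
  then show ?thesis by (simp only: summable_on_iff_abs_summable_on_complex)
qed

lemma monomial_derivative_bound:
  fixes \<rho> :: real
  assumes "\<And>i. cmod (z $ i) \<le> \<rho>"
  shows "cmod (monomial_derivative \<alpha> z v) \<le>
    (\<Sum>i\<in>UNIV. \<Prod>j\<in>UNIV. if j = i then real (\<alpha> j) * \<rho> ^ (\<alpha> j - 1) else \<rho> ^ \<alpha> j) * norm v"
proof -
  have \<rho>: "0 \<le> \<rho>" using assms norm_ge_zero order_trans by blast
  have "cmod (monomial_derivative \<alpha> z v) \<le>
      (\<Sum>i\<in>UNIV. cmod (of_nat (\<alpha> i) * (z $ i) ^ (\<alpha> i - 1) * (v $ i) * (\<Prod>j\<in>UNIV - {i}. (z $ j) ^ \<alpha> j)))"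
    unfolding monomial_derivative_def by (rule norm_sum)
  also have "\<dots> \<le> (\<Sum>i\<in>UNIV. (\<Prod>j\<in>UNIV. if j = i then real (\<alpha> j) * \<rho> ^ (\<alpha> j - 1) else \<rho> ^ \<alpha> j) * norm v)"
  proof (intro sum_mono)
    fix i :: 'a
    have "cmod (of_nat (\<alpha> i) * (z $ i) ^ (\<alpha> i - 1) * (v $ i) * (\<Prod>j\<in>UNIV - {i}. (z $ j) ^ \<alpha> j)) =
        (real (\<alpha> i) * cmod (z $ i) ^ (\<alpha> i - 1)) * cmod (v $ i) * (\<Prod>j\<in>UNIV - {i}. cmod (z $ j) ^ \<alpha> j)"
      by (simp add: norm_mult norm_power flip: prod_norm)
    also have "\<dots> \<le> (real (\<alpha> i) * \<rho> ^ (\<alpha> i - 1)) * norm v * (\<Prod>j\<in>UNIV - {i}. \<rho> ^ \<alpha> j)"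
      using assms \<rho> Finite_Cartesian_Product.norm_nth_le[of v i]
      by (intro mult_mono mult_left_mono prod_mono power_mono mult_nonneg_nonneg prod_nonneg conjI) auto
    also have "(\<Prod>j\<in>UNIV - {i}. \<rho> ^ \<alpha> j) = (\<Prod>j\<in>UNIV - {i}. if j = i then real (\<alpha> j) * \<rho> ^ (\<alpha> j - 1) else \<rho> ^ \<alpha> j)"
      by (intro prod.cong) auto
    also have "(real (\<alpha> i) * \<rho> ^ (\<alpha> i - 1)) * norm v * \<dots> =
        (\<Prod>j\<in>UNIV. if j = i then real (\<alpha> j) * \<rho> ^ (\<alpha> j - 1) else \<rho> ^ \<alpha> j) * norm v"
      using prod.remove[of UNIV i "\<lambda>j. if j = i then real (\<alpha> j) * \<rho> ^ (\<alpha> j - 1) else \<rho> ^ \<alpha> j"]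
      by (simp add: mult_ac)
    finally show "cmod (of_nat (\<alpha> i) * (z $ i) ^ (\<alpha> i - 1) * (v $ i) * (\<Prod>j\<in>UNIV - {i}. (z $ j) ^ \<alpha> j)) \<le>
        (\<Prod>j\<in>UNIV. if j = i then real (\<alpha> j) * \<rho> ^ (\<alpha> j - 1) else \<rho> ^ \<alpha> j) * norm v" .
  qed
  finally show ?thesis by (simp add: sum_distrib_right)
qed

lemma summable_on_finite_sum:
  fixes f :: "'i \<Rightarrow> 'a \<Rightarrow> real"
  assumes "finite I" "\<And>i. i \<in> I \<Longrightarrow> f i summable_on A"
  shows "(\<lambda>x. \<Sum>i\<in>I. f i x) summable_on A"
  using assms by (induction I) (auto intro: summable_on_add)

lemma summable_derivative_majorant:
  fixes \<rho> :: real
  assumes "0 \<le> \<rho>" "\<rho> < 1"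
  shows "(\<lambda>\<alpha>. \<Sum>i\<in>(UNIV :: 'n::finite set). \<Prod>j\<in>UNIV. if j = i then real (\<alpha> j) * \<rho> ^ (\<alpha> j - 1) else \<rho> ^ \<alpha> j)
    summable_on UNIV"
proof (rule summable_on_finite_sum[OF finite])
  fix i :: 'n
  have 1: "(\<lambda>k. \<rho> ^ k) summable_on (UNIV :: nat set)"
    using assms by (intro summable_nonneg_imp_summable_on summable_geometric) auto
  have "summable (\<lambda>k. diffs (\<lambda>_. 1) k * \<rho> ^ k)"
    using assms by (intro termdiff_converges[where K = 1]) (auto intro: summable_geometric)
  then have "summable (\<lambda>k. real (Suc k) * \<rho> ^ (Suc k - 1))" by (simp add: diffs_def)
  then have "summable (\<lambda>k. real k * \<rho> ^ (k - 1))" by (subst (asm) summable_Suc_iff)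
  then have 2: "(\<lambda>k. real k * \<rho> ^ (k - 1)) summable_on UNIV"
    using assms by (intro summable_nonneg_imp_summable_on) auto
  define b where "b = (\<lambda>j k. if j = i then real k * \<rho> ^ (k - 1) else \<rho> ^ k)"
  have "(\<lambda>k. norm (b j k)) summable_on UNIV" for j
    using 1 2 assms by (cases "j = i") (auto simp: b_def abs_mult power_abs)
  then have "(\<lambda>\<alpha>. norm (\<Prod>j\<in>UNIV. b j (\<alpha> j))) summable_on UNIV"
    by (rule abs_summable_prod)
  then have "(\<lambda>\<alpha>. norm (\<Prod>j\<in>(UNIV :: 'n set). if j = i then real (\<alpha> j) * \<rho> ^ (\<alpha> j - 1) else \<rho> ^ \<alpha> j)) summable_on UNIV"
    by (simp only: b_def)
  then show "(\<lambda>\<alpha>. \<Prod>j\<in>(UNIV :: 'n set). if j = i then real (\<alpha> j) * \<rho> ^ (\<alpha> j - 1) else \<rho> ^ \<alpha> j) summable_on UNIV"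
    by (rule abs_summable_summable)
qed

definition power_series :: "(('n::finite \<Rightarrow> nat) \<Rightarrow> complex) \<Rightarrow> complex ^ 'n \<Rightarrow> complex" where
  "power_series a z = (if z \<in> polydisc then \<Sum>\<^sub>\<infinity>\<alpha>. a \<alpha> * monomial_at \<alpha> z else 0)"

lemma power_series_has_sum:
  fixes a :: "('n::finite \<Rightarrow> nat) \<Rightarrow> complex"
  assumes K: "\<And>\<alpha>. cmod (a \<alpha>) \<le> K" and z: "z \<in> polydisc"
  shows "((\<lambda>\<alpha>. a \<alpha> * monomial_at \<alpha> z) has_sum power_series a z) UNIV"
proof -
  have "(\<lambda>\<alpha>. K * cmod (monomial_at \<alpha> z)) summable_on UNIV"
    by (intro summable_on_cmult_right summable_monomials z)
  moreover have "0 \<le> K" using K norm_ge_zero order_trans by blast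
  ultimately have "(\<lambda>\<alpha>. norm (complex_of_real (K * cmod (monomial_at \<alpha> z)))) summable_on UNIV"
    by (simp add: norm_mult)
  then have "(\<lambda>\<alpha>. norm (a \<alpha> * monomial_at \<alpha> z)) summable_on UNIV"
    by (rule Infinite_Sum.abs_summable_on_comparison_test) (use K \<open>0 \<le> K\<close> in \<open>simp add: norm_mult mult_right_mono\<close>)
  then have "(\<lambda>\<alpha>. a \<alpha> * monomial_at \<alpha> z) summable_on UNIV"
    by (rule abs_summable_summable)
  then show ?thesis using z by (simp add: power_series_def)
qed

lemma infinite_multiindices: "infinite (UNIV :: ('n::finite \<Rightarrow> nat) set)"
  using finite_fun_UNIVD2 infinite_UNIV_nat by blast

text \<open>
  A power series with bounded coefficients can be differentiated term by term on each smaller polydisc: the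
  derivatives of the monomials are dominated by a summable family that does not depend on the point. The
  multiindices are enumerated by the natural numbers in order to apply the theorem on derivatives of series.
\<close>
lemma power_series_analytic:
  fixes a :: "('n::finite \<Rightarrow> nat) \<Rightarrow> complex"
  assumes K: "\<And>\<alpha>. cmod (a \<alpha>) \<le> K"
  shows "analytic_polydisc (power_series a)"
  unfolding analytic_polydisc_def
proof
  fix w :: "complex ^ 'n" assume w: "w \<in> polydisc"
  define e :: "nat \<Rightarrow> 'n \<Rightarrow> nat" where "e = from_nat_into UNIV"
  have e: "bij_betw e UNIV UNIV"
    unfolding e_def by (intro bij_betw_from_nat_into infinite_multiindices) auto
  have K0: "0 \<le> K" using K norm_ge_zero order_trans by blast
  obtain \<rho> where \<rho>': "1/2 < \<rho>" "\<rho> < 1" "\<And>i. cmod (w $ i) < \<rho>" using polydisc_radius[OF w] by blast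
  then have \<rho>: "0 \<le> \<rho>" "\<rho> < 1" "\<And>i. cmod (w $ i) < \<rho>" by auto
  define S where "S = {z :: complex ^ 'n. \<forall>i. cmod (z $ i) < \<rho>}"
  have "S = (\<Inter>i. (\<lambda>z. z $ i) -` ball 0 \<rho>)" by (auto simp: S_def)
  moreover have "convex (\<Inter>i. (\<lambda>z :: complex ^ 'n. z $ i) -` ball 0 \<rho>)"
    by (intro convex_INT convex_linear_vimage convex_ball) (simp add: linear_conv_bounded_linear bounded_linear_vec_nth)
  ultimately have S: "convex S" by simp
  have "open (\<Inter>i. {z :: complex ^ 'n. cmod (z $ i) < \<rho>})"
    by (intro open_INT ballI finite open_Collect_less continuous_intros)
  then have oS: "open S" by (simp add: S_def Collect_all_eq)
  have wS: "w \<in> S" using \<rho> by (simp add: S_def)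
  have SP: "z \<in> polydisc" if "z \<in> S" for z
    using that \<rho>(2) by (auto simp: S_def polydisc_def intro: less_trans)
  define M where "M = (\<lambda>\<alpha>. K * (\<Sum>i\<in>(UNIV :: 'n set). \<Prod>j\<in>UNIV. if j = i then real (\<alpha> j) * \<rho> ^ (\<alpha> j - 1) else \<rho> ^ \<alpha> j))"
  have "(\<lambda>\<alpha>. M \<alpha>) summable_on UNIV"
    unfolding M_def by (intro summable_on_cmult_right summable_derivative_majorant \<rho>)
  then have "(M \<circ> e) summable_on UNIV"
    using summable_on_reindex_bij_betw[OF e, of M] by (simp add: o_def)
  then have Ms: "summable (\<lambda>n. M (e n))"
    using summable_on_imp_summable by (fastforce simp: o_def)
  define f where "f = (\<lambda>n z. a (e n) * monomial_at (e n) z)"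
  define f' where "f' = (\<lambda>n z v. a (e n) * monomial_derivative (e n) z v)"
  have f'M: "cmod (f' n z v) \<le> M (e n) * norm v" if "z \<in> S" for n z v
  proof -
    have "cmod (f' n z v) = cmod (a (e n)) * cmod (monomial_derivative (e n) z v)"
      by (simp add: f'_def norm_mult)
    also have "\<dots> \<le> K * ((\<Sum>i\<in>(UNIV :: 'n set). \<Prod>j\<in>UNIV. if j = i then real (e n j) * \<rho> ^ (e n j - 1) else \<rho> ^ e n j) * norm v)"
      using that K K0 by (intro mult_mono monomial_derivative_bound) (auto simp: S_def less_imp_le)
    finally show ?thesis by (simp add: M_def)
  qed
  have f's: "summable (\<lambda>n. f' n z v)" if "z \<in> S" for z v
    by (rule summable_comparison_test'[OF summable_mult2[OF Ms, of "norm v"], of 0]) (use f'M[OF that] in auto)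
  define g' where "g' = (\<lambda>z v. \<Sum>n. f' n z v)"
  have sums: "(\<lambda>n. f n z) sums power_series a z" if "z \<in> S" for z
  proof -
    have "((\<lambda>\<alpha>. a \<alpha> * monomial_at \<alpha> z) has_sum power_series a z) UNIV"
      using K SP[OF that] by (rule power_series_has_sum)
    then have "((\<lambda>n. a (e n) * monomial_at (e n) z) has_sum power_series a z) UNIV"
      by (subst has_sum_reindex_bij_betw[OF e])
    then show ?thesis unfolding f_def by (rule has_sum_imp_sums)
  qed
  have "\<exists>g. \<forall>z\<in>S. (\<lambda>n. f n z) sums g z \<and> (g has_derivative g' z) (at z within S)"
  proof (rule has_derivative_series[of S f f' g' w "power_series a w"])
    show "convex S" by (rule S)
    show "w \<in> S" by (rule wS)
    show "(\<lambda>n. f n w) sums power_series a w" by (rule sums[OF wS])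
    show "(f n has_derivative f' n z) (at z within S)" for n z
      unfolding f_def f'_def by (rule has_derivative_at_withinI[OF has_derivative_mult_right[OF monomial_has_derivative]])
    fix \<epsilon> :: real assume "0 < \<epsilon>"
    then obtain N where N: "\<And>n. n \<ge> N \<Longrightarrow> norm (\<Sum>i. M (e (i + n))) < \<epsilon>"
      using suminf_exist_split[OF _ Ms] by metis
    show "\<forall>\<^sub>F n in sequentially. \<forall>z\<in>S. \<forall>h. cmod ((\<Sum>i<n. f' i z h) - g' z h) \<le> \<epsilon> * norm h"
    proof (rule eventually_sequentiallyI[of N], intro ballI allI)
      fix n z and h :: "complex ^ 'n" assume n: "N \<le> n" and z: "z \<in> S"
      have sM: "summable (\<lambda>i. M (e (i + n)) * norm h)"
        using Ms by (intro summable_mult2) (simp add: summable_iff_shift[of "\<lambda>i. M (e i)"])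
      have "cmod ((\<Sum>i<n. f' i z h) - g' z h) = cmod (\<Sum>i. f' (i + n) z h)"
        unfolding g'_def suminf_split_initial_segment[OF f's[OF z], of h n] by (simp add: norm_minus_commute)
      also have "\<dots> \<le> (\<Sum>i. M (e (i + n)) * norm h)"
        by (rule norm_suminf_le[OF _ sM]) (rule f'M[OF z])
      also have "\<dots> = (\<Sum>i. M (e (i + n))) * norm h"
        using Ms by (intro suminf_mult2[symmetric]) (simp add: summable_iff_shift[of "\<lambda>i. M (e i)"])
      also have "\<dots> \<le> \<epsilon> * norm h" using N[OF n] by (intro mult_right_mono) auto
      finally show "cmod ((\<Sum>i<n. f' i z h) - g' z h) \<le> \<epsilon> * norm h" .
    qed
  qed
  then obtain g where g: "\<And>z. z \<in> S \<Longrightarrow> (\<lambda>n. f n z) sums g z" "(g has_derivative g' w) (at w within S)"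
    using wS by blast
  have "(g has_derivative g' w) (at w)" using g(2) at_within_open[OF wS oS] by simp
  moreover have "g z = power_series a z" if "z \<in> S" for z
    using g(1)[OF that] sums[OF that] by (rule sums_unique2)
  ultimately have "(power_series a has_derivative g' w) (at w)"
    by (rule has_derivative_transform_within_open[OF _ oS wS])
  moreover have "g' w (c *s v) = c * g' w v" for c v
    unfolding g'_def by (subst suminf_mult[OF f's[OF wS], symmetric]) (simp add: f'_def monomial_derivative_scale mult_ac)
  ultimately show "\<exists>D. (power_series a has_derivative D) (at w) \<and> (\<forall>c v. D (c *s v) = c * D v)" by blast
qed

lemma square_summable_bounded:
  assumes "(\<lambda>\<alpha>. (cmod (a \<alpha>))\<^sup>2) summable_on UNIV"
  obtains K where "\<And>\<alpha>. cmod (a \<alpha>) \<le> K"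
proof -
  have "(cmod (a \<alpha>))\<^sup>2 \<le> (\<Sum>\<^sub>\<infinity>\<alpha>. (cmod (a \<alpha>))\<^sup>2)" for \<alpha>
    using finite_sum_le_infsum[OF assms, of "{\<alpha>}"] by simp
  then show ?thesis using that real_le_rsqrt by blast
qed

lemma taylor_coeff_power_series:
  fixes a :: "('n::finite \<Rightarrow> nat) \<Rightarrow> complex"
  assumes "(\<lambda>\<alpha>. (cmod (a \<alpha>))\<^sup>2) summable_on UNIV"
  shows "taylor_coeff (power_series a) = a"
proof -
  obtain K where K: "\<And>\<alpha>. cmod (a \<alpha>) \<le> K" using square_summable_bounded[OF assms] by blast
  show ?thesis
    by (rule taylor_coeff_unique[OF analytic_polydisc_continuous_on[OF power_series_analytic[OF K]] power_series_has_sum[OF K]])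
qed

lemma power_series_in_H2:
  fixes a :: "('n::finite \<Rightarrow> nat) \<Rightarrow> complex"
  assumes "(\<lambda>\<alpha>. (cmod (a \<alpha>))\<^sup>2) summable_on UNIV"
  shows "power_series a \<in> H2"
proof -
  obtain K where K: "\<And>\<alpha>. cmod (a \<alpha>) \<le> K" using square_summable_bounded[OF assms] by blast
  have "hardy_sup (power_series a) = ennreal (\<Sum>\<^sub>\<infinity>\<alpha>. (cmod (taylor_coeff (power_series a) \<alpha>))\<^sup>2)"
    using assms by (intro hardy_sup_eq_infsum power_series_analytic[OF K])
      (auto simp: power_series_def taylor_coeff_power_series)
  then show ?thesis
    using power_series_analytic[OF K] by (auto simp: H2_def power_series_def)
qed

section \<open>The Hardy space as an inner product space\<close>

abbreviation square_summable :: "('i \<Rightarrow> complex) \<Rightarrow> bool" where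
  "square_summable a \<equiv> (\<lambda>i. (cmod (a i))\<^sup>2) summable_on UNIV"

lemma square_summable_product:
  assumes "square_summable a" "square_summable b"
  shows "(\<lambda>i. a i * cnj (b i)) summable_on UNIV"
proof -
  have "(\<lambda>i. (cmod (a i))\<^sup>2 + (cmod (b i))\<^sup>2) summable_on UNIV"
    using assms by (rule summable_on_add)
  then have "(\<lambda>i. norm ((cmod (a i))\<^sup>2 + (cmod (b i))\<^sup>2)) summable_on UNIV" by simp
  then have "(\<lambda>i. norm (a i * cnj (b i))) summable_on UNIV"
  proof (rule Infinite_Sum.abs_summable_on_comparison_test)
    fix i
    have "0 \<le> cmod (a i) * cmod (b i)" by simp
    moreover have "2 * (cmod (a i) * cmod (b i)) \<le> (cmod (a i))\<^sup>2 + (cmod (b i))\<^sup>2"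
      using sum_squares_bound[of "cmod (a i)" "cmod (b i)"] by (simp add: mult.assoc)
    ultimately have "cmod (a i) * cmod (b i) \<le> (cmod (a i))\<^sup>2 + (cmod (b i))\<^sup>2" by linarith
    then show "norm (a i * cnj (b i)) \<le> norm ((cmod (a i))\<^sup>2 + (cmod (b i))\<^sup>2)"
      by (simp add: norm_mult)
  qed
  then show ?thesis by (rule abs_summable_summable)
qed

lemma square_summable_scale: "square_summable a \<Longrightarrow> square_summable (\<lambda>i. c * a i)"
  by (simp add: norm_mult power_mult_distrib summable_on_cmult_right)

lemma square_summable_add:
  assumes "square_summable a" "square_summable b"
  shows "square_summable (\<lambda>i. a i + b i)"
proof -
  have "(\<lambda>i. norm (2 * (cmod (a i))\<^sup>2 + 2 * (cmod (b i))\<^sup>2)) summable_on UNIV"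
    using summable_on_add[OF summable_on_cmult_right[OF assms(1), of 2] summable_on_cmult_right[OF assms(2), of 2]] by simp
  then have "(\<lambda>i. norm ((cmod (a i + b i))\<^sup>2)) summable_on UNIV"
  proof (rule Infinite_Sum.abs_summable_on_comparison_test)
    fix i
    have "(cmod (a i + b i))\<^sup>2 \<le> (cmod (a i) + cmod (b i))\<^sup>2"
      by (intro power_mono norm_triangle_ineq) auto
    also have "\<dots> \<le> 2 * (cmod (a i))\<^sup>2 + 2 * (cmod (b i))\<^sup>2"
      using sum_squares_bound[of "cmod (a i)" "cmod (b i)"] by (simp add: power2_sum)
    finally show "norm ((cmod (a i + b i))\<^sup>2) \<le> norm (2 * (cmod (a i))\<^sup>2 + 2 * (cmod (b i))\<^sup>2)"
      by simp
  qed
  then show ?thesis by simp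
qed

lemma square_summable_finite_support: "finite {i. a i \<noteq> 0} \<Longrightarrow> square_summable a"
  by (rule summable_on_cong_neutral[THEN iffD1, OF _ _ _ summable_on_finite[of "{i. a i \<noteq> 0}"]]) auto

text \<open>
  As a type, the Hardy space inherits norms, limits and continuity from the class of real inner product
  spaces. The complex structure is kept beside it, as a scalar multiplication \<open>*\<^sub>C\<close> and a
  complex inner product \<open>cinner\<close> whose real part is \<open>inner\<close>.
\<close>
typedef (overloaded) 'n hardy = "H2 :: (complex ^ 'n::finite \<Rightarrow> complex) set"
  morphisms fn Hardy
  using power_series_in_H2[of "\<lambda>_. 0"] by auto

definition coef :: "'n::finite hardy \<Rightarrow> ('n \<Rightarrow> nat) \<Rightarrow> complex" where
  "coef x = taylor_coeff (fn x)"

definition of_coef :: "(('n::finite \<Rightarrow> nat) \<Rightarrow> complex) \<Rightarrow> 'n hardy" where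
  "of_coef a = Hardy (power_series a)"

lemma fn_analytic: "analytic_polydisc (fn x)"
  and fn_off_polydisc: "z \<notin> polydisc \<Longrightarrow> fn x z = 0"
  using fn[of x] by (auto simp: H2_def)

lemma square_summable_coef: "square_summable (coef x)"
  using fn[of x] unfolding coef_def by (intro hardy_sup_finiteD) (auto simp: H2_def)

lemma fn_has_sum: "z \<in> polydisc \<Longrightarrow> ((\<lambda>\<alpha>. coef x \<alpha> * monomial_at \<alpha> z) has_sum fn x z) UNIV"
  unfolding coef_def by (intro taylor_series fn_analytic)

lemma coef_of_coef [simp]: "square_summable a \<Longrightarrow> coef (of_coef a) = a"
  by (simp add: coef_def of_coef_def Hardy_inverse power_series_in_H2 taylor_coeff_power_series)

lemma hardy_eqI_fn:
  assumes "\<And>z. z \<in> polydisc \<Longrightarrow> fn x z = fn y z" shows "x = y"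
proof -
  have "fn x z = fn y z" for z
    using assms[of z] fn_off_polydisc[of z x] fn_off_polydisc[of z y] by (cases "z \<in> polydisc") auto
  then have "fn x = fn y" by (rule ext)
  then show ?thesis by (simp add: fn_inject)
qed

lemma fn_eqI: "((\<lambda>\<alpha>. coef x \<alpha> * monomial_at \<alpha> z) has_sum s) UNIV \<Longrightarrow> z \<in> polydisc \<Longrightarrow> fn x z = s"
  using fn_has_sum has_sum_unique by blast

lemma hardy_eqI:
  assumes "\<And>\<alpha>. coef x \<alpha> = coef y \<alpha>" shows "x = y"
proof (rule hardy_eqI_fn)
  fix z :: "complex ^ 'a" assume z: "z \<in> polydisc"
  show "fn x z = fn y z"
    using fn_has_sum[OF z, of y] z by (intro fn_eqI) (simp_all add: assms)
qed

lemma coef_eqI: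
  assumes "\<And>z. z \<in> polydisc \<Longrightarrow> ((\<lambda>\<alpha>. a \<alpha> * monomial_at \<alpha> z) has_sum fn x z) UNIV"
  shows "coef x = a"
  unfolding coef_def using analytic_polydisc_continuous_on[OF fn_analytic] assms by (rule taylor_coeff_unique)

definition cinner :: "'n::finite hardy \<Rightarrow> 'n hardy \<Rightarrow> complex" where
  "cinner x y = (\<Sum>\<^sub>\<infinity>\<alpha>. coef x \<alpha> * cnj (coef y \<alpha>))"

lemma cinner_has_sum: "((\<lambda>\<alpha>. coef x \<alpha> * cnj (coef y \<alpha>)) has_sum cinner x y) UNIV"
  unfolding cinner_def by (intro has_sum_infsum square_summable_product square_summable_coef)

definition scaleC :: "complex \<Rightarrow> 'n::finite hardy \<Rightarrow> 'n hardy" (infixr "*\<^sub>C" 75) where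
  "c *\<^sub>C x = of_coef (\<lambda>\<alpha>. c * coef x \<alpha>)"

lemma coef_scaleC [simp]: "coef (c *\<^sub>C x) \<alpha> = c * coef x \<alpha>"
  unfolding scaleC_def by (simp add: square_summable_scale square_summable_coef)

text \<open>
  The operations are defined on Taylor coefficients, for which closure under them is immediate; that they act
  pointwise on functions is derived below.
\<close>
instantiation hardy :: (finite) real_vector
begin

definition "0 = of_coef (\<lambda>_. 0)"
definition "x + y = of_coef (\<lambda>\<alpha>. coef x \<alpha> + coef y \<alpha>)"
definition "- x = (-1) *\<^sub>C x" for x :: "'a hardy"
definition "x - y = x + (-1) *\<^sub>C y" for x y :: "'a hardy"
definition "scaleR r x = complex_of_real r *\<^sub>C x" for x :: "'a hardy"

lemma coef_zero [simp]: "coef (0 :: 'a hardy) \<alpha> = 0"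
  by (simp add: zero_hardy_def)

lemma coef_plus [simp]: "coef (x + y :: 'a hardy) \<alpha> = coef x \<alpha> + coef y \<alpha>"
  by (simp add: plus_hardy_def square_summable_add square_summable_coef)

lemma coef_uminus [simp]: "coef (- x :: 'a hardy) \<alpha> = - coef x \<alpha>"
  by (simp add: uminus_hardy_def)

lemma coef_minus [simp]: "coef (x - y :: 'a hardy) \<alpha> = coef x \<alpha> - coef y \<alpha>"
  by (simp add: minus_hardy_def)

instance
proof
  fix x y z :: "'a hardy" and a b :: real
  show "x + y + z = x + (y + z)" "x + y = y + x" "0 + x = x" "- x + x = 0" "x - y = x + - y"
    "a *\<^sub>R (x + y) = a *\<^sub>R x + a *\<^sub>R y" "(a + b) *\<^sub>R x = a *\<^sub>R x + b *\<^sub>R x"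
    "a *\<^sub>R b *\<^sub>R x = (a * b) *\<^sub>R x" "1 *\<^sub>R x = x"
    by (rule hardy_eqI; simp add: scaleR_hardy_def algebra_simps)+
qed

end

lemma scaleR_eq_scaleC: "r *\<^sub>R x = complex_of_real r *\<^sub>C x" for x :: "'n::finite hardy"
  by (rule scaleR_hardy_def)

instantiation hardy :: (finite) real_inner
begin

definition "inner x y = Re (cinner x y)"
definition "norm x = sqrt (Re (cinner x x))" for x :: "'a hardy"
definition "sgn x = x /\<^sub>R norm x" for x :: "'a hardy"
definition "dist x y = norm (x - y)" for x y :: "'a hardy"
definition "uniformity = (INF e\<in>{0<..}. principal {(x :: 'a hardy, y). dist x y < e})"
definition "open (U :: 'a hardy set) \<longleftrightarrow> (\<forall>x\<in>U. \<forall>\<^sub>F (x', y) in uniformity. x' = x \<longrightarrow> y \<in> U)"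

instance
proof
  fix x y z :: "'a hardy" and r :: real
  show "sgn x = x /\<^sub>R norm x" "dist x y = norm (x - y)" "norm x = sqrt (inner x x)"
    by (simp_all add: sgn_hardy_def dist_hardy_def norm_hardy_def inner_hardy_def)
  show "uniformity = (INF e\<in>{0<..}. principal {(x :: 'a hardy, y). dist x y < e})"
    by (rule uniformity_hardy_def)
  show "open U \<longleftrightarrow> (\<forall>x\<in>U. \<forall>\<^sub>F (x', y) in uniformity. x' = x \<longrightarrow> y \<in> U)" for U :: "'a hardy set"
    by (rule open_hardy_def)
  have Re_sum: "((\<lambda>\<alpha>. Re (coef x \<alpha> * cnj (coef y \<alpha>))) has_sum inner x y) UNIV" for x y :: "'a hardy"
    unfolding inner_hardy_def by (intro has_sum_Re cinner_has_sum)
  have inner_eqI: "inner x y = s" if "((\<lambda>\<alpha>. Re (coef x \<alpha> * cnj (coef y \<alpha>))) has_sum s) UNIV" for x y :: "'a hardy" and s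
    using Re_sum that by (rule has_sum_unique)
  show "inner x y = inner y x"
    using Re_sum[of y x] by (intro inner_eqI) (simp add: algebra_simps)
  show "inner (x + y) z = inner x z + inner y z"
    using has_sum_add[OF Re_sum[of x z] Re_sum[of y z]] by (intro inner_eqI) (simp add: algebra_simps)
  show "inner (r *\<^sub>R x) y = r * inner x y"
    using has_sum_cmult_right[OF Re_sum[of x y], of r] by (intro inner_eqI) (simp add: scaleR_eq_scaleC algebra_simps)
  have sq: "((\<lambda>\<alpha>. (cmod (coef x \<alpha>))\<^sup>2) has_sum inner x x) UNIV"
    using Re_sum[of x x] by (simp only: complex_norm_square[symmetric] Re_complex_of_real)
  show "0 \<le> inner x x"
    by (rule has_sum_nonneg[OF sq]) simp
  show "inner x x = 0 \<longleftrightarrow> x = 0"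
  proof
    assume "inner x x = 0"
    then have "(cmod (coef x \<alpha>))\<^sup>2 = 0" for \<alpha>
      by (intro nonneg_has_sum_le_0D[OF sq]) auto
    then show "x = 0" by (intro hardy_eqI) simp
  qed (auto intro!: inner_eqI)
qed

end

lemma coef_sum [simp]: "coef (\<Sum>i\<in>I. x i) \<alpha> = (\<Sum>i\<in>I. coef (x i) \<alpha>)"
  by (induction I rule: infinite_finite_induct) auto

interpretation hardy: vector_space "scaleC :: complex \<Rightarrow> 'n::finite hardy \<Rightarrow> 'n hardy"
  by standard (rule hardy_eqI; simp add: algebra_simps)+

lemma fn_plus [simp]: "fn (x + y) z = fn x z + fn y z"
proof (cases "z \<in> polydisc")
  case True
  then show ?thesis
    using has_sum_add[OF fn_has_sum[of z x] fn_has_sum[of z y]] by (intro fn_eqI) (simp_all add: algebra_simps)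
qed (simp add: fn_off_polydisc)

lemma fn_scaleC [simp]: "fn (c *\<^sub>C x) z = c * fn x z"
proof (cases "z \<in> polydisc")
  case True
  then show ?thesis
    using has_sum_cmult_right[OF fn_has_sum[of z x], of c] by (intro fn_eqI) (simp_all add: algebra_simps)
qed (simp add: fn_off_polydisc)

lemma fn_zero [simp]: "fn 0 z = 0"
  using fn_scaleC[of 0 0 z] by (simp del: fn_scaleC)

lemma fn_uminus [simp]: "fn (- x) z = - fn x z"
  by (metis fn_plus fn_zero add.right_inverse add_eq_0_iff)

lemma fn_minus [simp]: "fn (x - y) z = fn x z - fn y z"
  by (simp add: diff_conv_add_uminus del: add_uminus_conv_diff)

lemma fn_sum [simp]: "fn (\<Sum>i\<in>I. x i) z = (\<Sum>i\<in>I. fn (x i) z)"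
  by (induction I rule: infinite_finite_induct) auto

lemma cinner_eq_sumI: "((\<lambda>\<alpha>. coef x \<alpha> * cnj (coef y \<alpha>)) has_sum s) UNIV \<Longrightarrow> cinner x y = s"
  using cinner_has_sum has_sum_unique by blast

lemma cinner_commute: "cnj (cinner x y) = cinner y x"
proof -
  have "((\<lambda>\<alpha>. cnj (coef x \<alpha> * cnj (coef y \<alpha>))) has_sum cnj (cinner x y)) UNIV"
    using cinner_has_sum by (simp only: has_sum_cnj_iff)
  then have "cinner y x = cnj (cinner x y)"
    by (intro cinner_eq_sumI) (simp add: mult.commute)
  then show ?thesis ..
qed

lemma cinner_add_left: "cinner (x + y) z = cinner x z + cinner y z"
  using has_sum_add[OF cinner_has_sum[of x z] cinner_has_sum[of y z]]
  by (intro cinner_eq_sumI) (simp add: algebra_simps)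

lemma cinner_scaleC_left [simp]: "cinner (c *\<^sub>C x) y = c * cinner x y"
  using has_sum_cmult_right[OF cinner_has_sum[of x y], of c]
  by (intro cinner_eq_sumI) (simp add: algebra_simps)

lemma cinner_add_right: "cinner x (y + z) = cinner x y + cinner x z"
  by (metis cinner_add_left cinner_commute complex_cnj_add)

lemma cinner_scaleC_right [simp]: "cinner x (c *\<^sub>C y) = cnj c * cinner x y"
  by (metis cinner_commute cinner_scaleC_left complex_cnj_mult)

lemma cinner_zero [simp]: "cinner 0 x = 0" "cinner x 0 = 0"
  by (simp_all add: cinner_def)

lemma cinner_minus [simp]: "cinner (- x) y = - cinner x y" "cinner x (- y) = - cinner x y"
  using cinner_scaleC_left[of "-1" x y] cinner_scaleC_right[of x "-1" y] by (simp_all del: cinner_scaleC_left cinner_scaleC_right)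

lemma cinner_diff_left: "cinner (x - y) z = cinner x z - cinner y z"
  by (simp add: diff_conv_add_uminus cinner_add_left del: add_uminus_conv_diff)

lemma cinner_diff_right: "cinner x (y - z) = cinner x y - cinner x z"
  by (simp add: diff_conv_add_uminus cinner_add_right del: add_uminus_conv_diff)

lemma cinner_sum_left: "cinner (\<Sum>i\<in>I. x i) y = (\<Sum>i\<in>I. cinner (x i) y)"
  by (induction I rule: infinite_finite_induct) (auto simp: cinner_add_left)

lemma cinner_sum_right: "cinner x (\<Sum>i\<in>I. y i) = (\<Sum>i\<in>I. cinner x (y i))"
  by (induction I rule: infinite_finite_induct) (auto simp: cinner_add_right)

lemma norm_has_sum: "((\<lambda>\<alpha>. (cmod (coef x \<alpha>))\<^sup>2) has_sum (norm x)\<^sup>2) UNIV"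
proof -
  have "((\<lambda>\<alpha>. Re (coef x \<alpha> * cnj (coef x \<alpha>))) has_sum inner x x) UNIV"
    unfolding inner_hardy_def by (intro has_sum_Re cinner_has_sum)
  then show ?thesis by (simp only: complex_norm_square[symmetric] Re_complex_of_real power2_norm_eq_inner)
qed

lemma cinner_self: "cinner x x = complex_of_real ((norm x)\<^sup>2)"
proof -
  have "((\<lambda>\<alpha>. complex_of_real ((cmod (coef x \<alpha>))\<^sup>2)) has_sum complex_of_real ((norm x)\<^sup>2)) UNIV"
    using norm_has_sum by (simp only: has_sum_of_real_iff)
  then show ?thesis by (intro cinner_eq_sumI) (simp only: complex_norm_square)
qed

lemma norm_scaleC [simp]: "norm (c *\<^sub>C x) = cmod c * norm x"
proof -
  have "complex_of_real ((norm (c *\<^sub>C x))\<^sup>2) = (c * cnj c) * cinner x x"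
    unfolding cinner_self[symmetric] by simp
  also have "\<dots> = complex_of_real ((cmod c * norm x)\<^sup>2)"
    unfolding cinner_self complex_norm_square[symmetric] by (simp add: power_mult_distrib)
  finally have "complex_of_real ((norm (c *\<^sub>C x))\<^sup>2) = complex_of_real ((cmod c * norm x)\<^sup>2)" .
  then have "(norm (c *\<^sub>C x))\<^sup>2 = (cmod c * norm x)\<^sup>2" by (simp only: of_real_eq_iff)
  then show ?thesis by (simp add: power2_eq_iff_nonneg)
qed

lemma cinner_Cauchy_Schwarz: "cmod (cinner x y) \<le> norm x * norm y"
proof (cases "cinner x y = 0")
  case False
  define c where "c = cnj (cinner x y) / cmod (cinner x y)"
  have "c * cinner x y = complex_of_real (cmod (cinner x y))"
    using False complex_norm_square[of "cinner x y"] by (simp add: c_def power2_eq_square field_simps)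
  then have "cmod (cinner x y) = inner (c *\<^sub>C x) y"
    by (simp add: inner_hardy_def)
  also have "\<dots> \<le> norm (c *\<^sub>C x) * norm y" by (rule norm_cauchy_schwarz)
  also have "norm (c *\<^sub>C x) = norm x" using False by (simp add: c_def norm_divide)
  finally show ?thesis .
qed simp

lemma bounded_linear_cinner_right: "bounded_linear (\<lambda>y. cinner x y)"
proof (rule bounded_linear_intro[where K = "norm x"])
  show "norm (cinner x y) \<le> norm y * norm x" for y
    using cinner_Cauchy_Schwarz[of x y] by (simp add: mult.commute)
qed (auto simp: cinner_add_right scaleR_eq_scaleC scaleR_conv_of_real)

lemma cinner_eqI: "(\<And>y. cinner x y = cinner x' y) \<Longrightarrow> x = x'"
proof -
  assume "\<And>y. cinner x y = cinner x' y"
  then have "cinner (x - x') (x - x') = 0" by (simp add: cinner_diff_left)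
  then show "x = x'" by (simp add: cinner_self)
qed

lemma polarization:
  "cinner x y = (\<Sum>k<4. \<i> ^ k * complex_of_real ((norm (x + \<i> ^ k *\<^sub>C y))\<^sup>2)) / 4"
  unfolding cinner_self[symmetric]
  by (simp add: cinner_add_left cinner_add_right eval_nat_numeral lessThan_Suc algebra_simps)

lemma hardy_norm_fn: "hardy_norm (fn x) = norm x"
proof -
  have "hardy_sup (fn x) = ennreal (\<Sum>\<^sub>\<infinity>\<alpha>. (cmod (taylor_coeff (fn x) \<alpha>))\<^sup>2)"
    using square_summable_coef[of x]
    by (intro hardy_sup_eq_infsum fn_analytic fn_off_polydisc) (simp_all add: coef_def)
  also have "(\<Sum>\<^sub>\<infinity>\<alpha>. (cmod (taylor_coeff (fn x) \<alpha>))\<^sup>2) = (norm x)\<^sup>2"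
    using norm_has_sum[of x] by (simp add: coef_def infsumI)
  finally show ?thesis by (simp add: hardy_norm_def)
qed

text \<open>
  The polarization formula turns the inner product that is defined by the Hardy norm into the one given by
  Taylor coefficients.
\<close>
lemma hardy_inner_fn: "hardy_inner (fn x) (fn y) = cinner x y"
proof -
  have "(\<lambda>z. fn x z + \<i> ^ k * fn y z) = fn (x + \<i> ^ k *\<^sub>C y)" for k
    by (simp add: fun_eq_iff)
  then show ?thesis by (simp add: hardy_inner_def hardy_norm_fn polarization)
qed

definition hmonomial :: "('n::finite \<Rightarrow> nat) \<Rightarrow> 'n hardy" where
  "hmonomial \<alpha> = of_coef (\<lambda>\<beta>. if \<beta> = \<alpha> then 1 else 0)"

lemma coef_monomial [simp]: "coef (hmonomial \<alpha>) \<beta> = (if \<beta> = \<alpha> then 1 else 0)"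
proof -
  have "square_summable (\<lambda>\<beta>. if \<beta> = \<alpha> then 1 else 0)"
    by (intro square_summable_finite_support) simp
  then show ?thesis unfolding hmonomial_def by simp
qed

lemma fn_monomial:
  assumes "z \<in> polydisc" shows "fn (hmonomial \<alpha>) z = monomial_at \<alpha> z"
  using assms by (intro fn_eqI has_sum_finite_neutralI[of "{\<alpha>}"]) auto

lemma cinner_monomial_right [simp]: "cinner x (hmonomial \<alpha>) = coef x \<alpha>"
  by (intro cinner_eq_sumI has_sum_finite_neutralI[of "{\<alpha>}"]) auto

lemma monomial_expansion: "((\<lambda>\<alpha>. coef x \<alpha> *\<^sub>C hmonomial \<alpha>) has_sum x) UNIV"
proof -
  have c: "coef (x - (\<Sum>\<alpha>\<in>F. coef x \<alpha> *\<^sub>C hmonomial \<alpha>)) \<beta> = (if \<beta> \<in> F then 0 else coef x \<beta>)" if "finite F" for F \<beta>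
    using that by (simp add: if_distrib[of "\<lambda>t. _ * t"] cong: if_cong)
  have eq: "(norm (x - (\<Sum>\<alpha>\<in>F. coef x \<alpha> *\<^sub>C hmonomial \<alpha>)))\<^sup>2 = (norm x)\<^sup>2 - (\<Sum>\<alpha>\<in>F. (cmod (coef x \<alpha>))\<^sup>2)" if F: "finite F" for F
  proof -
    let ?y = "x - (\<Sum>\<alpha>\<in>F. coef x \<alpha> *\<^sub>C hmonomial \<alpha>)"
    have "((\<lambda>\<alpha>. (cmod (coef x \<alpha>))\<^sup>2) has_sum ((norm x)\<^sup>2 - (\<Sum>\<alpha>\<in>F. (cmod (coef x \<alpha>))\<^sup>2))) (UNIV - F)"
      using F by (intro has_sum_Diff norm_has_sum has_sum_finite) auto
    moreover have "((\<lambda>\<alpha>. (cmod (coef ?y \<alpha>))\<^sup>2) has_sum (norm ?y)\<^sup>2) (UNIV - F)"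
      using norm_has_sum[of ?y] by (rule has_sum_cong_neutral[THEN iffD1, rotated -1]) (auto simp: c[OF F] simp del: coef_minus)
    moreover have "(cmod (coef ?y \<alpha>))\<^sup>2 = (cmod (coef x \<alpha>))\<^sup>2" if "\<alpha> \<in> UNIV - F" for \<alpha>
      using that by (simp add: c[OF F] del: coef_minus)
    ultimately show ?thesis using has_sum_unique has_sum_cong by (metis (no_types, lifting))
  qed
  have "((\<lambda>F. (norm x)\<^sup>2 - (\<Sum>\<alpha>\<in>F. (cmod (coef x \<alpha>))\<^sup>2)) \<longlongrightarrow> (norm x)\<^sup>2 - (norm x)\<^sup>2) (finite_subsets_at_top UNIV)"
    using norm_has_sum[of x] unfolding has_sum_def by (intro tendsto_diff tendsto_const)
  then have "((\<lambda>F. (norm x)\<^sup>2 - (\<Sum>\<alpha>\<in>F. (cmod (coef x \<alpha>))\<^sup>2)) \<longlongrightarrow> 0) (finite_subsets_at_top UNIV)"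
    by simp
  then have "((\<lambda>F. (norm (x - (\<Sum>\<alpha>\<in>F. coef x \<alpha> *\<^sub>C hmonomial \<alpha>)))\<^sup>2) \<longlongrightarrow> 0) (finite_subsets_at_top UNIV)"
    by (rule Lim_transform_eventually[where f = "\<lambda>F. (norm x)\<^sup>2 - (\<Sum>\<alpha>\<in>F. (cmod (coef x \<alpha>))\<^sup>2)"])
      (auto intro!: eventually_finite_subsets_at_top_weakI simp: eq)
  then have "((\<lambda>F. norm (x - (\<Sum>\<alpha>\<in>F. coef x \<alpha> *\<^sub>C hmonomial \<alpha>))) \<longlongrightarrow> 0) (finite_subsets_at_top UNIV)"
    using tendsto_real_sqrt by fastforce
  then have "((\<lambda>F. norm ((\<Sum>\<alpha>\<in>F. coef x \<alpha> *\<^sub>C hmonomial \<alpha>) - x)) \<longlongrightarrow> 0) (finite_subsets_at_top UNIV)"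
    by (simp add: norm_minus_commute)
  then show ?thesis unfolding has_sum_def by (simp add: tendsto_norm_zero_iff LIM_zero_iff)
qed

text \<open>
  Polynomials are dense, so a closed linear condition need only be checked on monomials.
\<close>
lemma hardy_closed_induct:
  assumes "closed {x :: 'n::finite hardy. P x}" "P 0" "\<And>x y. P x \<Longrightarrow> P y \<Longrightarrow> P (x + y)"
    "\<And>c x. P x \<Longrightarrow> P (c *\<^sub>C x)" "\<And>\<alpha>. P (hmonomial \<alpha>)"
  shows "P x"
proof -
  have "P (\<Sum>\<alpha>\<in>F. coef x \<alpha> *\<^sub>C hmonomial \<alpha>)" for F
    by (induction F rule: infinite_finite_induct) (use assms in auto)
  then have "x \<in> {x. P x}"
    using monomial_expansion[of x] unfolding has_sum_def
    by (intro Lim_in_closed_set[OF assms(1) _ finite_subsets_at_top_neq_bot]) (auto intro: always_eventually)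
  then show ?thesis by simp
qed

section \<open>Multiplication operators and their adjoints\<close>

lemma slice_integral_le_norm: "0 \<le> r \<Longrightarrow> r < 1 \<Longrightarrow> slice_integral (fn x) r \<le> (norm x)\<^sup>2"
  by (rule has_sum_mono[OF parseval_slice[OF fn_analytic] norm_has_sum[unfolded coef_def]])
    (auto intro!: mult_left_le power_le_one)

lemma norm_le_slice_integral:
  assumes "\<And>r. 0 \<le> r \<Longrightarrow> r < 1 \<Longrightarrow> slice_integral (fn x) r \<le> B" and "0 \<le> B"
  shows "(norm x)\<^sup>2 \<le> B"
proof -
  have "hardy_sup (fn x) = (SUP r\<in>{0..<1}. ennreal (slice_integral (fn x) r))"
    by (intro hardy_sup_slice_integral fn_analytic fn_off_polydisc)
  also have "\<dots> \<le> ennreal B"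
    using assms by (intro SUP_least ennreal_leI) auto
  finally have "enn2real (hardy_sup (fn x)) \<le> B"
    using assms(2) by (metis enn2real_ennreal enn2real_mono ennreal_less_top)
  moreover have "sqrt (enn2real (hardy_sup (fn x))) = norm x"
    using hardy_norm_fn[of x] by (simp add: hardy_norm_def)
  ultimately show ?thesis by (metis enn2real_nonneg real_sqrt_pow2)
qed

lemma analytic_polydisc_times:
  assumes "analytic_polydisc f" "analytic_polydisc g"
  shows "analytic_polydisc (\<lambda>z. f z * g z)"
  unfolding analytic_polydisc_def
proof
  fix z :: "complex ^ 'a" assume z: "z \<in> polydisc"
  obtain D E where D: "(f has_derivative D) (at z)" "\<And>c v. D (c *s v) = c * D v"
    and E: "(g has_derivative E) (at z)" "\<And>c v. E (c *s v) = c * E v"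
    using assms z unfolding analytic_polydisc_def by metis
  have "((\<lambda>z. f z * g z) has_derivative (\<lambda>v. f z * E v + D v * g z)) (at z)"
    using D(1) E(1) by (rule has_derivative_mult)
  moreover have "f z * E (c *s v) + D (c *s v) * g z = c * (f z * E v + D v * g z)" for c v
    by (simp add: D(2) E(2) algebra_simps)
  ultimately show "\<exists>D. ((\<lambda>z. f z * g z) has_derivative D) (at z) \<and> (\<forall>c v. D (c *s v) = c * D v)"
    by blast
qed

lemma HinfD: "\<phi> \<in> Hinf \<Longrightarrow> analytic_polydisc \<phi>"
  by (simp add: Hinf_def)

lemma Hinf_bound:
  assumes "\<phi> \<in> Hinf" obtains K where "0 \<le> K" "\<And>z. z \<in> polydisc \<Longrightarrow> cmod (\<phi> z) \<le> K"
proof -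
  obtain K where K: "\<And>z. z \<in> polydisc \<Longrightarrow> cmod (\<phi> z) \<le> K" using assms by (auto simp: Hinf_def)
  then have "cmod (\<phi> z) \<le> max 0 K" if "z \<in> polydisc" for z using that by (simp add: le_max_iff_disj)
  then show ?thesis using that[of "max 0 K"] by simp
qed

definition mult :: "(complex ^ 'n::finite \<Rightarrow> complex) \<Rightarrow> 'n hardy \<Rightarrow> 'n hardy" where
  "mult \<phi> x = Hardy (\<lambda>z. \<phi> z * fn x z)"

lemma slice_integral_times_le:
  fixes \<phi> :: "complex ^ 'n::finite \<Rightarrow> complex"
  assumes \<phi>: "analytic_polydisc \<phi>" and K: "\<And>z. z \<in> polydisc \<Longrightarrow> cmod (\<phi> z) \<le> K" and r: "0 \<le> r" "r < 1"
  shows "slice_integral (\<lambda>z. \<phi> z * fn x z) r \<le> K\<^sup>2 * (norm x)\<^sup>2"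
proof -
  have "slice_integral (\<lambda>z. \<phi> z * fn x z) r \<le> (LINT \<theta>|angles. K\<^sup>2 * (cmod (fn x (r *\<^sub>R torus_point \<theta>)))\<^sup>2)"
    unfolding slice_integral_def
  proof (rule integral_mono)
    show "integrable angles (\<lambda>\<theta>. (cmod (\<phi> (r *\<^sub>R torus_point \<theta>) * fn x (r *\<^sub>R torus_point \<theta>)))\<^sup>2)"
      using integrable_slice_square[OF analytic_polydisc_continuous_on[OF analytic_polydisc_times[OF \<phi> fn_analytic]] r] .
    show "integrable angles (\<lambda>\<theta>. K\<^sup>2 * (cmod (fn x (r *\<^sub>R torus_point \<theta>)))\<^sup>2)"
      by (intro integrable_mult_right integrable_slice_square analytic_polydisc_continuous_on fn_analytic r)
    fix \<theta> :: "'n \<Rightarrow> real"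
    have "cmod (\<phi> (r *\<^sub>R torus_point \<theta>)) \<le> K" by (intro K scaleR_torus_point_in_polydisc r)
    then show "(cmod (\<phi> (r *\<^sub>R torus_point \<theta>) * fn x (r *\<^sub>R torus_point \<theta>)))\<^sup>2 \<le> K\<^sup>2 * (cmod (fn x (r *\<^sub>R torus_point \<theta>)))\<^sup>2"
      by (simp add: norm_mult power_mult_distrib mult_right_mono power_mono)
  qed
  also have "\<dots> = K\<^sup>2 * slice_integral (fn x) r" unfolding slice_integral_def by simp
  also have "\<dots> \<le> K\<^sup>2 * (norm x)\<^sup>2" by (intro mult_left_mono slice_integral_le_norm r) auto
  finally show ?thesis .
qed

lemma times_fn_in_H2:
  assumes "\<phi> \<in> Hinf" shows "(\<lambda>z. \<phi> z * fn x z) \<in> H2"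
proof -
  obtain K where K: "\<And>z. z \<in> polydisc \<Longrightarrow> cmod (\<phi> z) \<le> K" using assms by (auto simp: Hinf_def)
  have an: "analytic_polydisc (\<lambda>z. \<phi> z * fn x z)"
    by (intro analytic_polydisc_times fn_analytic HinfD assms)
  have "hardy_sup (\<lambda>z. \<phi> z * fn x z) = (SUP r\<in>{0..<1}. ennreal (slice_integral (\<lambda>z. \<phi> z * fn x z) r))"
    using an by (rule hardy_sup_slice_integral) (simp add: fn_off_polydisc)
  also have "\<dots> \<le> ennreal (K\<^sup>2 * (norm x)\<^sup>2)"
    using slice_integral_times_le[OF HinfD[OF assms] K] by (intro SUP_least ennreal_leI) auto
  finally have "hardy_sup (\<lambda>z. \<phi> z * fn x z) < \<infinity>"
    by (metis ennreal_less_top infinity_ennreal_def order_le_less_trans)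
  then show ?thesis using an by (simp add: H2_def fn_off_polydisc)
qed

lemma fn_mult: "\<phi> \<in> Hinf \<Longrightarrow> fn (mult \<phi> x) z = \<phi> z * fn x z"
  by (simp add: mult_def Hardy_inverse times_fn_in_H2)

lemma norm_mult_le:
  assumes "\<phi> \<in> Hinf" "\<And>z. z \<in> polydisc \<Longrightarrow> cmod (\<phi> z) \<le> K" "0 \<le> K"
  shows "norm (mult \<phi> x) \<le> K * norm x"
proof -
  have "fn (mult \<phi> x) = (\<lambda>z. \<phi> z * fn x z)" using fn_mult[OF assms(1)] by (rule ext)
  then have "slice_integral (fn (mult \<phi> x)) r \<le> K\<^sup>2 * (norm x)\<^sup>2" if "0 \<le> r" "r < 1" for r
    using slice_integral_times_le[OF HinfD[OF assms(1)] assms(2) that, of x] by simp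
  then have "(norm (mult \<phi> x))\<^sup>2 \<le> (K * norm x)\<^sup>2"
    using norm_le_slice_integral[of "mult \<phi> x" "K\<^sup>2 * (norm x)\<^sup>2"] by (simp add: power_mult_distrib)
  then show ?thesis using assms(3) by (simp add: power2_le_iff_abs_le)
qed

lemma mult_add: "\<phi> \<in> Hinf \<Longrightarrow> mult \<phi> (x + y) = mult \<phi> x + mult \<phi> y"
  and mult_scaleC: "\<phi> \<in> Hinf \<Longrightarrow> mult \<phi> (c *\<^sub>C x) = c *\<^sub>C mult \<phi> x"
  and mult_diff: "\<phi> \<in> Hinf \<Longrightarrow> mult \<phi> (x - y) = mult \<phi> x - mult \<phi> y"
  and mult_zero: "\<phi> \<in> Hinf \<Longrightarrow> mult \<phi> 0 = 0"
  by (rule hardy_eqI_fn; simp add: fn_mult algebra_simps)+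

lemma mult_commute:
  assumes "\<phi> \<in> Hinf" "\<psi> \<in> Hinf"
  shows "mult \<phi> (mult \<psi> x) = mult \<psi> (mult \<phi> x)"
  by (rule hardy_eqI_fn) (simp only: fn_mult[OF assms(1)] fn_mult[OF assms(2)] mult.left_commute)

lemma bounded_linear_mult:
  assumes "\<phi> \<in> Hinf" shows "bounded_linear (mult \<phi>)"
proof -
  obtain K where K: "0 \<le> K" "\<And>z. z \<in> polydisc \<Longrightarrow> cmod (\<phi> z) \<le> K" using Hinf_bound[OF assms] by metis
  show ?thesis
    by (rule bounded_linear_intro[where K = K])
      (use assms norm_mult_le[OF assms K(2,1)] in \<open>auto simp: mult_add mult_scaleC scaleR_eq_scaleC mult.commute\<close>)
qed

lemma inner_Hinf: "inner_function \<phi> \<Longrightarrow> \<phi> \<in> Hinf"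
  by (simp add: inner_function_def)

lemma inner_function_1: "inner_function (\<lambda>_. 1)"
proof -
  have "analytic_polydisc (\<lambda>_ :: complex ^ 'a. 1)"
    unfolding analytic_polydisc_def by (intro ballI exI[of _ "\<lambda>_. 0"]) auto
  moreover have "\<exists>w. ((\<lambda>r::real. 1 :: complex) \<longlongrightarrow> w) (at_left 1) \<and> cmod w = 1"
    by (intro exI[of _ 1]) auto
  ultimately show ?thesis by (auto simp: inner_function_def Hinf_def)
qed

text \<open>
  Multiplication by an inner function is an isometry: on polynomials both norms are the mean of
  \<open>\<bar>G\<bar>\<^sup>2\<close> over the torus, and both sides are continuous.
\<close>
lemma norm_mult_inner:
  assumes \<phi>: "inner_function \<phi>"
  shows "norm (mult \<phi> x) = norm x"
proof -
  have eq: "norm (mult \<phi> (\<Sum>\<alpha>\<in>F. coef x \<alpha> *\<^sub>C hmonomial \<alpha>)) = norm (\<Sum>\<alpha>\<in>F. coef x \<alpha> *\<^sub>C hmonomial \<alpha>)" for F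
  proof -
    let ?p = "\<Sum>\<alpha>\<in>F. coef x \<alpha> *\<^sub>C hmonomial \<alpha>"
    define G where "G = (\<lambda>z. \<Sum>\<alpha>\<in>F. coef x \<alpha> * monomial_at \<alpha> z)"
    have G: "continuous_on UNIV G" unfolding G_def monomial_at_def by (intro continuous_intros)
    have p: "fn ?p z = G z" if "z \<in> polydisc" for z using that by (simp add: G_def fn_monomial)
    have "hardy_sup (fn (mult \<phi> ?p)) = ennreal (LINT \<theta>|angles. (cmod (G (torus_point \<theta>)))\<^sup>2)"
      by (rule hardy_sup_inner_times[OF \<phi> fn_analytic _ G])
        (simp_all only: fn_mult[OF inner_Hinf[OF \<phi>]] p fn_off_polydisc mult_zero_right not_False_eq_True)
    moreover have "hardy_sup (fn ?p) = ennreal (LINT \<theta>|angles. (cmod (G (torus_point \<theta>)))\<^sup>2)"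
      by (rule hardy_sup_inner_times[OF inner_function_1 fn_analytic _ G])
        (simp_all only: p fn_off_polydisc mult_1_left not_False_eq_True)
    ultimately show ?thesis by (simp only: hardy_norm_fn[symmetric] hardy_norm_def)
  qed
  have lim: "((\<lambda>F. \<Sum>\<alpha>\<in>F. coef x \<alpha> *\<^sub>C hmonomial \<alpha>) \<longlongrightarrow> x) (finite_subsets_at_top UNIV)"
    using monomial_expansion[of x] by (simp add: has_sum_def)
  have "((\<lambda>F. norm (mult \<phi> (\<Sum>\<alpha>\<in>F. coef x \<alpha> *\<^sub>C hmonomial \<alpha>))) \<longlongrightarrow> norm (mult \<phi> x)) (finite_subsets_at_top UNIV)"
    by (intro tendsto_norm bounded_linear.tendsto[OF bounded_linear_mult[OF inner_Hinf[OF \<phi>]]] lim)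
  moreover have "((\<lambda>F. norm (mult \<phi> (\<Sum>\<alpha>\<in>F. coef x \<alpha> *\<^sub>C hmonomial \<alpha>))) \<longlongrightarrow> norm x) (finite_subsets_at_top UNIV)"
    unfolding eq by (intro tendsto_norm lim)
  ultimately show ?thesis by (rule tendsto_unique[OF finite_subsets_at_top_neq_bot])
qed

lemma cinner_mult_mult:
  assumes "inner_function \<phi>" shows "cinner (mult \<phi> x) (mult \<phi> y) = cinner x y"
proof -
  have "mult \<phi> x + c *\<^sub>C mult \<phi> y = mult \<phi> (x + c *\<^sub>C y)" for c
    using inner_Hinf[OF assms] by (simp add: mult_add mult_scaleC)
  then show ?thesis by (simp add: polarization norm_mult_inner[OF assms])
qed

lemma bessel:
  assumes F: "finite F" and on: "\<And>i j. i \<in> F \<Longrightarrow> j \<in> F \<Longrightarrow> cinner (u i) (u j) = (if i = j then 1 else 0)"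
  shows "(\<Sum>i\<in>F. (cmod (cinner x (u i)))\<^sup>2) \<le> (norm x)\<^sup>2"
proof -
  define p where "p = (\<Sum>i\<in>F. cinner x (u i) *\<^sub>C u i)"
  have xu: "cinner p (u j) = cinner x (u j)" if j: "j \<in> F" for j
  proof -
    have "cinner p (u j) = (\<Sum>i\<in>F. cinner x (u i) * cinner (u i) (u j))"
      by (simp add: p_def cinner_sum_left)
    also have "\<dots> = (\<Sum>i\<in>F. if i = j then cinner x (u i) else 0)"
      by (intro sum.cong refl) (simp add: on j)
    finally show ?thesis using F j by simp
  qed
  define N where "N = (\<Sum>i\<in>F. (cmod (cinner x (u i)))\<^sup>2)"
  have N: "complex_of_real N = (\<Sum>i\<in>F. cinner x (u i) * cnj (cinner x (u i)))"
    by (simp only: N_def of_real_sum complex_norm_square)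
  have "cinner x p = complex_of_real N"
    by (simp add: p_def N cinner_sum_right mult.commute)
  moreover have "cinner p p = complex_of_real N"
    by (subst (2) p_def) (simp add: cinner_sum_right xu N mult.commute)
  moreover have "cinner p x = complex_of_real N"
    using \<open>cinner x p = _\<close> cinner_commute[of x p] by simp
  ultimately have "cinner (x - p) (x - p) = complex_of_real ((norm x)\<^sup>2 - N)"
    by (simp add: cinner_diff_left cinner_diff_right cinner_self[of x])
  then have "(norm (x - p))\<^sup>2 = (norm x)\<^sup>2 - N" unfolding cinner_self by (simp only: of_real_eq_iff)
  then have "N \<le> (norm x)\<^sup>2" using zero_le_power2[of "norm (x - p)"] by linarith
  then show ?thesis by (simp add: N_def)
qed

text \<open>
  The coefficients of \<open>adj \<phi> x\<close> are forced by
  \<open>\<langle>adj \<phi> x, z\<^sup>\<alpha>\<rangle> = \<langle>x, \<phi> z\<^sup>\<alpha>\<rangle>\<close>.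
  For inner \<open>\<phi>\<close> the functions \<open>\<phi> z\<^sup>\<alpha>\<close> are orthonormal, and
  Bessel's inequality makes these coefficients square summable, so the adjoint exists without an appeal to
  completeness.
\<close>
definition adj :: "(complex ^ 'n::finite \<Rightarrow> complex) \<Rightarrow> 'n hardy \<Rightarrow> 'n hardy" where
  "adj \<phi> x = of_coef (\<lambda>\<alpha>. cinner x (mult \<phi> (hmonomial \<alpha>)))"

lemma coef_adj:
  assumes \<phi>: "inner_function \<phi>" shows "coef (adj \<phi> x) \<alpha> = cinner x (mult \<phi> (hmonomial \<alpha>))"
proof -
  have "square_summable (\<lambda>\<alpha>. cinner x (mult \<phi> (hmonomial \<alpha>)))"
  proof (rule nonneg_bdd_above_summable_on)
    show "bdd_above (sum (\<lambda>\<alpha>. (cmod (cinner x (mult \<phi> (hmonomial \<alpha>))))\<^sup>2) ` {F. F \<subseteq> UNIV \<and> finite F})"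
    proof (rule bdd_aboveI2)
      fix F :: "('a \<Rightarrow> nat) set" assume "F \<in> {F. F \<subseteq> UNIV \<and> finite F}"
      then show "(\<Sum>\<alpha>\<in>F. (cmod (cinner x (mult \<phi> (hmonomial \<alpha>))))\<^sup>2) \<le> (norm x)\<^sup>2"
        by (intro bessel) (auto simp: cinner_mult_mult[OF \<phi>])
    qed
  qed simp
  then show ?thesis by (simp add: adj_def)
qed

lemma cinner_adj_left:
  assumes \<phi>: "inner_function \<phi>" shows "cinner (adj \<phi> x) y = cinner x (mult \<phi> y)"
proof (induction y rule: hardy_closed_induct)
  show "closed {y. cinner (adj \<phi> x) y = cinner x (mult \<phi> y)}"
    by (intro closed_Collect_eq linear_continuous_on bounded_linear_cinner_right
        bounded_linear_compose[OF bounded_linear_cinner_right bounded_linear_mult[OF inner_Hinf[OF \<phi>]]])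
qed (simp_all add: mult_zero mult_add mult_scaleC inner_Hinf[OF \<phi>] cinner_add_right coef_adj[OF \<phi>])

lemma cinner_adj_right:
  assumes \<phi>: "inner_function \<phi>" shows "cinner x (adj \<phi> y) = cinner (mult \<phi> x) y"
  using cinner_adj_left[OF \<phi>, of y x] by (metis cinner_commute)

lemma adj_mult: "inner_function \<phi> \<Longrightarrow> adj \<phi> (mult \<phi> x) = x"
  by (rule cinner_eqI) (simp add: cinner_adj_left cinner_mult_mult)

lemma adj_add: "inner_function \<phi> \<Longrightarrow> adj \<phi> (x + y) = adj \<phi> x + adj \<phi> y"
  and adj_diff: "inner_function \<phi> \<Longrightarrow> adj \<phi> (x - y) = adj \<phi> x - adj \<phi> y"
  and adj_scaleC: "inner_function \<phi> \<Longrightarrow> adj \<phi> (c *\<^sub>C x) = c *\<^sub>C adj \<phi> x"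
  and adj_zero: "inner_function \<phi> \<Longrightarrow> adj \<phi> 0 = 0"
  by (rule cinner_eqI; simp add: cinner_adj_left cinner_add_left cinner_diff_left)+

lemma adj_commute: "inner_function \<phi> \<Longrightarrow> inner_function \<psi> \<Longrightarrow> adj \<phi> (adj \<psi> x) = adj \<psi> (adj \<phi> x)"
  by (rule cinner_eqI) (simp add: cinner_adj_left mult_commute[OF inner_Hinf inner_Hinf, of \<phi> \<psi>])

lemma norm_adj_le:
  assumes "inner_function \<phi>" shows "norm (adj \<phi> x) \<le> norm x"
proof -
  have "(norm (adj \<phi> x))\<^sup>2 = cmod (cinner (adj \<phi> x) (adj \<phi> x))"
    by (simp add: cinner_self norm_power)
  also have "\<dots> = cmod (cinner x (mult \<phi> (adj \<phi> x)))" by (simp add: cinner_adj_left assms)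
  also have "\<dots> \<le> norm x * norm (adj \<phi> x)"
    using cinner_Cauchy_Schwarz[of x "mult \<phi> (adj \<phi> x)"] by (simp add: norm_mult_inner assms)
  finally show ?thesis
    by (cases "adj \<phi> x = 0") (simp_all add: power2_eq_square)
qed

lemma bounded_linear_adj:
  assumes "inner_function \<phi>" shows "bounded_linear (adj \<phi>)"
  by (rule bounded_linear_intro[where K = 1])
    (use norm_adj_le[OF assms] in \<open>auto simp: adj_add adj_scaleC scaleR_eq_scaleC assms\<close>)

section \<open>Coordinate shifts and model spaces\<close>

text \<open>
  Powers of a coordinate function are inner, so the shifts \<open>mult (coord i m)\<close> and the backward
  shifts \<open>adj (coord i m)\<close> are instances of the operators above.
\<close>
definition coord :: "'n::finite \<Rightarrow> nat \<Rightarrow> complex ^ 'n \<Rightarrow> complex" where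
  "coord i m z = (z $ i) ^ m"

lemma inner_coord: "inner_function (coord i m :: complex ^ 'n::finite \<Rightarrow> complex)"
proof -
  have an: "analytic_polydisc (coord i m :: complex ^ 'n \<Rightarrow> complex)"
    unfolding analytic_polydisc_def
  proof
    fix z :: "complex ^ 'n"
    have "((\<lambda>z :: complex ^ 'n. z $ i) has_derivative (\<lambda>v. v $ i)) (at z)"
      by (rule bounded_linear_imp_has_derivative[OF bounded_linear_vec_nth])
    then have "(coord i m has_derivative (\<lambda>v. of_nat m * (z $ i) ^ (m - 1) * (v $ i))) (at z)"
      using has_derivative_power[of "\<lambda>z. z $ i" "\<lambda>v. v $ i" z UNIV m] by (simp add: coord_def[abs_def] mult_ac)
    then show "\<exists>D. (coord i m has_derivative D) (at z) \<and> (\<forall>c v. D (c *s v) = c * D v)"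
      by (intro exI[of _ "\<lambda>v. of_nat m * (z $ i) ^ (m - 1) * (v $ i)"]) (simp add: mult_ac)
  qed
  have "cmod (coord i m z) \<le> 1" if "z \<in> polydisc" for z :: "complex ^ 'n"
    using that by (simp add: coord_def norm_power polydisc_def power_le_one less_imp_le)
  then have H: "coord i m \<in> (Hinf :: (complex ^ 'n \<Rightarrow> complex) set)"
    using an by (auto simp: Hinf_def)
  have "{z :: complex ^ 'n. cmod (z $ i) = 1} \<in> sets borel"
    by (intro borel_closed closed_Collect_eq continuous_intros)
  then have "AE z in (torus_measure :: (complex ^ 'n) measure). cmod (z $ i) = 1"
    unfolding torus_measure_eq by (subst AE_distr_iff[OF measurable_torus_point]) auto
  then have "AE z in (torus_measure :: (complex ^ 'n) measure).
      \<exists>w. ((\<lambda>r::real. coord i m (r *\<^sub>R z)) \<longlongrightarrow> w) (at_left 1) \<and> cmod w = 1"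
  proof (rule AE_mp, intro AE_I2 impI)
    fix z :: "complex ^ 'n" assume z: "cmod (z $ i) = 1"
    have "((\<lambda>r::real. (r *\<^sub>R (z $ i)) ^ m) \<longlongrightarrow> (1 *\<^sub>R (z $ i)) ^ m) (at_left 1)"
      by (intro tendsto_intros)
    then show "\<exists>w. ((\<lambda>r::real. coord i m (r *\<^sub>R z)) \<longlongrightarrow> w) (at_left 1) \<and> cmod w = 1"
      using z by (intro exI[of _ "(z $ i) ^ m"]) (simp add: coord_def vector_scaleR_component norm_power)
  qed
  then show ?thesis using H by (simp add: inner_function_def)
qed

lemma coord_Hinf: "coord i m \<in> Hinf"
  by (rule inner_Hinf[OF inner_coord])

lemma monomial_at_upd: "monomial_at (\<alpha>(i := \<alpha> i + m)) z = coord i m z * monomial_at \<alpha> z"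
proof -
  have "monomial_at (\<alpha>(i := \<alpha> i + m)) z = (\<Prod>j\<in>UNIV. (if j = i then (z $ i) ^ m else 1) * (z $ j) ^ \<alpha> j)"
    unfolding monomial_at_def by (intro prod.cong) (auto simp: power_add)
  then show ?thesis by (simp add: prod.distrib monomial_at_def coord_def)
qed

lemma mult_coord_hmonomial: "mult (coord i m) (hmonomial \<alpha>) = hmonomial (\<alpha>(i := \<alpha> i + m))"
  by (rule hardy_eqI_fn) (simp only: fn_mult[OF coord_Hinf] fn_monomial monomial_at_upd)

lemma coef_adj_coord: "coef (adj (coord i m) x) \<alpha> = coef x (\<alpha>(i := \<alpha> i + m))"
  by (simp add: coef_adj inner_coord mult_coord_hmonomial)

lemma coef_mult_coord: "coef (mult (coord i m) x) \<alpha> = (if m \<le> \<alpha> i then coef x (\<alpha>(i := \<alpha> i - m)) else 0)"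
proof -
  have "adj (coord i m) (hmonomial \<alpha>) = (if m \<le> \<alpha> i then hmonomial (\<alpha>(i := \<alpha> i - m)) else 0)"
    by (rule hardy_eqI) (auto simp: coef_adj_coord fun_eq_iff split: if_splits)
  moreover have "coef (mult (coord i m) x) \<alpha> = cinner x (adj (coord i m) (hmonomial \<alpha>))"
    by (simp add: cinner_adj_right inner_coord)
  ultimately show ?thesis by simp
qed

lemma adj_coord_mult_coord:
  assumes "i \<noteq> j"
  shows "adj (coord i m) (mult (coord j k) x) = mult (coord j k) (adj (coord i m) x)"
  by (rule hardy_eqI) (use assms in \<open>simp add: coef_adj_coord coef_mult_coord fun_upd_twist\<close>)

lemma adj_coord_add: "adj (coord i (m + k)) x = adj (coord i m) (adj (coord i k) x)"
  by (rule hardy_eqI) (simp add: coef_adj_coord add.assoc)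

lemma adj_coord_one: "adj (coord i (Suc m)) (hmonomial (\<lambda>_. 0)) = 0"
proof (rule hardy_eqI)
  fix \<alpha> :: "'a \<Rightarrow> nat"
  have "\<alpha>(i := \<alpha> i + Suc m) \<noteq> (\<lambda>_. 0)"
  proof
    assume "\<alpha>(i := \<alpha> i + Suc m) = (\<lambda>_. 0)"
    from fun_cong[OF this, of i] show False by simp
  qed
  then show "coef (adj (coord i (Suc m)) (hmonomial (\<lambda>_. 0))) \<alpha> = coef 0 \<alpha>" by (simp add: coef_adj_coord)
qed

lemma adj_coord_tendsto_0: "(\<lambda>m. adj (coord i m) x) \<longlonglongrightarrow> 0"
proof (rule LIMSEQ_I)
  fix \<epsilon> :: real assume "0 < \<epsilon>"
  have "((\<lambda>F. \<Sum>\<alpha>\<in>F. coef x \<alpha> *\<^sub>C hmonomial \<alpha>) \<longlongrightarrow> x) (finite_subsets_at_top UNIV)"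
    using monomial_expansion[of x] by (simp add: has_sum_def)
  then have "\<forall>\<^sub>F F in finite_subsets_at_top UNIV. dist (\<Sum>\<alpha>\<in>F. coef x \<alpha> *\<^sub>C hmonomial \<alpha>) x < \<epsilon>"
    using \<open>0 < \<epsilon>\<close> by (rule tendstoD)
  moreover have "\<forall>\<^sub>F F in finite_subsets_at_top (UNIV :: ('a \<Rightarrow> nat) set). finite F"
    by (auto intro: eventually_finite_subsets_at_top_weakI)
  ultimately have "\<forall>\<^sub>F F in finite_subsets_at_top UNIV. finite F \<and> dist (\<Sum>\<alpha>\<in>F. coef x \<alpha> *\<^sub>C hmonomial \<alpha>) x < \<epsilon>"
    by eventually_elim simp
  then obtain F where F: "finite F" "dist (\<Sum>\<alpha>\<in>F. coef x \<alpha> *\<^sub>C hmonomial \<alpha>) x < \<epsilon>"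
    using eventually_happens'[OF finite_subsets_at_top_neq_bot] by blast
  define p where "p = (\<Sum>\<alpha>\<in>F. coef x \<alpha> *\<^sub>C hmonomial \<alpha>)"
  define N where "N = Suc (Max (insert 0 ((\<lambda>\<alpha>. \<alpha> i) ` F)))"
  have N: "\<alpha> i < N" if "\<alpha> \<in> F" for \<alpha>
    unfolding N_def using that F(1) by (simp add: less_Suc_eq_le)
  show "\<exists>N. \<forall>m\<ge>N. norm (adj (coord i m) x - 0) < \<epsilon>"
  proof (intro exI[of _ N] allI impI)
    fix m assume m: "N \<le> m"
    have "adj (coord i m) p = 0"
    proof (rule hardy_eqI)
      fix \<beta>
      have "coef p (\<beta>(i := \<beta> i + m)) = 0"
        unfolding p_def using N m by (fastforce intro!: sum.neutral)
      then show "coef (adj (coord i m) p) \<beta> = coef 0 \<beta>" by (simp add: coef_adj_coord)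
    qed
    then have "adj (coord i m) x = adj (coord i m) (x - p)"
      by (simp add: adj_diff inner_coord)
    then have "norm (adj (coord i m) x) \<le> norm (x - p)"
      by (simp add: norm_adj_le inner_coord)
    also have "\<dots> < \<epsilon>" using F(2) by (simp add: p_def dist_norm norm_minus_commute)
    finally show "norm (adj (coord i m) x - 0) < \<epsilon>" by simp
  qed
qed

lemma adj_coord_eq_0_iff: "adj (coord i (Suc 0)) x = 0 \<longleftrightarrow> \<not> depends_on (fn x) i"
proof
  assume 0: "adj (coord i (Suc 0)) x = 0"
  have c: "coef x \<alpha> = 0" if "\<alpha> i \<noteq> 0" for \<alpha>
  proof -
    have "coef (adj (coord i (Suc 0)) x) (\<alpha>(i := \<alpha> i - 1)) = 0" using 0 by simp
    then show ?thesis using that by (simp add: coef_adj_coord fun_upd_idem)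
  qed
  have "fn x z = fn x w" if "z \<in> polydisc" "w \<in> polydisc" and eq: "\<And>j. j \<noteq> i \<Longrightarrow> z $ j = w $ j" for z w
  proof -
    have "coef x \<alpha> * monomial_at \<alpha> z = coef x \<alpha> * monomial_at \<alpha> w" for \<alpha>
    proof (cases "\<alpha> i = 0")
      case True
      then have "(z $ j) ^ \<alpha> j = (w $ j) ^ \<alpha> j" for j using eq[of j] by (cases "j = i") auto
      then show ?thesis by (simp add: monomial_at_def)
    qed (simp add: c)
    then have "(\<lambda>\<alpha>. coef x \<alpha> * monomial_at \<alpha> z) = (\<lambda>\<alpha>. coef x \<alpha> * monomial_at \<alpha> w)" by (rule ext)
    then show ?thesis using fn_has_sum[OF that(2), of x] that(1) by (intro fn_eqI) (simp_all only:)
  qed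
  then show "\<not> depends_on (fn x) i" unfolding depends_on_def by blast
next
  assume nd: "\<not> depends_on (fn x) i"
  have cx: "coef x = (\<lambda>\<alpha>. if \<alpha> i = 0 then coef x \<alpha> else 0)"
  proof (rule coef_eqI)
    fix z :: "complex ^ 'a" assume z: "z \<in> polydisc"
    define w where "w = (\<chi> j. if j = i then 0 else z $ j)"
    have w: "w \<in> polydisc" using z by (simp add: w_def polydisc_def)
    have "z $ j = w $ j" if "j \<noteq> i" for j using that by (simp add: w_def)
    then have "fn x w = fn x z"
      using nd z w unfolding depends_on_def by force
    moreover have "coef x \<alpha> * monomial_at \<alpha> w = (if \<alpha> i = 0 then coef x \<alpha> else 0) * monomial_at \<alpha> z" for \<alpha>
    proof (cases "\<alpha> i = 0")
      case True
      then have "(w $ j) ^ \<alpha> j = (z $ j) ^ \<alpha> j" for j by (cases "j = i") (auto simp: w_def)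
      then show ?thesis using True by (simp add: monomial_at_def)
    next
      case False
      then have "(w $ i) ^ \<alpha> i = 0" by (simp add: w_def)
      then have "monomial_at \<alpha> w = 0" unfolding monomial_at_def by (intro prod_zero) auto
      then show ?thesis using False by simp
    qed
    ultimately show "((\<lambda>\<alpha>. (if \<alpha> i = 0 then coef x \<alpha> else 0) * monomial_at \<alpha> z) has_sum fn x z) UNIV"
      using fn_has_sum[OF w, of x] by simp
  qed
  have "coef x \<alpha> = 0" if "\<alpha> i \<noteq> 0" for \<alpha>
    using fun_cong[OF cx, of \<alpha>] that by simp
  then show "adj (coord i (Suc 0)) x = 0"
    by (intro hardy_eqI) (simp add: coef_adj_coord)
qed

text \<open>
  Split \<open>x = y + z\<^sub>i (S x)\<close> with \<open>S\<close> the backward shift. The function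
  \<open>y\<close> does not depend on \<open>z\<^sub>i\<close>, hence neither does \<open>\<phi> y\<close>,
  and \<open>S\<close> annihilates it.
\<close>
lemma adj_coord_mult_independent:
  assumes \<phi>: "\<phi> \<in> Hinf" and nd: "\<not> depends_on \<phi> i"
  shows "adj (coord i m) (mult \<phi> x) = mult \<phi> (adj (coord i m) x)"
proof (induction m)
  case 0
  have "adj (coord i 0) x = x" for x :: "'a hardy" by (rule hardy_eqI) (simp add: coef_adj_coord)
  then show ?case by simp
next
  case (Suc m)
  let ?S = "adj (coord i (Suc 0))" and ?Z = "mult (coord i (Suc 0))"
  have step: "?S (mult \<phi> x) = mult \<phi> (?S x)" for x
  proof -
    define y where "y = x - ?Z (?S x)"
    have "?S y = 0" by (simp add: y_def adj_diff adj_mult inner_coord)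
    then have "\<not> depends_on (fn y) i" by (simp add: adj_coord_eq_0_iff)
    then have "\<not> depends_on (fn (mult \<phi> y)) i"
      using nd unfolding depends_on_def fn_mult[OF \<phi>] by metis
    then have "?S (mult \<phi> y) = 0" by (simp add: adj_coord_eq_0_iff)
    moreover have "mult \<phi> (y + ?Z (?S x)) = mult \<phi> y + ?Z (mult \<phi> (?S x))"
      unfolding mult_add[OF \<phi>] mult_commute[OF \<phi> coord_Hinf, of i "Suc 0" "?S x"] ..
    then have "mult \<phi> x = mult \<phi> y + ?Z (mult \<phi> (?S x))" by (simp add: y_def)
    ultimately show ?thesis by (simp add: adj_add adj_mult inner_coord)
  qed
  have "adj (coord i (Suc m)) y = ?S (adj (coord i m) y)" for y
    using adj_coord_add[of i "Suc 0" m] by simp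
  then show ?case by (simp add: Suc.IH step)
qed

text \<open>
  Since \<open>mult \<phi>\<close> is an isometry, \<open>mult \<phi> \<circ> adj \<phi>\<close> is the
  orthogonal projection onto its range, and \<open>model_proj \<phi>\<close> is the one onto the model space.
\<close>
definition model_proj :: "(complex ^ 'n::finite \<Rightarrow> complex) \<Rightarrow> 'n hardy \<Rightarrow> 'n hardy" where
  "model_proj \<phi> x = x - mult \<phi> (adj \<phi> x)"

lemma adj_model_proj: "inner_function \<phi> \<Longrightarrow> adj \<phi> (model_proj \<phi> x) = 0"
  by (simp add: model_proj_def adj_diff adj_mult)

lemma model_proj_fixed_iff:
  assumes "inner_function \<phi>" shows "model_proj \<phi> x = x \<longleftrightarrow> adj \<phi> x = 0"
  using adj_model_proj[OF assms, of x] by (auto simp: model_proj_def mult_zero inner_Hinf[OF assms])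

lemma model_proj_mult: "inner_function \<phi> \<Longrightarrow> model_proj \<phi> (mult \<phi> x) = 0"
  by (simp add: model_proj_def adj_mult)

lemma cinner_model_proj:
  assumes "inner_function \<phi>" shows "cinner (model_proj \<phi> x) y = cinner x (model_proj \<phi> y)"
  by (simp add: model_proj_def cinner_diff_left cinner_diff_right cinner_adj_right[OF assms, symmetric]
      cinner_adj_left[OF assms, symmetric])

lemma model_proj_add: "inner_function \<phi> \<Longrightarrow> model_proj \<phi> (x + y) = model_proj \<phi> x + model_proj \<phi> y"
  and model_proj_diff: "inner_function \<phi> \<Longrightarrow> model_proj \<phi> (x - y) = model_proj \<phi> x - model_proj \<phi> y"
  and model_proj_scaleC: "inner_function \<phi> \<Longrightarrow> model_proj \<phi> (c *\<^sub>C x) = c *\<^sub>C model_proj \<phi> x"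
  and model_proj_zero: "inner_function \<phi> \<Longrightarrow> model_proj \<phi> 0 = 0"
  by (simp_all add: model_proj_def adj_add adj_diff adj_scaleC adj_zero mult_add mult_diff mult_scaleC mult_zero
      inner_Hinf hardy.scale_right_diff_distrib)

lemma norm_model_proj_le:
  assumes "inner_function \<phi>" shows "norm (model_proj \<phi> x) \<le> norm x"
proof -
  have "(norm (model_proj \<phi> x))\<^sup>2 = cmod (cinner (model_proj \<phi> x) (model_proj \<phi> x))"
    by (simp add: cinner_self norm_power)
  also have "\<dots> = cmod (cinner x (model_proj \<phi> x))"
    using assms by (simp add: cinner_model_proj model_proj_fixed_iff[THEN iffD2] adj_model_proj)
  also have "\<dots> \<le> norm x * norm (model_proj \<phi> x)" by (rule cinner_Cauchy_Schwarz)
  finally show ?thesis by (cases "model_proj \<phi> x = 0") (simp_all add: power2_eq_square)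
qed

lemma range_fn: "range fn = H2"
  using type_definition.Rep_range[OF type_definition_hardy] .

lemma fn_in_model_space_iff:
  assumes \<phi>: "inner_function \<phi>" shows "fn x \<in> model_space \<phi> \<longleftrightarrow> adj \<phi> x = 0"
proof -
  have "fn x \<in> model_space \<phi> \<longleftrightarrow> (\<forall>y. hardy_inner (fn x) (\<lambda>z. \<phi> z * fn y z) = 0)"
    by (simp add: model_space_def range_fn[symmetric])
  also have "\<dots> \<longleftrightarrow> (\<forall>y. cinner x (mult \<phi> y) = 0)"
  proof -
    have "(\<lambda>z. \<phi> z * fn y z) = fn (mult \<phi> y)" for y
      using fn_mult[OF inner_Hinf[OF \<phi>]] by (simp add: fun_eq_iff)
    then show ?thesis by (simp add: hardy_inner_fn)
  qed
  also have "\<dots> \<longleftrightarrow> (\<forall>y. cinner (adj \<phi> x) y = cinner 0 y)"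
    by (simp add: cinner_adj_left[OF \<phi>])
  also have "\<dots> \<longleftrightarrow> adj \<phi> x = 0" using cinner_eqI[of "adj \<phi> x" 0] by auto
  finally show ?thesis .
qed

lemma proj_onto_model_space:
  assumes \<phi>: "inner_function \<phi>"
  shows "proj_onto (model_space \<phi>) (fn x) = fn (model_proj \<phi> x)"
  unfolding proj_onto_def
proof (rule the_equality)
  have diff: "(\<lambda>z. fn x z - fn y z) = fn (x - y)" for y by (simp add: fun_eq_iff)
  have ms: "\<exists>y. g = fn y \<and> adj \<phi> y = 0" if g: "g \<in> model_space \<phi>" for g
  proof -
    have "g \<in> H2" using g by (simp add: model_space_def)
    then obtain y where "g = fn y" using range_fn by blast
    then show ?thesis using g fn_in_model_space_iff[OF \<phi>] by blast
  qed
  have orth: "cinner (x - model_proj \<phi> x) w = 0" if "adj \<phi> w = 0" for w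
    using that by (simp add: model_proj_def cinner_adj_right[OF \<phi>, symmetric])
  show "fn (model_proj \<phi> x) \<in> model_space \<phi> \<and> (\<forall>h\<in>model_space \<phi>. hardy_inner (\<lambda>z. fn x z - fn (model_proj \<phi> x) z) h = 0)"
  proof (intro conjI ballI)
    show "fn (model_proj \<phi> x) \<in> model_space \<phi>"
      by (simp only: fn_in_model_space_iff[OF \<phi>] adj_model_proj[OF \<phi>])
    fix h assume "h \<in> model_space \<phi>"
    then obtain w where "h = fn w" "adj \<phi> w = 0" using ms by blast
    then show "hardy_inner (\<lambda>z. fn x z - fn (model_proj \<phi> x) z) h = 0"
      by (simp only: diff hardy_inner_fn orth)
  qed
  fix g assume g: "g \<in> model_space \<phi> \<and> (\<forall>h\<in>model_space \<phi>. hardy_inner (\<lambda>z. fn x z - g z) h = 0)"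
  then obtain y where y: "g = fn y" "adj \<phi> y = 0" using ms by blast
  define d where "d = model_proj \<phi> x - y"
  have d: "adj \<phi> d = 0" by (simp add: d_def adj_diff adj_model_proj \<phi> y)
  then have "hardy_inner (\<lambda>z. fn x z - g z) (fn d) = 0" using g by (simp add: fn_in_model_space_iff[OF \<phi>])
  then have "cinner (x - y) d = 0" by (simp only: y diff hardy_inner_fn)
  moreover have "d = (x - y) - (x - model_proj \<phi> x)" by (simp add: d_def)
  ultimately have "cinner d d = 0" using orth[OF d] cinner_diff_left[of "x - y" "x - model_proj \<phi> x" d] by simp
  then have "d = 0" by (simp add: cinner_self)
  then show "g = fn (model_proj \<phi> x)" by (simp add: d_def y)
qed

section \<open>Consequences of finite dimension\<close>

abbreviation one :: "'n::finite hardy" where "one \<equiv> hmonomial (\<lambda>_. 0)"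

lemma fn_one: "z \<in> polydisc \<Longrightarrow> fn one z = 1"
  by (simp add: fn_monomial monomial_at_def)

lemma norm_eq_1I: assumes "cinner x x = 1" shows "norm x = 1"
proof -
  have "complex_of_real ((norm x)\<^sup>2) = complex_of_real 1" using assms cinner_self[of x] by simp
  then have "(norm x)\<^sup>2 = 1\<^sup>2" by (simp only: of_real_eq_iff one_power2)
  then show ?thesis by (simp only: power2_eq_iff_nonneg norm_ge_zero zero_le_one)
qed

lemma norm_hmonomial: "norm (hmonomial \<alpha>) = 1"
  by (rule norm_eq_1I) simp

lemma norm_monomial_at_le_1:
  assumes "z \<in> polydisc" shows "cmod (monomial_at \<alpha> z) \<le> 1"
  using assms by (auto simp: monomial_at_def norm_power polydisc_def less_imp_le
      simp flip: prod_norm intro!: prod_le_1 power_le_one)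

lemma norm_coef_le: "cmod (coef x \<alpha>) \<le> norm x"
  using cinner_Cauchy_Schwarz[of x "hmonomial \<alpha>"] by (simp add: norm_hmonomial)

lemma adj_mult_independent:
  assumes g: "inner_function g" and nd: "\<not> depends_on g i"
  shows "adj g (mult (coord i m) x) = mult (coord i m) (adj g x)"
  by (rule cinner_eqI)
    (simp add: cinner_adj_left[OF g] cinner_adj_right[OF inner_coord, symmetric]
      adj_coord_mult_independent[OF inner_Hinf[OF g] nd])

lemma model_proj_mult_independent:
  assumes g: "inner_function g" and nd: "\<not> depends_on g i"
  shows "model_proj g (mult (coord i m) x) = mult (coord i m) (model_proj g x)"
  by (simp add: model_proj_def adj_mult_independent[OF assms] mult_diff[OF coord_Hinf]
      mult_commute[OF inner_Hinf[OF g] coord_Hinf])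

text \<open>
  Suppose that \<open>z\<^sub>i\<^sup>m h\<close> is close to \<open>f u\<close> and
  \<open>z\<^sub>j\<^sup>m h\<close> is close to \<open>f v\<close>. Cancelling \<open>f\<close>, which is
  isometric, shows that \<open>z\<^sub>j\<^sup>m u\<close> is close to \<open>z\<^sub>i\<^sup>m v\<close>. The
  backward shift in \<open>z\<^sub>j\<close> commutes with multiplication by \<open>z\<^sub>i\<close>, so
  \<open>u\<close> is close to \<open>z\<^sub>i\<^sup>m w\<close> with \<open>w\<close> the
  \<open>m\<close>-th backward shift of \<open>v\<close> in \<open>z\<^sub>j\<close>. Then
  \<open>z\<^sub>i\<^sup>m h\<close> is close to \<open>z\<^sub>i\<^sup>m f w\<close>, that is,
  \<open>h\<close> is close to \<open>f w\<close>. The argument needs two different coordinates and is the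
  reason why dimension one behaves differently.
\<close>
lemma range_of_shift_limits:
  assumes f: "inner_function f" and ij: "i \<noteq> j"
    and i: "(\<lambda>m. model_proj f (mult (coord i m) h)) \<longlonglongrightarrow> 0"
    and j: "(\<lambda>m. model_proj f (mult (coord j m) h)) \<longlonglongrightarrow> 0"
  shows "model_proj f h = 0"
proof -
  define a where "a = (\<lambda>m. norm (model_proj f (mult (coord i m) h)))"
  define b where "b = (\<lambda>m. norm (model_proj f (mult (coord j m) h)))"
  have le: "norm (model_proj f h) \<le> 2 * a m + b m" for m
  proof -
    let ?Z = "mult (coord i m)" and ?W = "mult (coord j m)" and ?W' = "adj (coord j m)"
    let ?P = "model_proj f" and ?f = "mult f"
    note lin = mult_diff[OF coord_Hinf] mult_add[OF coord_Hinf] mult_diff[OF inner_Hinf[OF f]] adj_diff[OF inner_coord]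
    define u where "u = adj f (?Z h)"
    define v where "v = adj f (?W h)"
    have Z: "?f u = ?Z h - ?P (?Z h)" and W: "?f v = ?W h - ?P (?W h)"
      by (simp_all add: model_proj_def u_def v_def)
    have "?f (?W u - ?Z v) = ?W (?f u) - ?Z (?f v)"
      by (simp only: lin mult_commute[OF inner_Hinf[OF f] coord_Hinf])
    also have "\<dots> = ?Z (?P (?W h)) - ?W (?P (?Z h))"
      unfolding Z W lin mult_commute[OF coord_Hinf coord_Hinf, of j m i m h] by simp
    finally have "norm (?f (?W u - ?Z v)) \<le> b m + a m"
      using norm_triangle_ineq4[of "?Z (?P (?W h))" "?W (?P (?Z h))"]
      by (simp add: norm_mult_inner[OF inner_coord] a_def b_def)
    then have 1: "norm (?W u - ?Z v) \<le> b m + a m" by (simp add: norm_mult_inner[OF f])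
    define w where "w = ?W' v"
    have "?W' (?W u - ?Z v) = u - ?Z w"
      using ij by (simp add: lin adj_mult[OF inner_coord] adj_coord_mult_coord w_def)
    then have 2: "norm (u - ?Z w) \<le> b m + a m"
      using 1 norm_adj_le[OF inner_coord, of j m "?W u - ?Z v"] by simp
    have "?Z (h - ?f w) = ?f (u - ?Z w) + ?P (?Z h)"
      by (simp add: lin Z mult_commute[OF inner_Hinf[OF f] coord_Hinf])
    then have "norm (h - ?f w) = norm (?f (u - ?Z w) + ?P (?Z h))"
      by (metis norm_mult_inner[OF inner_coord])
    also have "\<dots> \<le> norm (u - ?Z w) + a m"
      using norm_triangle_ineq[of "?f (u - ?Z w)" "?P (?Z h)"] by (simp add: norm_mult_inner[OF f] a_def)
    finally have 3: "norm (h - ?f w) \<le> 2 * a m + b m" using 2 by simp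
    have "?P h = ?P (h - ?f w)" by (simp add: model_proj_diff[OF f] model_proj_mult[OF f])
    then show ?thesis using norm_model_proj_le[OF f, of "h - ?f w"] 3 by simp
  qed
  have "(\<lambda>m. 2 * a m + b m) \<longlonglongrightarrow> 2 * 0 + 0"
    unfolding a_def b_def using i j by (intro tendsto_intros tendsto_norm_zero)
  then have "norm (model_proj f h) \<le> 2 * 0 + 0"
    by (rule LIMSEQ_le_const) (use le in auto)
  then show ?thesis by simp
qed

lemma orthonormal_basis_of_span:
  assumes "finite B"
  shows "\<exists>A. finite A \<and> (\<forall>u\<in>A. \<forall>v\<in>A. cinner u v = (if u = v then 1 else 0)) \<and>
    (\<forall>x\<in>hardy.span B. x = (\<Sum>u\<in>A. cinner x u *\<^sub>C u))"
  using assms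
proof induction
  case empty
  show ?case by (intro exI[of _ "{}"]) simp
next
  case (insert b B)
  then obtain A where A: "finite A" "\<And>u v. u \<in> A \<Longrightarrow> v \<in> A \<Longrightarrow> cinner u v = (if u = v then 1 else 0)"
    "\<And>x. x \<in> hardy.span B \<Longrightarrow> x = (\<Sum>u\<in>A. cinner x u *\<^sub>C u)" by metis
  define r where "r = b - (\<Sum>u\<in>A. cinner b u *\<^sub>C u)"
  have split: "\<exists>k. x - k *\<^sub>C b \<in> hardy.span B" if "x \<in> hardy.span (insert b B)" for x
    using that by (simp add: hardy.span_breakdown_eq)
  have lin: "(\<Sum>u\<in>A. cinner (y + k *\<^sub>C b) u *\<^sub>C u) = (\<Sum>u\<in>A. cinner y u *\<^sub>C u) + k *\<^sub>C (\<Sum>u\<in>A. cinner b u *\<^sub>C u)" for y k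
    by (simp add: cinner_add_left hardy.scale_left_distrib sum.distrib hardy.scale_sum_right)
  show ?case
  proof (cases "r = 0")
    case True
    have "x = (\<Sum>u\<in>A. cinner x u *\<^sub>C u)" if x: "x \<in> hardy.span (insert b B)" for x
    proof -
      obtain k where k: "x - k *\<^sub>C b \<in> hardy.span B" using split[OF x] by blast
      have "(\<Sum>u\<in>A. cinner x u *\<^sub>C u) = (\<Sum>u\<in>A. cinner (x - k *\<^sub>C b) u *\<^sub>C u) + k *\<^sub>C b"
        using lin[of "x - k *\<^sub>C b" k] True by (simp add: r_def)
      then show ?thesis using A(3)[OF k] by simp
    qed
    then show ?thesis using A by blast
  next
    case False
    define e where "e = complex_of_real (inverse (norm r)) *\<^sub>C r"
    have sumA: "(\<Sum>v\<in>A. c v * cinner v u) = c u" if "u \<in> A" for c u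
    proof -
      have "(\<Sum>v\<in>A. c v * cinner v u) = (\<Sum>v\<in>A. if v = u then c v else 0)"
        using that by (intro sum.cong) (auto simp: A(2))
      then show ?thesis using that A(1) by simp
    qed
    have ru: "cinner r u = 0" if "u \<in> A" for u
      by (simp add: r_def cinner_diff_left cinner_sum_left sumA that)
    have eu: "cinner e u = 0" "cinner u e = 0" if "u \<in> A" for u
    proof -
      show "cinner e u = 0" by (simp add: e_def ru that)
      then show "cinner u e = 0" using cinner_commute[of e u] by simp
    qed
    have nr: "norm r \<noteq> 0" using False by simp
    have ee: "cinner e e = 1"
    proof -
      have "norm e = 1" using nr by (simp add: e_def norm_inverse)
      then show ?thesis by (simp add: cinner_self)
    qed
    have eA: "e \<notin> A" using eu(1) ee by force
    have re: "cinner r e *\<^sub>C e = r"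
    proof -
      have "r = complex_of_real (norm r) *\<^sub>C e" using nr by (simp add: e_def)
      then show ?thesis using ee by (metis cinner_scaleC_left mult.right_neutral)
    qed
    have ue: "cinner (\<Sum>u\<in>A. c u *\<^sub>C u) e = 0" for c
      by (simp add: cinner_sum_left eu)
    have be: "cinner b e = cinner r e"
      using ue[of "cinner b"] by (simp add: r_def cinner_diff_left)
    have "x = (\<Sum>u\<in>insert e A. cinner x u *\<^sub>C u)" if x: "x \<in> hardy.span (insert b B)" for x
    proof -
      obtain k where k: "x - k *\<^sub>C b \<in> hardy.span B" using split[OF x] by blast
      define y where "y = x - k *\<^sub>C b"
      have y: "y = (\<Sum>u\<in>A. cinner y u *\<^sub>C u)" using A(3) k by (simp add: y_def)
      have ye: "cinner y e = 0" using ue[of "cinner y"] y by simp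
      have xy: "x = y + k *\<^sub>C b" by (simp add: y_def)
      have "(\<Sum>u\<in>insert e A. cinner x u *\<^sub>C u) = cinner x e *\<^sub>C e + (\<Sum>u\<in>A. cinner x u *\<^sub>C u)"
        using A(1) eA by simp
      also have "(\<Sum>u\<in>A. cinner x u *\<^sub>C u) = y + k *\<^sub>C (b - r)"
        unfolding xy lin y[symmetric] by (simp add: r_def)
      also have "cinner x e *\<^sub>C e = k *\<^sub>C (cinner r e *\<^sub>C e)"
        by (simp add: xy cinner_add_left ye be)
      finally show ?thesis by (simp add: re xy hardy.scale_right_diff_distrib)
    qed
    moreover have "\<forall>u\<in>insert e A. \<forall>v\<in>insert e A. cinner u v = (if u = v then 1 else 0)"
      using A(2) eu ee eA by auto
    ultimately show ?thesis using A(1) by (intro exI[of _ "insert e A"]) auto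
  qed
qed

text \<open>
  The powers of a backward shift tend to \<open>0\<close> at every vector. With an orthonormal basis of the
  span, the rate at the finitely many basis vectors controls the rate on the unit ball.
\<close>
lemma uniform_decay_of_finite_dim:
  assumes B: "finite B" and "0 < \<epsilon>"
  shows "\<forall>\<^sub>F m in sequentially. \<forall>x\<in>hardy.span B. norm (adj (coord i m) x) \<le> \<epsilon> * norm x"
proof -
  obtain A where A: "finite A" "\<And>u v. u \<in> A \<Longrightarrow> v \<in> A \<Longrightarrow> cinner u v = (if u = v then 1 else 0)"
    "\<And>x. x \<in> hardy.span B \<Longrightarrow> x = (\<Sum>u\<in>A. cinner x u *\<^sub>C u)"
    using orthonormal_basis_of_span[OF B] by metis
  have n1: "norm u = 1" if "u \<in> A" for u
    using A(2)[OF that that] by (intro norm_eq_1I) simp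
  have "(\<lambda>m. \<Sum>u\<in>A. norm (adj (coord i m) u)) \<longlonglongrightarrow> (\<Sum>u\<in>A. 0)"
    by (intro tendsto_sum tendsto_norm_zero adj_coord_tendsto_0)
  then have "\<forall>\<^sub>F m in sequentially. (\<Sum>u\<in>A. norm (adj (coord i m) u)) < \<epsilon>"
    using \<open>0 < \<epsilon>\<close> by (intro order_tendstoD) auto
  then show ?thesis
  proof eventually_elim
    case (elim m)
    show ?case
    proof
      fix x assume x: "x \<in> hardy.span B"
      have s: "adj (coord i m) (\<Sum>u\<in>A. c u *\<^sub>C u) = (\<Sum>u\<in>A. c u *\<^sub>C adj (coord i m) u)" for c
        by (induction A rule: infinite_finite_induct) (simp_all add: adj_zero adj_add adj_scaleC inner_coord)
      have "norm (adj (coord i m) x) = norm (\<Sum>u\<in>A. cinner x u *\<^sub>C adj (coord i m) u)"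
        using A(3)[OF x] s by metis
      also have "\<dots> \<le> (\<Sum>u\<in>A. cmod (cinner x u) * norm (adj (coord i m) u))"
        by (rule order_trans[OF norm_sum]) simp
      also have "\<dots> \<le> (\<Sum>u\<in>A. norm x * norm (adj (coord i m) u))"
        using cinner_Cauchy_Schwarz[of x] n1 by (intro sum_mono mult_right_mono) (auto, metis mult.right_neutral)
      also have "\<dots> = norm x * (\<Sum>u\<in>A. norm (adj (coord i m) u))" by (simp add: sum_distrib_left)
      also have "\<dots> \<le> norm x * \<epsilon>" using elim by (intro mult_left_mono) auto
      finally show "norm (adj (coord i m) x) \<le> \<epsilon> * norm x" by (simp add: mult.commute)
    qed
  qed
qed

lemma summable_half_power_div:
  assumes "0 < m" shows "(\<lambda>k. (1/2 :: real) ^ (k div m)) summable_on UNIV"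
proof -
  define \<rho> where "\<rho> = root m (1/2 :: real)"
  have \<rho>: "0 < \<rho>" "\<rho> < 1" "\<rho> ^ m = 1/2" using assms by (simp_all add: \<rho>_def)
  have le: "(1/2 :: real) ^ (k div m) \<le> 2 * \<rho> ^ k" for k
  proof -
    have "m * (k div m) + k mod m = k" by simp
    with mod_less_divisor[OF assms, of k] have "k \<le> m * (k div m) + m" by linarith
    then have "k \<le> m * (k div m + 1)" by simp
    then have "\<rho> ^ (m * (k div m + 1)) \<le> \<rho> ^ k" using \<rho> by (intro power_decreasing) auto
    moreover have "\<rho> ^ (m * (k div m + 1)) = 1/2 * (1/2) ^ (k div m)"
      by (simp only: power_mult \<rho> power_add power_one_right mult.commute)
    ultimately show ?thesis by linarith
  qed
  have "summable (\<lambda>k. 2 * \<rho> ^ k)" using \<rho> by (intro summable_mult summable_geometric) simp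
  then have "summable (\<lambda>k. (1/2 :: real) ^ (k div m))"
    by (rule summable_comparison_test'[of _ 0]) (use le in auto)
  then show ?thesis by (intro summable_nonneg_imp_summable_on) auto
qed

text \<open>
  If some power of each backward shift has norm at most \<open>1/2\<close> on an invariant set, then iteration
  makes the Taylor coefficients of its elements decay geometrically in every direction. They are thus
  absolutely summable, with a sum that is at most a constant times the norm.
\<close>
lemma bounded_functions_of_decay:
  fixes E :: "'n::finite hardy set"
  assumes inv: "\<And>i k x. x \<in> E \<Longrightarrow> adj (coord i k) x \<in> E"
    and decay: "\<And>i. \<forall>\<^sub>F m in sequentially. \<forall>x\<in>E. norm (adj (coord i m) x) \<le> 1/2 * norm x"
  obtains C where "0 \<le> C" "\<And>x z. x \<in> E \<Longrightarrow> z \<in> polydisc \<Longrightarrow> cmod (fn x z) \<le> C * norm x"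
proof -
  have "\<exists>m>0. \<forall>x\<in>E. norm (adj (coord i m) x) \<le> 1/2 * norm x" for i
    using eventually_happens'[OF sequentially_bot eventually_conj[OF decay[of i] eventually_gt_at_top[of 0]]] by blast
  then obtain m where m: "\<And>i. 0 < m i" "\<And>i x. x \<in> E \<Longrightarrow> norm (adj (coord i (m i)) x) \<le> 1/2 * norm x"
    by metis
  have mult: "norm (adj (coord i (q * m i)) x) \<le> (1/2) ^ q * norm x" if "x \<in> E" for i q x
  proof (induction q)
    case 0
    show ?case using norm_adj_le[OF inner_coord, of i 0 x] by simp
  next
    case (Suc q)
    have "norm (adj (coord i (Suc q * m i)) x) = norm (adj (coord i (m i)) (adj (coord i (q * m i)) x))"
      by (simp add: adj_coord_add)
    also have "\<dots> \<le> 1/2 * norm (adj (coord i (q * m i)) x)" by (intro m(2) inv that)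
    also have "\<dots> \<le> 1/2 * ((1/2) ^ q * norm x)" using Suc by simp
    finally show ?case by simp
  qed
  define b where "b = (\<lambda>i k. (1/2 :: real) ^ (k div m i))"
  have step: "norm (adj (coord i k) x) \<le> b i k * norm x" if "x \<in> E" for i k x
  proof -
    have "adj (coord i k) x = adj (coord i (k mod m i)) (adj (coord i (k div m i * m i)) x)"
      using adj_coord_add[of i "k mod m i" "k div m i * m i" x] by simp
    then have "norm (adj (coord i k) x) \<le> norm (adj (coord i (k div m i * m i)) x)"
      using norm_adj_le[OF inner_coord] by metis
    also have "\<dots> \<le> b i k * norm x" unfolding b_def by (rule mult[OF that])
    finally show ?thesis .
  qed
  have b0: "0 \<le> b i k" for i k by (simp add: b_def)
  have "\<forall>x\<in>E. \<forall>\<alpha>. (\<forall>i. i \<notin> A \<longrightarrow> \<alpha> i = 0) \<longrightarrow> cmod (coef x \<alpha>) \<le> (\<Prod>i\<in>A. b i (\<alpha> i)) * norm x"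
    if "finite A" for A :: "'n set"
    using that
  proof induction
    case empty
    show ?case by (simp add: norm_coef_le)
  next
    case (insert i A)
    show ?case
    proof (intro ballI allI impI)
      fix x and \<alpha> :: "'n \<Rightarrow> nat" assume x: "x \<in> E" and \<alpha>: "\<forall>j. j \<notin> insert i A \<longrightarrow> \<alpha> j = 0"
      \<comment> \<open>shift away the exponent of the coordinate i, then use the hypothesis for the shifted element\<close>
      have "cmod (coef x \<alpha>) = cmod (coef (adj (coord i (\<alpha> i)) x) (\<alpha>(i := 0)))"
        by (simp add: coef_adj_coord)
      also have "\<dots> \<le> (\<Prod>j\<in>A. b j ((\<alpha>(i := 0)) j)) * norm (adj (coord i (\<alpha> i)) x)"
        by (rule insert.IH[rule_format, OF inv[OF x]]) (use \<alpha> in auto)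
      also have "\<dots> \<le> (\<Prod>j\<in>A. b j ((\<alpha>(i := 0)) j)) * (b i (\<alpha> i) * norm x)"
        by (rule mult_left_mono[OF step[OF x] prod_nonneg]) (rule b0)
      also have "(\<Prod>j\<in>A. b j ((\<alpha>(i := 0)) j)) = (\<Prod>j\<in>A. b j (\<alpha> j))"
        using insert.hyps by (intro prod.cong) auto
      finally show "cmod (coef x \<alpha>) \<le> (\<Prod>j\<in>insert i A. b j (\<alpha> j)) * norm x"
        using insert.hyps by (simp add: mult_ac)
    qed
  qed
  from this[of UNIV] have coef_le: "cmod (coef x \<alpha>) \<le> (\<Prod>i\<in>UNIV. b i (\<alpha> i)) * norm x" if "x \<in> E" for x \<alpha>
    using that by simp
  define C where "C = (\<Sum>\<^sub>\<infinity>\<alpha>. \<Prod>i\<in>(UNIV :: 'n set). b i (\<alpha> i))"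
  have "(\<lambda>\<alpha>. norm (\<Prod>i\<in>(UNIV :: 'n set). b i (\<alpha> i))) summable_on UNIV"
    by (rule abs_summable_prod) (use summable_half_power_div[OF m(1)] in \<open>simp add: b_def\<close>)
  then have C: "((\<lambda>\<alpha>. \<Prod>i\<in>(UNIV :: 'n set). b i (\<alpha> i)) has_sum C) UNIV"
    unfolding C_def by (rule has_sum_infsum[OF abs_summable_summable])
  show ?thesis
  proof (rule that)
    show "0 \<le> C" using C by (rule has_sum_nonneg) (simp add: b0 prod_nonneg)
    fix x z assume x: "x \<in> E" and z: "z \<in> (polydisc :: (complex ^ 'n) set)"
    show "cmod (fn x z) \<le> C * norm x"
    proof (rule norm_infsum_le[OF fn_has_sum[OF z] has_sum_cmult_left[OF C]])
      fix \<alpha>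
      have "cmod (coef x \<alpha> * monomial_at \<alpha> z) \<le> cmod (coef x \<alpha>)"
        by (simp add: norm_mult mult_left_le norm_monomial_at_le_1[OF z])
      also have "\<dots> \<le> (\<Prod>i\<in>UNIV. b i (\<alpha> i)) * norm x" by (rule coef_le[OF x])
      finally show "norm (coef x \<alpha> * monomial_at \<alpha> z) \<le> (\<Prod>i\<in>UNIV. b i (\<alpha> i)) * norm x" .
    qed
  qed
qed

lemma fn_Hinf_finite_support:
  fixes x :: "'n::finite hardy"
  assumes "finite {\<alpha>. coef x \<alpha> \<noteq> 0}" shows "fn x \<in> Hinf"
proof -
  have "cmod (fn x z) \<le> (\<Sum>\<alpha>\<in>{\<alpha>. coef x \<alpha> \<noteq> 0}. cmod (coef x \<alpha>))" if z: "z \<in> polydisc" for z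
  proof -
    have "fn x z = (\<Sum>\<alpha>\<in>{\<alpha>. coef x \<alpha> \<noteq> 0}. coef x \<alpha> * monomial_at \<alpha> z)"
      using assms by (intro fn_eqI[OF _ z] has_sum_finite_neutralI) auto
    also have "cmod \<dots> \<le> (\<Sum>\<alpha>\<in>{\<alpha>. coef x \<alpha> \<noteq> 0}. cmod (coef x \<alpha>))"
    proof (intro sum_norm_le)
      fix \<alpha>
      show "cmod (coef x \<alpha> * monomial_at \<alpha> z) \<le> cmod (coef x \<alpha>)"
        by (simp add: norm_mult mult_left_le norm_monomial_at_le_1[OF z])
    qed
    finally show ?thesis .
  qed
  then show ?thesis using fn_analytic[of x] by (auto simp: Hinf_def)
qed

text \<open>
  Multiplication by an analytic function never lowers an exponent. Dually, the adjoint of multiplication maps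
  monomials to polynomials, whence the next lemma.
\<close>
lemma coef_mult_hmonomial_eq_0:
  assumes f: "f \<in> Hinf" and "\<gamma> j < \<beta> j" shows "coef (mult f (hmonomial \<beta>)) \<gamma> = 0"
proof -
  have "hmonomial \<beta> = mult (coord j (\<beta> j)) (hmonomial (\<beta>(j := 0)))"
    by (simp add: mult_coord_hmonomial)
  then have "mult f (hmonomial \<beta>) = mult (coord j (\<beta> j)) (mult f (hmonomial (\<beta>(j := 0))))"
    using mult_commute[OF f coord_Hinf] by metis
  then show ?thesis using assms(2) by (simp add: coef_mult_coord)
qed

lemma fn_adj_hmonomial_Hinf:
  fixes \<gamma> :: "'n::finite \<Rightarrow> nat"
  assumes f: "inner_function f" shows "fn (adj f (hmonomial \<gamma>)) \<in> Hinf"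
proof (rule fn_Hinf_finite_support, rule finite_subset)
  have "coef (adj f (hmonomial \<gamma>)) \<beta> = cnj (coef (mult f (hmonomial \<beta>)) \<gamma>)" for \<beta>
    using cinner_commute[of "mult f (hmonomial \<beta>)" "hmonomial \<gamma>"] by (simp add: coef_adj[OF f])
  then show "{\<beta>. coef (adj f (hmonomial \<gamma>)) \<beta> \<noteq> 0} \<subseteq> PiE UNIV (\<lambda>j. {..\<gamma> j})"
    using coef_mult_hmonomial_eq_0[OF inner_Hinf[OF f], of \<gamma>] by (auto simp: PiE_UNIV_domain not_less[symmetric])
  show "finite (PiE UNIV (\<lambda>j :: 'n. {..\<gamma> j}))" by (intro finite_PiE) auto
qed

text \<open>
  The one-variable identity theorem on the complex line through \<open>a\<close> and \<open>w\<close>, whose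
  intersection with the polydisc is convex.
\<close>
lemma analytic_identity:
  fixes u :: "complex ^ 'n::finite \<Rightarrow> complex"
  assumes u: "analytic_polydisc u" and U: "open U" "a \<in> U" "U \<subseteq> polydisc" "\<And>z. z \<in> U \<Longrightarrow> u z = 0"
    and w: "w \<in> polydisc"
  shows "u w = 0"
proof -
  define l where "l = (\<lambda>t :: complex. a + t *s (w - a))"
  have bl: "bounded_linear (\<lambda>t :: complex. t *s (w - a))"
  proof (rule bounded_linear_intro[where K = "\<Sum>i\<in>UNIV. norm ((w - a) $ i)"])
    fix x y :: complex and r :: real
    show "(x + y) *s (w - a) = x *s (w - a) + y *s (w - a)" by (simp add: vec_eq_iff algebra_simps)
    show "(r *\<^sub>R x) *s (w - a) = r *\<^sub>R (x *s (w - a))" by (simp add: vec_eq_iff vector_scaleR_component scaleR_right_diff_distrib)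
    have "norm (x *s (w - a)) \<le> (\<Sum>i\<in>UNIV. norm ((x *s (w - a)) $ i))"
      by (simp add: norm_vec_def L2_set_le_sum)
    also have "\<dots> = norm x * (\<Sum>i\<in>UNIV. norm ((w - a) $ i))"
      by (simp only: vector_smult_component norm_mult sum_distrib_left)
    finally show "norm (x *s (w - a)) \<le> norm x * (\<Sum>i\<in>UNIV. norm ((w - a) $ i))" .
  qed
  have dl: "(l has_derivative (\<lambda>t. t *s (w - a))) (at t)" for t
    using has_derivative_add[OF has_derivative_const[of a] bounded_linear_imp_has_derivative[OF bl, of "at t"]]
    by (simp add: l_def[abs_def])
  have cl: "continuous_on UNIV l"
    using dl by (meson continuous_at_imp_continuous_on has_derivative_continuous)
  define V where "V = l -` polydisc"
  have oV: "open V" unfolding V_def by (rule open_vimage[OF open_polydisc cl])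
  have cvx: "convex V"
  proof (rule convexI)
    fix s t :: complex and p q :: real
    assume st: "s \<in> V" "t \<in> V" and pq: "0 \<le> p" "0 \<le> q" "p + q = 1"
    show "p *\<^sub>R s + q *\<^sub>R t \<in> V"
      unfolding V_def polydisc_def
    proof (simp, rule allI)
      fix i
      have "l (p *\<^sub>R s + q *\<^sub>R t) $ i = p *\<^sub>R (l s $ i) + q *\<^sub>R (l t $ i)"
      proof -
        have "a $ i = complex_of_real p * a $ i + complex_of_real q * a $ i"
          using pq(3) by (metis distrib_right mult_1 of_real_1 of_real_add)
        then show ?thesis by (simp add: l_def scaleR_conv_of_real algebra_simps)
      qed
      moreover have "p *\<^sub>R (l s $ i) + q *\<^sub>R (l t $ i) \<in> ball 0 1"
        using st pq by (intro convexD[OF convex_ball]) (auto simp: V_def polydisc_def)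
      ultimately show "cmod (l (p *\<^sub>R s + q *\<^sub>R t) $ i) < 1" by simp
    qed
  qed
  have hol: "(u \<circ> l) holomorphic_on V"
    unfolding holomorphic_on_def
  proof
    fix t assume "t \<in> V"
    then have "l t \<in> polydisc" by (simp add: V_def)
    then obtain D where D: "(u has_derivative D) (at (l t))" "\<And>c v. D (c *s v) = c * D v"
      using u unfolding analytic_polydisc_def by blast
    have "((u \<circ> l) has_derivative (D \<circ> (\<lambda>t. t *s (w - a)))) (at t)"
      using dl D(1) by (rule diff_chain_at)
    moreover have "D \<circ> (\<lambda>t. t *s (w - a)) = (*) (D (w - a))"
      by (rule ext) (simp only: o_apply D(2) mult.commute)
    ultimately have "((u \<circ> l) has_field_derivative D (w - a)) (at t)" by (simp add: has_field_derivative_def)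
    then show "(u \<circ> l) field_differentiable at t within V"
      by (meson field_differentiable_at_within field_differentiable_def)
  qed
  have l0: "l 0 = a" "l 1 = w" by (simp_all add: l_def vec_eq_iff)
  have oL: "open (l -` U)" by (rule open_vimage[OF U(1) cl])
  have "(u \<circ> l) 1 = 0"
  proof (rule analytic_continuation[OF hol oV convex_connected[OF cvx]])
    show "l -` U \<subseteq> V" using U(3) by (auto simp: V_def)
    show "0 \<in> V" using U(2,3) l0 by (auto simp: V_def)
    show "0 islimpt l -` U" using oL U(2) l0(1) by (intro interior_limit_point) (auto simp: interior_open)
    show "(u \<circ> l) t = 0" if "t \<in> l -` U" for t using that U(4) by simp
    show "1 \<in> V" using w l0 by (simp add: V_def)
  qed
  then show ?thesis by (simp add: l0)
qed

section \<open>Commuting model projections with small joint range\<close>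

text \<open>
  The two kernels in the assumption \<open>decay\<close> are the model spaces of \<open>f\<close> and
  \<open>g\<close>. If their intersection is finite-dimensional, the assumption is an instance of
  \<open>uniform_decay_of_finite_dim\<close>; in this form it says that the intersection is negligible compared
  with high powers of the coordinates.
\<close>
locale commuting_models =
  fixes f g :: "complex ^ 'n::finite \<Rightarrow> complex"
  assumes f: "inner_function f" and g: "inner_function g"
    and commute: "\<And>x. model_proj f (model_proj g x) = model_proj g (model_proj f x)"
    and decay: "\<And>i \<epsilon>. 0 < \<epsilon> \<Longrightarrow> \<forall>\<^sub>F m in sequentially. \<forall>x. adj f x = 0 \<longrightarrow> adj g x = 0 \<longrightarrow>
        norm (adj (coord i m) x) \<le> \<epsilon> * norm x"
begin

lemmas fH = inner_Hinf[OF f] and gH = inner_Hinf[OF g]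

definition joint_proj :: "'n hardy \<Rightarrow> 'n hardy" where
  "joint_proj x = model_proj f (model_proj g x)"

lemma adj_joint_proj: "adj f (joint_proj x) = 0" "adj g (joint_proj x) = 0"
proof -
  show "adj f (joint_proj x) = 0" unfolding joint_proj_def by (rule adj_model_proj[OF f])
  show "adj g (joint_proj x) = 0" unfolding joint_proj_def commute by (rule adj_model_proj[OF g])
qed

lemma joint_proj_fixed: "adj f x = 0 \<Longrightarrow> adj g x = 0 \<Longrightarrow> joint_proj x = x"
  by (simp add: joint_proj_def model_proj_def mult_zero fH gH)

lemma cinner_joint_proj: "cinner (joint_proj x) y = cinner x (joint_proj y)"
  unfolding joint_proj_def cinner_model_proj[OF f] cinner_model_proj[OF g] commute ..

text \<open>
  The compression \<open>joint_proj \<circ> mult (coord i m)\<close> is the adjoint of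
  \<open>adj (coord i m)\<close> restricted to the intersection of the model spaces, where the latter is small
  in norm.
\<close>
lemma joint_proj_shift_decay:
  assumes "0 < \<epsilon>"
  shows "\<forall>\<^sub>F m in sequentially. \<forall>x. norm (joint_proj (mult (coord i m) x)) \<le> \<epsilon> * norm x"
  using decay[OF assms, of i]
proof eventually_elim
  case (elim m)
  show ?case
  proof
    fix x
    define e where "e = joint_proj (mult (coord i m) x)"
    have e: "adj f e = 0" "adj g e = 0" by (simp_all add: e_def adj_joint_proj)
    have "(norm e)\<^sup>2 = cmod (cinner e e)" by (simp add: cinner_self norm_power)
    also have "cinner e e = cinner (mult (coord i m) x) e"
      by (subst (1) e_def) (simp add: cinner_joint_proj joint_proj_fixed e)
    also have "\<dots> = cinner x (adj (coord i m) e)" by (simp add: cinner_adj_right inner_coord)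
    also have "cmod \<dots> \<le> norm x * norm (adj (coord i m) e)" by (rule cinner_Cauchy_Schwarz)
    also have "\<dots> \<le> norm x * (\<epsilon> * norm e)" using elim e by (intro mult_left_mono) auto
    finally have "norm e * norm e \<le> (\<epsilon> * norm x) * norm e" by (simp add: power2_eq_square mult_ac)
    then show "norm (joint_proj (mult (coord i m) x)) \<le> \<epsilon> * norm x"
      unfolding e_def[symmetric] using assms by (cases "norm e = 0") auto
  qed
qed

lemma joint_proj_shift_tendsto_0: "(\<lambda>m. joint_proj (mult (coord i m) x)) \<longlonglongrightarrow> 0"
proof (rule tendsto_norm_zero_cancel, rule tendstoI)
  fix \<epsilon> :: real assume \<epsilon>: "0 < \<epsilon>"
  define \<delta> where "\<delta> = \<epsilon> / (norm x + 1)"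
  have x1: "0 < norm x + 1" using norm_ge_zero[of x] by linarith
  then have \<delta>: "0 < \<delta>" using \<epsilon> by (simp add: \<delta>_def)
  have "\<delta> * norm x < \<delta> * (norm x + 1)" using \<delta> by (intro mult_strict_left_mono) auto
  also have "\<delta> * (norm x + 1) = \<epsilon>" using x1 by (simp add: \<delta>_def)
  finally have less: "\<delta> * norm x < \<epsilon>" .
  show "\<forall>\<^sub>F m in sequentially. dist (norm (joint_proj (mult (coord i m) x))) 0 < \<epsilon>"
    using joint_proj_shift_decay[OF \<delta>, of i]
    by eventually_elim (use less in \<open>auto intro: le_less_trans\<close>)
qed

lemma range_proj_commute: "mult f (adj f (mult g (adj g x))) = mult g (adj g (mult f (adj f x)))"
  using commute[of x]
  by (simp add: model_proj_def adj_diff[OF f] adj_diff[OF g] mult_diff[OF fH] mult_diff[OF gH] algebra_simps)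

lemma joint_functions_bounded:
  obtains C where "0 \<le> C" "\<And>x z. adj f x = 0 \<Longrightarrow> adj g x = 0 \<Longrightarrow> z \<in> polydisc \<Longrightarrow> cmod (fn x z) \<le> C * norm x"
proof -
  define E where "E = {x. adj f x = 0 \<and> adj g x = 0}"
  have 1: "adj (coord i k) x \<in> E" if "x \<in> E" for i k x
    using that by (simp add: E_def adj_commute[OF f inner_coord] adj_commute[OF g inner_coord] adj_zero[OF inner_coord])
  have 2: "\<forall>\<^sub>F m in sequentially. \<forall>x\<in>E. norm (adj (coord i m) x) \<le> 1/2 * norm x" for i
    using decay[of "1/2" i] by (auto simp: E_def elim!: eventually_mono)
  obtain C where "0 \<le> C" "\<And>x z. x \<in> E \<Longrightarrow> z \<in> polydisc \<Longrightarrow> cmod (fn x z) \<le> C * norm x"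
    using bounded_functions_of_decay[OF 1 2] by metis
  then show ?thesis using that by (auto simp: E_def)
qed

lemma joint_function_Hinf:
  assumes "adj f x = 0" "adj g x = 0" shows "fn x \<in> Hinf"
proof -
  obtain C where "\<And>z. z \<in> polydisc \<Longrightarrow> cmod (fn x z) \<le> C * norm x"
    using joint_functions_bounded assms by metis
  then show ?thesis using fn_analytic[of x] by (auto simp: Hinf_def)
qed

text \<open>
  The function \<open>W = f c\<close> is bounded while \<open>c\<close> is only known to be square integrable.
  Multiplying \<open>W\<close> by a polynomial \<open>q\<close> gives \<open>f (c q)\<close>, in the range of
  multiplication by \<open>f\<close>; this range is closed and \<open>W\<close> is a bounded multiplier, so
  the polynomial may be replaced by any \<open>h\<close>.
\<close>
lemma bounded_multiple_in_range:
  assumes W: "fn (mult f c) \<in> Hinf"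
  shows "model_proj f (mult (fn (mult f c)) h) = 0"
proof (induction h rule: hardy_closed_induct)
  have "bounded_linear (\<lambda>h. model_proj f (mult (fn (mult f c)) h))"
  proof -
    have "bounded_linear (model_proj f)"
      unfolding model_proj_def
      by (intro bounded_linear_sub bounded_linear_ident bounded_linear_compose[OF bounded_linear_mult[OF fH] bounded_linear_adj[OF f]])
    then show ?thesis using bounded_linear_mult[OF W] by (rule bounded_linear_compose)
  qed
  then show "closed {h. model_proj f (mult (fn (mult f c)) h) = 0}"
    by (intro closed_Collect_eq linear_continuous_on continuous_on_const)
  show "model_proj f (mult (fn (mult f c)) (hmonomial \<alpha>)) = 0" for \<alpha>
  proof -
    have m: "fn (hmonomial \<alpha>) \<in> Hinf" by (rule fn_Hinf_finite_support) simp
    have "mult (fn (mult f c)) (hmonomial \<alpha>) = mult f (mult (fn (hmonomial \<alpha>)) c)"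
      by (rule hardy_eqI_fn) (simp add: fn_mult[OF W] fn_mult[OF fH] fn_mult[OF m])
    then show ?thesis by (simp add: model_proj_mult[OF f])
  qed
qed (simp_all add: mult_zero[OF W] mult_add[OF W] mult_scaleC[OF W] model_proj_zero[OF f] model_proj_add[OF f] model_proj_scaleC[OF f])

text \<open>
  The four-term decomposition of \<open>z\<^sub>i\<^sup>m\<close> along the commuting projections reads
  \<open>z\<^sub>i\<^sup>m = f a + g b - f c + e\<close> with \<open>e = joint_proj z\<^sub>i\<^sup>m\<close>.
  Here \<open>a\<close> and \<open>b\<close> are polynomials and \<open>e\<close> is bounded, so
  \<open>f c\<close> is bounded as well and the identity may be multiplied by \<open>h\<close>. As
  \<open>g h = f k\<close>, everything but \<open>e h\<close> lies in the range of multiplication by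
  \<open>f\<close>, and \<open>e\<close> tends to \<open>0\<close> as \<open>m\<close> grows.
\<close>
lemma shift_limit_of_quotient:
  assumes gh: "mult g h = mult f k"
  shows "(\<lambda>m. model_proj f (mult (coord i m) h)) \<longlonglongrightarrow> 0"
proof -
  obtain C where C: "0 \<le> C" "\<And>x z. adj f x = 0 \<Longrightarrow> adj g x = 0 \<Longrightarrow> z \<in> polydisc \<Longrightarrow> cmod (fn x z) \<le> C * norm x"
    using joint_functions_bounded by metis
  have key: "norm (model_proj f (mult (coord i m) h)) \<le> C * norm h * norm (joint_proj (mult (coord i m) one))" for m
  proof -
    define Z where "Z = mult (coord i m) one"
    define e where "e = joint_proj Z"
    define a where "a = adj f Z"
    define b where "b = adj g Z"
    define c where "c = adj f (mult g b)"
    have Zmon: "Z = hmonomial ((\<lambda>_. 0)(i := m))" by (simp add: Z_def mult_coord_hmonomial)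
    have ZH: "fn Z \<in> Hinf" unfolding Zmon by (rule fn_Hinf_finite_support) simp
    have aH: "fn a \<in> Hinf" and bH: "fn b \<in> Hinf"
      unfolding a_def b_def Zmon by (rule fn_adj_hmonomial_Hinf[OF f], rule fn_adj_hmonomial_Hinf[OF g])
    have e0: "adj f e = 0" "adj g e = 0" by (simp_all add: e_def adj_joint_proj)
    have eH: "fn e \<in> Hinf" using e0 by (rule joint_function_Hinf)
    have e_eq: "e = Z - mult g b - mult f a + mult f c"
      by (simp add: e_def joint_proj_def model_proj_def a_def b_def c_def adj_diff[OF f] mult_diff[OF fH])
    have WH: "fn (mult f c) \<in> Hinf"
    proof -
      obtain K where K: "\<And>z. z \<in> polydisc \<Longrightarrow> cmod (f z) \<le> K" using fH by (auto simp: Hinf_def)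
      obtain L where L: "\<And>z. z \<in> polydisc \<Longrightarrow> cmod (g z) \<le> L" using gH by (auto simp: Hinf_def)
      obtain Ka where Ka: "\<And>z. z \<in> polydisc \<Longrightarrow> cmod (fn a z) \<le> Ka" using aH by (auto simp: Hinf_def)
      obtain Kb where Kb: "\<And>z. z \<in> polydisc \<Longrightarrow> cmod (fn b z) \<le> Kb" using bH by (auto simp: Hinf_def)
      obtain Ke where Ke: "\<And>z. z \<in> polydisc \<Longrightarrow> cmod (fn e z) \<le> Ke" using eH by (auto simp: Hinf_def)
      obtain Kz where Kz: "\<And>z. z \<in> polydisc \<Longrightarrow> cmod (fn Z z) \<le> Kz" using ZH by (auto simp: Hinf_def)
      have "cmod (fn (mult f c) z) \<le> Ke + Kz + L * Kb + K * Ka" if z: "z \<in> polydisc" for z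
      proof -
        have "mult f c = e - Z + mult g b + mult f a" by (simp add: e_eq)
        then have "fn (mult f c) z = fn e z - fn Z z + g z * fn b z + f z * fn a z"
          by (simp add: fn_mult[OF fH] fn_mult[OF gH])
        also have "cmod \<dots> \<le> cmod (fn e z) + cmod (fn Z z) + cmod (g z * fn b z) + cmod (f z * fn a z)"
          by (intro norm_triangle_mono norm_triangle_ineq4 order_refl)
        also have "\<dots> \<le> Ke + Kz + L * Kb + K * Ka"
          unfolding norm_mult using K[OF z] L[OF z] Ka[OF z] Kb[OF z] Ke[OF z] Kz[OF z]
          by (intro add_mono mult_mono) (auto intro: order_trans[OF norm_ge_zero])
        finally show ?thesis .
      qed
      then show ?thesis using fn_analytic[of "mult f c"] by (auto simp: Hinf_def)
    qed
    have "mult (coord i m) h = mult f (mult (fn a) h) + mult f (mult (fn b) k) - mult (fn (mult f c)) h + mult (fn e) h"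
    proof (rule hardy_eqI_fn)
      fix z :: "complex ^ 'n" assume z: "z \<in> polydisc"
      have "fn (mult g h) z = fn (mult f k) z" by (simp only: gh)
      then have gk: "g z * fn h z = f z * fn k z" by (simp add: fn_mult[OF fH] fn_mult[OF gH])
      have "fn Z z = coord i m z" using z by (simp add: Z_def fn_mult[OF coord_Hinf] fn_one)
      moreover have "fn e z = fn Z z - g z * fn b z - f z * fn a z + f z * fn c z"
        by (simp add: e_eq fn_mult[OF fH] fn_mult[OF gH])
      ultimately have cz: "coord i m z = fn e z + g z * fn b z + f z * fn a z - f z * fn c z" by simp
      have "coord i m z * fn h z =
          f z * (fn a z * fn h z) + fn b z * (g z * fn h z) - f z * fn c z * fn h z + fn e z * fn h z"
        unfolding cz by (simp add: algebra_simps)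
      then show "fn (mult (coord i m) h) z =
          fn (mult f (mult (fn a) h) + mult f (mult (fn b) k) - mult (fn (mult f c)) h + mult (fn e) h) z"
        unfolding gk
        by (simp add: fn_mult[OF coord_Hinf] fn_mult[OF fH] fn_mult[OF aH] fn_mult[OF bH] fn_mult[OF WH] fn_mult[OF eH] mult_ac)
    qed
    then have "model_proj f (mult (coord i m) h) = model_proj f (mult (fn e) h)"
      by (simp only: model_proj_add[OF f] model_proj_diff[OF f] model_proj_mult[OF f] bounded_multiple_in_range[OF WH] add_0_left diff_0_right)
    also have "norm \<dots> \<le> norm (mult (fn e) h)" by (rule norm_model_proj_le[OF f])
    also have "\<dots> \<le> (C * norm e) * norm h"
      using C e0 by (intro norm_mult_le[OF eH]) auto
    finally show ?thesis by (simp add: e_def Z_def mult_ac)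
  qed
  have "(\<lambda>m. C * norm h * norm (joint_proj (mult (coord i m) one))) \<longlonglongrightarrow> C * norm h * 0"
    by (intro tendsto_mult tendsto_const tendsto_norm_zero joint_proj_shift_tendsto_0)
  then have lim: "(\<lambda>m. C * norm h * norm (joint_proj (mult (coord i m) one))) \<longlonglongrightarrow> 0" by simp
  show ?thesis
    by (rule Lim_null_comparison[OF _ lim]) (simp add: key always_eventually)
qed

text \<open>
  A divisibility statement: if \<open>f\<close> divides \<open>g h\<close>, then \<open>f\<close> divides
  \<open>h\<close>.
\<close>
lemma coprime:
  assumes "i \<noteq> (j :: 'n)" and "mult g h = mult f k"
  shows "model_proj f h = 0"
  using assms(1) shift_limit_of_quotient[OF assms(2)] shift_limit_of_quotient[OF assms(2)]
  by (rule range_of_shift_limits[OF f])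

text \<open>
  If \<open>h\<close> is in the model space of \<open>f\<close> and
  \<open>x = M\<^sub>f\<^sup>* M\<^sub>g h\<close>, then commutativity of the projections gives that
  \<open>g\<close> divides \<open>f x\<close>, say \<open>f x = g y\<close>. By coprimality \<open>f\<close>
  divides \<open>y\<close>, so \<open>y\<close> is orthogonal to \<open>h\<close>; but
  \<open>\<langle>y, h\<rangle> = \<langle>f x, g h\<rangle> = \<langle>x, x\<rangle>\<close>.
\<close>
lemma doubly_commute:
  assumes ij: "i \<noteq> (j :: 'n)"
  shows "adj f (mult g x) = mult g (adj f x)"
proof -
  have ker: "adj f (mult g h) = 0" if h: "adj f h = 0" for h
  proof -
    define x where "x = adj f (mult g h)"
    have "mult g (adj g (mult f x)) = mult f x"
      unfolding x_def range_proj_commute[symmetric] by (simp add: adj_mult[OF g])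
    then have "model_proj f (adj g (mult f x)) = 0" by (rule coprime[OF ij])
    then have "cinner (adj g (mult f x)) (model_proj f h) = 0"
      by (simp add: cinner_model_proj[OF f, symmetric])
    moreover have "model_proj f h = h" using h by (simp add: model_proj_fixed_iff[OF f])
    ultimately have "cinner x x = 0"
      by (simp add: cinner_adj_left[OF g] cinner_adj_right[OF f, symmetric] x_def)
    then have "x = 0" by (simp add: cinner_self)
    then show ?thesis by (simp add: x_def)
  qed
  have "adj f (mult g (model_proj f x)) = 0" by (rule ker[OF adj_model_proj[OF f]])
  then have "adj f (mult g x) = adj f (mult g (mult f (adj f x)))"
    by (simp add: model_proj_def mult_diff[OF gH] adj_diff[OF f])
  also have "\<dots> = mult g (adj f x)"
    by (simp add: mult_commute[OF gH fH] adj_mult[OF f])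
  finally show ?thesis .
qed

lemma depends_on_mult_one: "\<phi> \<in> Hinf \<Longrightarrow> depends_on (fn (mult \<phi> one)) l \<longleftrightarrow> depends_on \<phi> l"
  by (simp add: depends_on_def fn_mult fn_one cong: conj_cong bex_cong)

text \<open>
  Let \<open>D\<close> be the commutator of the adjoint of multiplication by \<open>f\<close> with
  multiplication by \<open>z\<^sub>l\<close>. If \<open>D = 0\<close>, its adjoint shows that the backward
  shift annihilates \<open>f\<close>, which then does not depend on \<open>z\<^sub>l\<close>. Otherwise the
  range of \<open>D\<close> contains some \<open>u \<noteq> 0\<close>; it consists of functions that do not
  depend on \<open>z\<^sub>l\<close> and is mapped to itself by multiplication by \<open>g\<close>, because
  \<open>g\<close> commutes with both factors. So \<open>u\<close> and \<open>g u\<close> do not depend on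
  \<open>z\<^sub>l\<close>, and then neither does \<open>g\<close>.
\<close>
lemma separated_coordinate:
  assumes ij: "i \<noteq> (j :: 'n)"
  shows "\<not> depends_on f l \<or> \<not> depends_on g l"
proof -
  let ?Z = "mult (coord l (Suc 0))" and ?S = "adj (coord l (Suc 0))"
  define D where "D = (\<lambda>h. adj f (?Z h) - ?Z (adj f h))"
  have SD: "?S (D h) = 0" for h
    by (simp add: D_def adj_diff[OF inner_coord] adj_mult[OF inner_coord] adj_commute[OF inner_coord f])
  have gD: "mult g (D h) = D (mult g h)" for h
    by (simp add: D_def mult_diff[OF gH] doubly_commute[OF ij] mult_commute[OF gH coord_Hinf] flip: doubly_commute[OF ij])
  show ?thesis
  proof (cases "\<forall>h. D h = 0")
    case True
    have "?S (mult f one) = mult f (?S one)"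
    proof (rule cinner_eqI)
      fix y
      have "cinner (?S (mult f one)) y = cinner one (adj f (?Z y))"
        by (simp add: cinner_adj_left[OF inner_coord] cinner_adj_right[OF f])
      also have "adj f (?Z y) = ?Z (adj f y)" using True by (simp add: D_def)
      finally show "cinner (?S (mult f one)) y = cinner (mult f (?S one)) y"
        by (simp add: cinner_adj_left[OF inner_coord] cinner_adj_right[OF f, symmetric])
    qed
    moreover have "?S one = 0" by (rule adj_coord_one)
    ultimately have "?S (mult f one) = 0" by (simp add: mult_zero[OF fH])
    then show ?thesis by (simp add: adj_coord_eq_0_iff depends_on_mult_one[OF fH])
  next
    case False
    then obtain h where h: "D h \<noteq> 0" by blast
    define u where "u = D h"
    have u: "\<not> depends_on (fn u) l" and gu: "\<not> depends_on (fn (mult g u)) l"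
      using SD by (simp_all add: u_def gD adj_coord_eq_0_iff[symmetric])
    have "\<not> depends_on g l"
    proof
      assume "depends_on g l"
      then obtain z w where zw: "z \<in> polydisc" "w \<in> polydisc" "\<And>j. j \<noteq> l \<Longrightarrow> z $ j = w $ j" "g z \<noteq> g w"
        unfolding depends_on_def by blast
      \<comment> \<open>P c replaces the l-th coordinate by c; on the open set where g distinguishes the two values, u must vanish\<close>
      define P where "P = (\<lambda>c (\<zeta> :: complex ^ 'n). (\<chi> j. if j = l then c else \<zeta> $ j))"
      have Pz: "P (z $ l) z = z" "P (w $ l) z = w" using zw(3) by (auto simp: P_def vec_eq_iff)
      have Pp: "P c \<zeta> \<in> polydisc" if "cmod c < 1" "\<zeta> \<in> polydisc" for c \<zeta>
        using that by (simp add: P_def polydisc_def)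
      have c1: "cmod (z $ l) < 1" "cmod (w $ l) < 1" using zw by (simp_all add: polydisc_def)
      have Pcont: "continuous_on UNIV (P c)" for c
        unfolding P_def
      proof (rule continuous_on_vec_lambda)
        show "continuous_on UNIV (\<lambda>\<zeta> :: complex ^ 'n. if j = l then c else \<zeta> $ j)" for j
          by (cases "j = l") (auto intro!: continuous_intros)
      qed
      define G where "G = (\<lambda>\<zeta>. g (P (z $ l) \<zeta>) - g (P (w $ l) \<zeta>))"
      have Gc: "continuous_on polydisc G"
        unfolding G_def
        by (intro continuous_intros continuous_on_compose2[OF analytic_polydisc_continuous_on[OF HinfD[OF gH]]]
            continuous_on_subset[OF Pcont]) (auto intro: Pp c1)
      define U where "U = polydisc \<inter> G -` (- {0})"
      have oU: "open U" unfolding U_def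
        by (rule continuous_open_preimage[OF Gc open_polydisc]) (simp add: open_Compl)
      have zU: "z \<in> U" using zw Pz by (simp add: U_def G_def)
      have uU: "fn u \<zeta> = 0" if \<zeta>: "\<zeta> \<in> U" for \<zeta>
      proof -
        have \<zeta>p: "\<zeta> \<in> polydisc" and G0: "G \<zeta> \<noteq> 0" using \<zeta> by (auto simp: U_def)
        have in1: "P (z $ l) \<zeta> \<in> polydisc" "P (w $ l) \<zeta> \<in> polydisc" using Pp c1 \<zeta>p by auto
        have same: "\<phi> a = \<phi> b" if "\<not> depends_on \<phi> l" "a \<in> polydisc" "b \<in> polydisc" "\<And>j. j \<noteq> l \<Longrightarrow> a $ j = b $ j" for \<phi> a b
          using that unfolding depends_on_def by blast
        have "fn u (P (z $ l) \<zeta>) = fn u \<zeta>" "fn u (P (w $ l) \<zeta>) = fn u \<zeta>"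
          by (rule same[OF u]; use in1 \<zeta>p in \<open>simp add: P_def\<close>)+
        moreover have "fn (mult g u) (P (z $ l) \<zeta>) = fn (mult g u) (P (w $ l) \<zeta>)"
          by (rule same[OF gu]) (use in1 in \<open>simp_all add: P_def\<close>)
        ultimately have "G \<zeta> * fn u \<zeta> = 0" by (simp add: fn_mult[OF gH] G_def algebra_simps)
        then show ?thesis using G0 by simp
      qed
      have UP: "U \<subseteq> polydisc" by (auto simp: U_def)
      have "fn u x = 0" if "x \<in> polydisc" for x
        by (rule analytic_identity[OF fn_analytic oU zU UP _ that]) (rule uU)
      then have "u = 0" by (intro hardy_eqI_fn) simp
      then show False using h by (simp add: u_def)
    qed
    then show ?thesis ..
  qed
qed

text \<open>
  Multiplication by a coordinate that \<open>g\<close> does not involve commutes with the model projection of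
  \<open>g\<close>, so the decay of \<open>joint_proj \<circ> mult (coord l m)\<close> becomes that of
  \<open>model_proj f \<circ> mult (coord l m)\<close> on the model space of \<open>g\<close>. With two such
  coordinates that whole space lies in the range of multiplication by \<open>f\<close>.
\<close>
lemma joint_proj_zero:
  assumes ij: "i \<noteq> (j :: 'n)" and "\<not> depends_on g i" "\<not> depends_on g j"
  shows "joint_proj x = 0"
proof -
  have "(\<lambda>m. model_proj f (mult (coord l m) (model_proj g x))) \<longlonglongrightarrow> 0" if "\<not> depends_on g l" for l
    using joint_proj_shift_tendsto_0[of l x]
    by (simp add: joint_proj_def model_proj_mult_independent[OF g that])
  then show ?thesis unfolding joint_proj_def
    using range_of_shift_limits[OF f ij] assms(2,3) by blast
qed

end

lemma commuting_models_swap: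
  assumes "commuting_models f g" shows "commuting_models g f"
proof -
  interpret commuting_models f g by fact
  show ?thesis
  proof
    show "inner_function g" "inner_function f" by (rule g f)+
    show "model_proj g (model_proj f x) = model_proj f (model_proj g x)" for x by (rule commute[symmetric])
    show "\<forall>\<^sub>F m in sequentially. \<forall>x. adj g x = 0 \<longrightarrow> adj f x = 0 \<longrightarrow>
        norm (adj (coord i m) x) \<le> \<epsilon> * norm x" if "0 < \<epsilon>" for i and \<epsilon> :: real
      using decay[OF that, of i] by (rule eventually_mono) blast
  qed
qed

section \<open>Rational inner functions of one variable\<close>

lemma continuous_zero_at_limit_point:
  fixes u :: "'a::t2_space \<Rightarrow> 'b::t1_space"
  assumes "continuous_on S u" "a \<in> S" "a islimpt S" "\<And>w. w \<in> S \<Longrightarrow> w \<noteq> a \<Longrightarrow> u w = b"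
  shows "u a = b"
proof (rule ccontr)
  assume "u a \<noteq> b"
  then have "\<forall>\<^sub>F w in at a within S. u w \<noteq> b"
    using assms(1,2) by (intro tendsto_imp_eventually_ne[of u "u a"]) (auto simp: continuous_on_def)
  moreover have "\<forall>\<^sub>F w in at a within S. u w = b"
    using assms(4) by (auto simp: eventually_at_filter)
  ultimately have "\<forall>\<^sub>F w in at a within S. False" by eventually_elim simp
  then show False using assms(3) by (simp add: eventually_False trivial_limit_within)
qed

text \<open>
  A zero of \<open>P\<close> in the open disc is a zero of \<open>Q\<close> because \<open>F\<close> is finite
  there, and on the circle because the moduli agree. Cancelling the common factor keeps both relations, by
  continuity at the cancelled point.
\<close>
lemma cancel_zeros_in_cball:
  fixes P Q :: "complex poly"
  assumes "continuous_on (ball 0 1) F" "P \<noteq> 0"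
    and "\<And>w. cmod w < 1 \<Longrightarrow> poly P w * F w = poly Q w"
    and "\<And>w. cmod w = 1 \<Longrightarrow> cmod (poly P w) = cmod (poly Q w)"
  shows "\<exists>P Q. (\<forall>w. cmod w \<le> 1 \<longrightarrow> poly P w \<noteq> 0) \<and> (\<forall>w. cmod w < 1 \<longrightarrow> poly P w * F w = poly Q w) \<and>
    (\<forall>w. cmod w = 1 \<longrightarrow> cmod (poly P w) = cmod (poly Q w))"
  using assms(2-)
proof (induction "degree P" arbitrary: P Q rule: less_induct)
  case less
  show ?case
  proof (cases "\<forall>w. cmod w \<le> 1 \<longrightarrow> poly P w \<noteq> 0")
    case True
    then show ?thesis using less.prems by blast
  next
    case False
    then obtain a where a: "cmod a \<le> 1" "poly P a = 0" by blast
    have "poly Q a = 0"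
      using a less.prems(2)[of a] less.prems(3)[of a] by (cases "cmod a < 1") auto
    then obtain Q1 where Q1: "Q = [:- a, 1:] * Q1" by (auto simp: poly_eq_0_iff_dvd)
    obtain P1 where P1: "P = [:- a, 1:] * P1" using a(2) by (auto simp: poly_eq_0_iff_dvd)
    have P1n: "P1 \<noteq> 0" using less.prems(1) P1 by auto
    have deg: "degree P1 < degree P" unfolding P1 using P1n by (subst degree_mult_eq) auto
    have off: "poly P1 w * F w = poly Q1 w" if "cmod w < 1" "w \<noteq> a" for w
    proof -
      have "(w - a) * (poly P1 w * F w) = (w - a) * poly Q1 w"
        using less.prems(2)[OF that(1)] by (simp add: P1 Q1 algebra_simps)
      then show ?thesis using that(2) by simp
    qed
    have 1: "poly P1 w * F w = poly Q1 w" if w: "cmod w < 1" for w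
    proof (cases "w = a")
      case True
      have "poly P1 a * F a - poly Q1 a = 0"
      proof (rule continuous_zero_at_limit_point[of "ball 0 1" "\<lambda>w. poly P1 w * F w - poly Q1 w"])
        show "continuous_on (ball 0 1) (\<lambda>w. poly P1 w * F w - poly Q1 w)"
          by (intro continuous_intros assms(1))
        show "a islimpt ball 0 1" using w True by (intro interior_limit_point) simp
      qed (use w True off in auto)
      then show ?thesis using True by simp
    qed (use w off in auto)
    have offs: "cmod (poly P1 w) = cmod (poly Q1 w)" if "cmod w = 1" "w \<noteq> a" for w
    proof -
      have "cmod (w - a) * cmod (poly P1 w) = cmod (w - a) * cmod (poly Q1 w)"
        using less.prems(3)[OF that(1)] unfolding norm_mult[symmetric] by (simp add: P1 Q1 algebra_simps)
      then show ?thesis using that(2) by simp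
    qed
    have 2: "cmod (poly P1 w) = cmod (poly Q1 w)" if w: "cmod w = 1" for w
    proof (cases "w = a")
      case True
      have "cmod (poly P1 a) - cmod (poly Q1 a) = 0"
      proof (rule continuous_zero_at_limit_point[of "sphere 0 1" "\<lambda>w. cmod (poly P1 w) - cmod (poly Q1 w)"])
        show "continuous_on (sphere 0 1) (\<lambda>w. cmod (poly P1 w) - cmod (poly Q1 w))"
          by (intro continuous_intros)
        have "a \<in> sphere 0 1" "- a \<in> sphere 0 1" "- a \<noteq> a" using w True by auto
        then have "sphere 0 1 \<noteq> {x}" for x :: complex by (metis singletonD)
        then show "a islimpt sphere 0 1"
          using \<open>a \<in> sphere 0 1\<close> by (intro connected_imp_perfect connected_sphere) auto
      qed (use w True offs in auto)
      then show ?thesis using True by simp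
    qed (use w offs in auto)
    show ?thesis using less.hyps[OF deg P1n 1 2] by blast
  qed
qed

lemma unimodular_on_circle_constant:
  assumes hol: "h holomorphic_on ball 0 1" and cont: "continuous_on (cball 0 1) h"
    and nz: "\<And>w. cmod w \<le> 1 \<Longrightarrow> h w \<noteq> 0" and circle: "\<And>w. cmod w = 1 \<Longrightarrow> cmod (h w) = 1"
  shows "\<exists>c. cmod c = 1 \<and> (\<forall>w. cmod w < 1 \<longrightarrow> h w = c)"
proof -
  have le: "cmod (k w) \<le> 1"
    if "k holomorphic_on ball 0 1" "continuous_on (cball 0 1) k" "\<And>w. cmod w = 1 \<Longrightarrow> cmod (k w) = 1" "cmod w < 1" for k w
    by (rule maximum_modulus_frontier[of k "ball 0 1" 1]) (use that in \<open>auto simp: frontier_ball\<close>)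
  have eq: "cmod (h w) = 1" if w: "cmod w < 1" for w
  proof (rule antisym)
    show "cmod (h w) \<le> 1" by (rule le[OF hol cont circle w])
    have "cmod (inverse (h w)) \<le> 1"
      by (rule le[of "\<lambda>w. inverse (h w)"])
        (use nz circle w in \<open>auto intro!: holomorphic_on_inverse hol continuous_on_inverse cont simp: norm_inverse\<close>)
    then have "inverse (cmod (h w)) \<le> inverse 1" by (simp add: norm_inverse)
    then show "1 \<le> cmod (h w)" using nz[of w] w by (subst (asm) inverse_le_iff_le) auto
  qed
  have "h constant_on ball 0 1"
    by (rule maximum_modulus_principle[OF hol open_ball _ open_ball order_refl, of 0]) (auto simp: eq)
  then obtain c where c: "\<And>w. cmod w < 1 \<Longrightarrow> h w = c" by (auto simp: constant_on_def)
  then have "cmod c = 1" using eq[of 0] by simp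
  then show ?thesis using c by blast
qed

lemma norm_reflected_factor:
  assumes "cmod w = 1" shows "cmod (w - a) = cmod (1 - cnj a * w)"
proof -
  have "w * cnj w = 1" using assms by (metis complex_norm_square of_real_1 one_power2)
  then have "1 - cnj a * w = w * cnj (w - a)" by (simp add: algebra_simps)
  then show ?thesis using assms by (simp add: norm_mult flip: complex_cnj_diff)
qed

text \<open>
  The roots of \<open>Q\<close> are removed one by one; the polynomial \<open>W\<close> collects what replaces
  them. A root \<open>a\<close> outside the closed disc is moved to \<open>W\<close>. For a root inside,
  \<open>z - a\<close> is a Blaschke factor times \<open>1 - cnj a * z\<close>, and the latter goes to
  \<open>W\<close>. There is no root on the circle. Once \<open>Q\<close> is constant, the maximum principle
  applies to the quotient and to its inverse.
\<close>
lemma blaschke_of_quotient: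
  fixes P Q W :: "complex poly"
  assumes P: "\<And>w. cmod w \<le> 1 \<Longrightarrow> poly P w \<noteq> 0" and W: "\<And>w. cmod w \<le> 1 \<Longrightarrow> poly W w \<noteq> 0"
    and circle: "\<And>w. cmod w = 1 \<Longrightarrow> cmod (poly P w) = cmod (poly Q w * poly W w)"
  shows "\<exists>c as. cmod c = 1 \<and> (\<forall>a\<in>set as. cmod a < 1) \<and>
    (\<forall>w. cmod w < 1 \<longrightarrow> poly Q w * poly W w = poly P w * blaschke c as w)"
  using W circle
proof (induction "degree Q" arbitrary: Q W rule: less_induct)
  case less
  show ?case
  proof (cases "degree Q = 0")
    case True
    then obtain q where q: "Q = [:q:]" by (metis degree_0_id)
    have "cmod (poly P 1) = cmod (q * poly W 1)" using less.prems(2)[of 1] by (simp add: q)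
    then have q0: "q \<noteq> 0" using P[of 1] by auto
    define h where "h = (\<lambda>w. q * poly W w / poly P w)"
    have "\<exists>c. cmod c = 1 \<and> (\<forall>w. cmod w < 1 \<longrightarrow> h w = c)"
    proof (rule unimodular_on_circle_constant)
      show "h holomorphic_on ball 0 1" unfolding h_def by (intro holomorphic_intros) (use P in auto)
      show "continuous_on (cball 0 1) h" unfolding h_def by (intro continuous_intros) (use P in auto)
      show "h w \<noteq> 0" if "cmod w \<le> 1" for w using P less.prems(1) q0 that by (simp add: h_def)
      show "cmod (h w) = 1" if "cmod w = 1" for w
        using less.prems(2)[OF that] less.prems(1)[of w] P[of w] q0 that by (simp add: h_def q norm_divide norm_mult)
    qed
    then obtain c where c: "cmod c = 1" "\<And>w. cmod w < 1 \<Longrightarrow> h w = c" by blast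
    have "poly Q w * poly W w = poly P w * blaschke c [] w" if "cmod w < 1" for w
      using c(2)[OF that] P[of w] that by (simp add: h_def q blaschke_def field_simps)
    then show ?thesis using c(1) by (intro exI[of _ c] exI[of _ "[]"]) auto
  next
    case False
    then obtain a where a: "poly Q a = 0" using alg_closed_imp_poly_has_root[of Q] by blast
    then obtain Q1 where Q1: "Q = [:- a, 1:] * Q1" by (auto simp: poly_eq_0_iff_dvd)
    have Qw: "poly Q w = (w - a) * poly Q1 w" for w by (simp add: Q1 algebra_simps)
    have "Q1 \<noteq> 0" using False Q1 by auto
    then have deg: "degree Q1 < degree Q" unfolding Q1 by (subst degree_mult_eq) auto
    have "cmod a \<noteq> 1" using less.prems(2)[of a] P[of a] a by auto
    then consider "cmod a > 1" | "cmod a < 1" by linarith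
    then show ?thesis
    proof cases
      case 1
      have "\<exists>c as. cmod c = 1 \<and> (\<forall>a\<in>set as. cmod a < 1) \<and>
          (\<forall>w. cmod w < 1 \<longrightarrow> poly Q1 w * poly ([:- a, 1:] * W) w = poly P w * blaschke c as w)"
      proof (rule less.hyps[OF deg])
        show "poly ([:- a, 1:] * W) w \<noteq> 0" if "cmod w \<le> 1" for w using less.prems(1)[OF that] that 1 by auto
        show "cmod (poly P w) = cmod (poly Q1 w * poly ([:- a, 1:] * W) w)" if "cmod w = 1" for w
          using less.prems(2)[OF that] by (simp add: Q1 algebra_simps)
      qed
      moreover have "poly Q1 w * poly ([:- a, 1:] * W) w = poly Q w * poly W w" for w
        by (simp add: Q1 algebra_simps)
      ultimately show ?thesis by (simp only:)
    next
      case 2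
      have nz: "1 - cnj a * w \<noteq> 0" if "cmod w \<le> 1" for w
      proof
        assume "1 - cnj a * w = 0"
        then have "cmod a * cmod w = 1" by (metis complex_mod_cnj eq_iff_diff_eq_0 norm_mult norm_one)
        moreover have "cmod a * cmod w < 1" using 2 that by (metis mult_left_le norm_ge_zero order_le_less_trans)
        ultimately show False by simp
      qed
      have Ww: "poly ([:1, - cnj a:] * W) w = (1 - cnj a * w) * poly W w" for w
        by (simp add: algebra_simps)
      have "\<exists>c as. cmod c = 1 \<and> (\<forall>a\<in>set as. cmod a < 1) \<and>
          (\<forall>w. cmod w < 1 \<longrightarrow> poly Q1 w * poly ([:1, - cnj a:] * W) w = poly P w * blaschke c as w)"
      proof (rule less.hyps[OF deg])
        show "poly ([:1, - cnj a:] * W) w \<noteq> 0" if "cmod w \<le> 1" for w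
          using less.prems(1)[OF that] nz[OF that] by (simp only: Ww mult_eq_0_iff simp_thms)
        show "cmod (poly P w) = cmod (poly Q1 w * poly ([:1, - cnj a:] * W) w)" if "cmod w = 1" for w
        proof -
          have "cmod (poly P w) = cmod (w - a) * cmod (poly Q1 w) * cmod (poly W w)"
            using less.prems(2)[OF that] by (simp only: Qw norm_mult)
          then show ?thesis
            unfolding norm_reflected_factor[OF that] Ww norm_mult by (simp only: mult_ac)
        qed
      qed
      then obtain c as where c: "cmod c = 1" "\<forall>a\<in>set as. cmod a < 1"
        "\<And>w. cmod w < 1 \<Longrightarrow> poly Q1 w * poly ([:1, - cnj a:] * W) w = poly P w * blaschke c as w" by blast
      have "poly Q w * poly W w = poly P w * blaschke c (a # as) w" if w: "cmod w < 1" for w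
      proof -
        have n: "1 - cnj a * w \<noteq> 0" using nz w by simp
        have "poly Q w * poly W w = (w - a) / (1 - cnj a * w) * (poly Q1 w * ((1 - cnj a * w) * poly W w))"
          using n by (simp add: Qw)
        also have "poly Q1 w * ((1 - cnj a * w) * poly W w) = poly P w * blaschke c as w"
          using c(3)[OF w] by (simp only: Ww)
        finally show ?thesis by (simp add: blaschke_def mult_ac)
      qed
      then show ?thesis using c(1,2) 2 by (intro exI[of _ c] exI[of _ "a # as"]) auto
    qed
  qed
qed

lemma rational_inner_is_blaschke:
  assumes "continuous_on (ball 0 1) F" "P \<noteq> 0"
    and "\<And>w. cmod w < 1 \<Longrightarrow> poly P w * F w = poly Q w"
    and "\<And>w. cmod w = 1 \<Longrightarrow> cmod (poly P w) = cmod (poly Q w)"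
  shows "\<exists>c as. cmod c = 1 \<and> (\<forall>a\<in>set as. cmod a < 1) \<and> (\<forall>w. cmod w < 1 \<longrightarrow> F w = blaschke c as w)"
proof -
  obtain P Q where PQ: "\<And>w. cmod w \<le> 1 \<Longrightarrow> poly P w \<noteq> 0" "\<And>w. cmod w < 1 \<Longrightarrow> poly P w * F w = poly Q w"
    "\<And>w. cmod w = 1 \<Longrightarrow> cmod (poly P w) = cmod (poly Q w)"
    using cancel_zeros_in_cball[OF assms] by metis
  obtain c as where c: "cmod c = 1" "\<forall>a\<in>set as. cmod a < 1"
    "\<And>w. cmod w < 1 \<Longrightarrow> poly Q w * poly 1 w = poly P w * blaschke c as w"
    using blaschke_of_quotient[of P 1 Q] PQ by auto
  have "F w = blaschke c as w" if w: "cmod w < 1" for w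
  proof -
    have "poly P w * F w = poly P w * blaschke c as w" using PQ(2)[OF w] c(3)[OF w] by simp
    then show ?thesis using PQ(1)[of w] w by simp
  qed
  then show ?thesis using c by blast
qed

text \<open>
  The classical correspondence between linear recurrences and rational generating functions: with
  \<open>P = \<Sum> c\<^sub>k w\<^sup>d\<^sup>-\<^sup>k\<close> the recurrence kills the high coefficients of
  \<open>P F\<close>.
\<close>
lemma rational_of_recurrence:
  fixes a c :: "nat \<Rightarrow> complex"
  assumes sums: "\<And>w. cmod w < 1 \<Longrightarrow> (\<lambda>n. a n * w ^ n) sums F w"
    and rec: "\<And>n. (\<Sum>k<d. c k * a (n + Suc k)) = 0" and k0: "k0 < d" "c k0 \<noteq> 0"
  shows "\<exists>P Q. P \<noteq> 0 \<and> (\<forall>w. cmod w < 1 \<longrightarrow> poly P w * F w = poly Q w)"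
proof -
  define P where "P = (\<Sum>k<d. monom (c k) (d - k))"
  define Q where "Q = (\<Sum>k<d. monom (c k) (d - k) * (\<Sum>n<Suc k. monom (a n) n))"
  have "coeff P (d - k0) = (\<Sum>k<d. if k = k0 then c k else 0)"
    unfolding P_def coeff_sum using k0 by (intro sum.cong) auto
  also have "\<dots> = c k0" using k0 by simp
  finally have "P \<noteq> 0" using k0 by auto
  moreover have "poly P w * F w = poly Q w" if w: "cmod w < 1" for w
  proof -
    define R where "R = (\<lambda>k. \<Sum>n. a (n + Suc k) * w ^ n)"
    have sm: "summable (\<lambda>n. a n * w ^ n)" using sums[OF w] by (rule sums_summable)
    have shift: "(\<lambda>n. a (n + Suc k) * w ^ (n + Suc k)) sums (F w - (\<Sum>n<Suc k. a n * w ^ n))" for k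
      using sums[OF w] by (subst sums_iff_shift)
        simp
    have Rs: "(\<lambda>n. a (n + Suc k) * w ^ n) sums R k" for k
    proof -
      have "summable (\<lambda>n. a (n + Suc k) * w ^ n)"
      proof (cases "w = 0")
        case True
        show ?thesis unfolding True by (rule summable_finite[of "{0}"]) auto
      next
        case False
        have "summable (\<lambda>n. (a (n + Suc k) * w ^ (n + Suc k)) * (1 / w ^ Suc k))"
          using shift[of k] by (intro summable_mult2) (rule sums_summable)
        moreover have "(a (n + Suc k) * w ^ (n + Suc k)) * (1 / w ^ Suc k) = a (n + Suc k) * w ^ n" for n
          using False by (simp add: power_add)
        ultimately show ?thesis by simp
      qed
      then show ?thesis unfolding R_def by (rule summable_sums)
    qed
    have FR: "F w = (\<Sum>n<Suc k. a n * w ^ n) + w ^ Suc k * R k" for k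
    proof -
      have "(\<lambda>n. w ^ Suc k * (a (n + Suc k) * w ^ n)) sums (w ^ Suc k * R k)"
        using Rs by (rule sums_mult)
      then have "(\<lambda>n. a (n + Suc k) * w ^ (n + Suc k)) sums (w ^ Suc k * R k)"
        by (simp add: power_add mult_ac)
      then have "F w - (\<Sum>n<Suc k. a n * w ^ n) = w ^ Suc k * R k" using shift sums_unique2 by blast
      then show ?thesis by (simp add: algebra_simps)
    qed
    have "(\<lambda>n. \<Sum>k<d. c k * (a (n + Suc k) * w ^ n)) sums (\<Sum>k<d. c k * R k)"
      by (intro sums_sum sums_mult Rs)
    moreover have "(\<Sum>k<d. c k * (a (n + Suc k) * w ^ n)) = 0" for n
    proof -
      have "(\<Sum>k<d. c k * (a (n + Suc k) * w ^ n)) = (\<Sum>k<d. c k * a (n + Suc k)) * w ^ n"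
        by (simp add: sum_distrib_right mult.assoc)
      then show ?thesis by (simp only: rec mult_zero_left)
    qed
    ultimately have "(\<lambda>n. 0) sums (\<Sum>k<d. c k * R k)" by simp
    then have R0: "(\<Sum>k<d. c k * R k) = 0" by (rule sums_unique2[OF _ sums_zero])
    have "poly P w * F w = (\<Sum>k<d. c k * w ^ (d - k) * F w)"
      by (simp add: P_def poly_sum poly_monom sum_distrib_right)
    also have "\<dots> = (\<Sum>k<d. c k * w ^ (d - k) * (\<Sum>n<Suc k. a n * w ^ n) + w ^ Suc d * (c k * R k))"
    proof (intro sum.cong refl)
      fix k assume k: "k \<in> {..<d}"
      have "w ^ (d - k) * w ^ Suc k = w ^ Suc d" using k by (simp add: power_add[symmetric] del: power_Suc)
      then show "c k * w ^ (d - k) * F w = c k * w ^ (d - k) * (\<Sum>n<Suc k. a n * w ^ n) + w ^ Suc d * (c k * R k)"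
        unfolding FR[of k] by (simp add: algebra_simps flip: \<open>w ^ (d - k) * w ^ Suc k = w ^ Suc d\<close> del: power_Suc)
    qed
    also have "\<dots> = (\<Sum>k<d. c k * w ^ (d - k) * (\<Sum>n<Suc k. a n * w ^ n)) + w ^ Suc d * (\<Sum>k<d. c k * R k)"
      by (simp only: sum.distrib sum_distrib_left)
    also have "\<dots> = poly Q w"
      unfolding R0 Q_def poly_sum poly_mult poly_monom by simp
    finally show ?thesis .
  qed
  ultimately show ?thesis by blast
qed

section \<open>From finite rank to finite Blaschke products\<close>

lemma linear_relation_in_span:
  fixes w :: "nat \<Rightarrow> 'n::finite hardy"
  assumes B: "finite B" and w: "\<And>k. w k \<in> hardy.span B"
  shows "\<exists>d c k0. k0 < d \<and> c k0 \<noteq> 0 \<and> (\<Sum>k<d. c k *\<^sub>C w k) = 0"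
proof -
  define d where "d = Suc (card B)"
  show ?thesis
  proof (cases "inj_on w {..<d}")
    case True
    have "hardy.dependent (w ` {..<d})"
    proof (rule ccontr)
      assume "\<not> hardy.dependent (w ` {..<d})"
      then have "card (w ` {..<d}) \<le> card B"
        using hardy.independent_span_bound[OF B, of "w ` {..<d}"] w by auto
      then show False using card_image[OF True] by (simp add: d_def)
    qed
    then obtain u v where u: "v \<in> w ` {..<d}" "u v \<noteq> 0" "(\<Sum>v\<in>w ` {..<d}. u v *\<^sub>C v) = 0"
      by (subst (asm) hardy.dependent_finite) auto
    then obtain k0 where "k0 < d" "u (w k0) \<noteq> 0" by auto
    moreover have "(\<Sum>k<d. u (w k) *\<^sub>C w k) = 0"
      using u(3) by (simp add: sum.reindex[OF True])
    ultimately show ?thesis by (intro exI[of _ d] exI[of _ "\<lambda>k. u (w k)"] exI[of _ k0]) auto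
  next
    case False
    then obtain p q where pq: "p < d" "q < d" "p \<noteq> q" "w p = w q" by (auto simp: inj_on_def)
    define c :: "nat \<Rightarrow> complex" where "c = (\<lambda>k. if k = p then 1 else if k = q then -1 else 0)"
    have "(\<Sum>k<d. c k *\<^sub>C w k) = (\<Sum>k\<in>{p, q}. c k *\<^sub>C w k)"
      using pq by (intro sum.mono_neutral_right) (auto simp: c_def)
    also have "\<dots> = 0" using pq by (simp add: c_def)
    finally show ?thesis using pq by (intro exI[of _ d] exI[of _ c] exI[of _ p]) (auto simp: c_def)
  qed
qed

lemma continuous_AE_circ_zero:
  fixes D :: "real \<Rightarrow> real"
  assumes D: "continuous_on UNIV D" and ae: "AE t in circ. D t = 0" and t: "0 \<le> t" "t \<le> 2 * pi"
  shows "D t = 0"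
proof -
  define I where "I = integral {0..2 * pi} (\<lambda>t. (D t)\<^sup>2)"
  have cI: "continuous_on {0..2 * pi} (\<lambda>t. (D t)\<^sup>2)"
    by (intro continuous_on_power continuous_on_subset[OF D]) auto
  then have "((\<lambda>t. (D t)\<^sup>2) has_integral I) {0..2 * pi}"
    unfolding I_def by (intro integrable_integral integrable_continuous_real)
  then have "((\<lambda>t. complex_of_real ((D t)\<^sup>2)) has_integral complex_of_real I) {0..2 * pi}"
    by (rule has_integral_of_real)
  moreover have "continuous_on UNIV (\<lambda>t. complex_of_real ((D t)\<^sup>2))"
    by (intro continuous_intros D)
  ultimately have "(LINT t|circ. complex_of_real ((D t)\<^sup>2)) = complex_of_real I / (2 * pi)"
    by (rule circ_integral[rotated])
  moreover have "(LINT t|circ. complex_of_real ((D t)\<^sup>2)) = 0"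
    by (rule integral_eq_zero_AE) (use ae in eventually_elim, simp)
  ultimately have "I = 0" by simp
  then have "(D t)\<^sup>2 = 0"
    unfolding I_def using integral_eq_0_iff[OF cI] t by auto
  then show ?thesis by simp
qed

text \<open>
  The adjoint of multiplication fixes the constants up to the factor \<open>cnj (g 0)\<close>.
\<close>
lemma adj_one:
  assumes g: "inner_function g"
  shows "adj g one = coef (adj g one) (\<lambda>_. 0) *\<^sub>C one"
proof (rule hardy_eqI)
  fix \<beta> :: "'a \<Rightarrow> nat"
  show "coef (adj g one) \<beta> = coef (coef (adj g one) (\<lambda>_. 0) *\<^sub>C one) \<beta>"
  proof (cases "\<beta> = (\<lambda>_. 0)")
    case False
    then obtain j where "0 < \<beta> j" by auto
    then have "coef (mult g (hmonomial \<beta>)) (\<lambda>_. 0) = 0"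
      by (intro coef_mult_hmonomial_eq_0[OF inner_Hinf[OF g], of _ j]) simp
    moreover have "coef (adj g one) \<beta> = cnj (coef (mult g (hmonomial \<beta>)) (\<lambda>_. 0))"
      using cinner_commute[of "mult g (hmonomial \<beta>)" "one"] by (simp add: coef_adj[OF g])
    ultimately show ?thesis using False by simp
  qed simp
qed

text \<open>
  The strict inequality \<open>\<bar>g 0\<bar> < 1\<close>. If equality held, \<open>1\<close> would be
  orthogonal to the model space of \<open>g\<close>, so \<open>1\<close> would be a multiple of
  \<open>g\<close> by a constant.
\<close>
lemma nonconstant_inner_at_origin:
  assumes g: "inner_function g" and nc: "\<not> constant_on_polydisc g"
  shows "cmod (coef (adj g one) (\<lambda>_. 0)) < 1"
proof -
  define \<gamma> where "\<gamma> = coef (adj g one) (\<lambda>_. 0)"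
  have a1: "adj g one = \<gamma> *\<^sub>C one" unfolding \<gamma>_def by (rule adj_one[OF g])
  have le: "cmod \<gamma> \<le> 1"
    using norm_adj_le[OF g, of one] by (simp add: a1 norm_hmonomial)
  have "cmod \<gamma> \<noteq> 1"
  proof
    assume \<gamma>1: "cmod \<gamma> = 1"
    have "cinner (model_proj g one) one = 1 - cinner (adj g one) (adj g one)"
      by (simp add: model_proj_def cinner_diff_left cinner_adj_right[OF g])
    also have "\<dots> = 0" using \<gamma>1 by (simp add: cinner_self a1 norm_hmonomial)
    finally have 0: "cinner (model_proj g one) one = 0" .
    define y where "y = model_proj g one"
    have "model_proj g y = y" by (simp add: y_def model_proj_fixed_iff[OF g] adj_model_proj[OF g])
    then have "cinner y y = cinner y one"
      using cinner_model_proj[OF g, of y one] by (simp add: y_def)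
    then have "cinner (model_proj g one) (model_proj g one) = 0" using 0 by (simp add: y_def)
    then have "model_proj g one = 0" by (simp add: cinner_self)
    then have eq: "mult g (adj g one) = one" by (simp add: model_proj_def)
    have "\<gamma> * g z = 1" if "z \<in> polydisc" for z
    proof -
      have "fn (mult g (adj g one)) z = 1" using that by (simp add: eq fn_one)
      then show ?thesis using that by (simp add: fn_mult[OF inner_Hinf[OF g]] a1 fn_one mult.commute)
    qed
    then have "g z = 1 / \<gamma>" if "z \<in> polydisc" for z using that \<gamma>1 by (metis mult_zero_left nonzero_eq_divide_eq mult.commute zero_neq_one)
    then show False using nc by (auto simp: constant_on_polydisc_def)
  qed
  then show ?thesis using le by (simp add: \<gamma>_def)
qed

lemma one_variable_series:
  fixes i :: "'n::finite"
  assumes nd: "\<And>l. l \<noteq> i \<Longrightarrow> \<not> depends_on (fn x) l" and w: "cmod w < 1"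
  shows "(\<lambda>n. coef x ((\<lambda>_. 0)(i := n)) * w ^ n) sums fn x (axis i w)"
proof -
  have z: "axis i w \<in> polydisc" using w by (simp add: polydisc_def axis_def)
  have inj: "inj (\<lambda>n. (\<lambda>_. 0)(i := n))" by (auto intro!: injI dest: fun_cong[of _ _ i])
  have "((\<lambda>\<alpha>. coef x \<alpha> * monomial_at \<alpha> (axis i w)) has_sum fn x (axis i w)) UNIV"
    by (rule fn_has_sum[OF z])
  then have "((\<lambda>\<alpha>. coef x \<alpha> * monomial_at \<alpha> (axis i w)) has_sum fn x (axis i w)) (range (\<lambda>n. (\<lambda>_. 0)(i := n)))"
  proof (rule has_sum_cong_neutral[THEN iffD1, rotated -1])
    fix \<alpha> :: "'n \<Rightarrow> nat" assume \<alpha>: "\<alpha> \<in> UNIV - range (\<lambda>n. (\<lambda>_. 0)(i := n))"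
    have "\<exists>j. j \<noteq> i \<and> \<alpha> j \<noteq> 0"
    proof (rule ccontr)
      assume "\<not> (\<exists>j. j \<noteq> i \<and> \<alpha> j \<noteq> 0)"
      then have "\<alpha> = (\<lambda>_. 0)(i := \<alpha> i)" by (auto simp: fun_eq_iff)
      then show False using \<alpha> by blast
    qed
    then obtain j where j: "j \<noteq> i" "\<alpha> j \<noteq> 0" by blast
    then have "(axis i w $ j) ^ \<alpha> j = 0" by (simp add: axis_def)
    then have "monomial_at \<alpha> (axis i w) = 0" unfolding monomial_at_def by (intro prod_zero) auto
    then show "coef x \<alpha> * monomial_at \<alpha> (axis i w) = 0" by simp
  qed auto
  then have "((\<lambda>n. coef x ((\<lambda>_. 0)(i := n)) * monomial_at ((\<lambda>_. 0)(i := n)) (axis i w)) has_sum fn x (axis i w)) UNIV"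
    using has_sum_reindex[OF inj, of "\<lambda>\<alpha>. coef x \<alpha> * monomial_at \<alpha> (axis i w)"] by (simp add: o_def)
  moreover have "monomial_at ((\<lambda>_. 0)(i := n)) (axis i w) = w ^ n" for n
  proof -
    have "monomial_at ((\<lambda>_. 0)(i := n)) (axis i w) = (\<Prod>j\<in>UNIV. if j = i then w ^ n else 1)"
      unfolding monomial_at_def by (intro prod.cong) (auto simp: axis_def)
    then show ?thesis by simp
  qed
  ultimately show ?thesis using has_sum_imp_sums by fastforce
qed

lemma eq_if_independent:
  fixes \<phi> :: "complex ^ 'n::finite \<Rightarrow> complex"
  assumes A: "finite A" "\<And>i. i \<in> A \<Longrightarrow> \<not> depends_on \<phi> i"
    and zw: "z \<in> polydisc" "w \<in> polydisc" "\<And>j. j \<notin> A \<Longrightarrow> z $ j = w $ j"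
  shows "\<phi> z = \<phi> w"
  using A zw
proof (induction arbitrary: z)
  case empty
  then have "z = w" by (simp add: vec_eq_iff)
  then show ?case by simp
next
  case (insert i A)
  define v where "v = (\<chi> j. if j = i then w $ j else z $ j)"
  have v: "v \<in> polydisc" using insert.prems(2,3) by (simp add: v_def polydisc_def)
  have "\<not> depends_on \<phi> i" using insert.prems(1) by blast
  then have "\<phi> z = \<phi> v" using insert.prems(2) v unfolding depends_on_def by (force simp: v_def)
  also have "\<phi> v = \<phi> w"
    by (rule insert.IH[OF _ v insert.prems(3)]) (use insert.prems(1,4) in \<open>auto simp: v_def\<close>)
  finally show ?case .
qed

lemma constant_if_independent:
  assumes "\<And>i. \<not> depends_on \<phi> i" shows "constant_on_polydisc \<phi>"
proof -
  have "\<phi> z = \<phi> 0" if "z \<in> polydisc" for z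
  proof (rule eq_if_independent[OF finite[of UNIV] assms that])
    show "(0 :: complex ^ 'a) \<in> polydisc" by (simp add: polydisc_def)
  qed simp
  then show ?thesis unfolding constant_on_polydisc_def by blast
qed

context commuting_models
begin

lemma doubly_commute_swap:
  assumes ij: "i \<noteq> (j :: 'n)" shows "adj g (mult f x) = mult f (adj g x)"
proof -
  interpret swap: commuting_models g f by (rule commuting_models_swap) unfold_locales
  show ?thesis by (rule swap.doubly_commute[OF ij])
qed

text \<open>
  The backward shifts \<open>v\<^sub>k\<close> of \<open>f\<close> of order at least one belong to the model
  space of \<open>f\<close> and are eigenvectors of the adjoint of multiplication by \<open>g\<close>, with
  eigenvalue \<open>\<gamma> = cnj (g 0)\<close>. Their joint projections
  \<open>v\<^sub>k - \<gamma> g v\<^sub>k\<close> satisfy a linear relation by finite dimension. It passes to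
  the \<open>v\<^sub>k\<close>, because \<open>V = \<gamma> g V\<close> with
  \<open>\<bar>\<gamma>\<bar> < 1\<close> and \<open>g\<close> isometric forces \<open>V = 0\<close>.
\<close>
lemma finite_dim_imp_recurrence:
  assumes ij: "i \<noteq> (j :: 'n)" and nc: "\<not> constant_on_polydisc g"
    and B: "finite B" "\<And>x. joint_proj x \<in> hardy.span B"
  shows "\<exists>d c k0. k0 < d \<and> c k0 \<noteq> 0 \<and> (\<Sum>k<d. c k *\<^sub>C adj (coord l (Suc k)) (mult f one)) = 0"
proof -
  define v where "v = (\<lambda>k. adj (coord l (Suc k)) (mult f one))"
  define \<gamma> where "\<gamma> = coef (adj g one) (\<lambda>_. 0)"
  have fv: "adj f (v k) = 0" for k
    by (simp add: v_def adj_commute[OF f inner_coord] adj_mult[OF f] adj_coord_one)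
  have gv: "adj g (v k) = \<gamma> *\<^sub>C v k" for k
  proof -
    have "adj g (v k) = adj (coord l (Suc k)) (mult f (adj g one))"
      by (simp add: v_def adj_commute[OF g inner_coord] doubly_commute_swap[OF ij])
    also have "adj g one = \<gamma> *\<^sub>C one" unfolding \<gamma>_def by (rule adj_one[OF g])
    finally show ?thesis by (simp add: v_def mult_scaleC[OF fH] adj_scaleC[OF inner_coord])
  qed
  have w: "joint_proj (v k) = v k - \<gamma> *\<^sub>C mult g (v k)" for k
  proof -
    have "model_proj f (v k) = v k" using fv by (simp add: model_proj_fixed_iff[OF f])
    then have "joint_proj (v k) = model_proj g (v k)" by (simp add: joint_proj_def commute)
    then show ?thesis by (simp add: model_proj_def gv mult_scaleC[OF gH])
  qed
  obtain d c k0 where c: "k0 < d" "c k0 \<noteq> 0" "(\<Sum>k<d. c k *\<^sub>C joint_proj (v k)) = 0"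
    using linear_relation_in_span[OF B(1), of "\<lambda>k. joint_proj (v k)"] B(2) by blast
  define V where "V = (\<Sum>k<d. c k *\<^sub>C v k)"
  have ms: "mult g (\<Sum>k\<in>K. c k *\<^sub>C v k) = (\<Sum>k\<in>K. c k *\<^sub>C mult g (v k))" for K
    by (induction K rule: infinite_finite_induct) (simp_all add: mult_zero[OF gH] mult_add[OF gH] mult_scaleC[OF gH])
  have "(\<Sum>k<d. c k *\<^sub>C joint_proj (v k)) = (\<Sum>k<d. c k *\<^sub>C v k) - (\<Sum>k<d. \<gamma> *\<^sub>C (c k *\<^sub>C mult g (v k)))"
    unfolding w sum_subtractf[symmetric]
    by (intro sum.cong refl) (simp add: hardy.scale_right_diff_distrib mult.commute)
  also have "(\<Sum>k<d. \<gamma> *\<^sub>C (c k *\<^sub>C mult g (v k))) = \<gamma> *\<^sub>C mult g V"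
    unfolding V_def ms by (rule hardy.scale_sum_right[symmetric])
  finally have "(\<Sum>k<d. c k *\<^sub>C joint_proj (v k)) = V - \<gamma> *\<^sub>C mult g V" by (simp only: V_def)
  then have "V = \<gamma> *\<^sub>C mult g V" using c(3) by simp
  then have "norm V = cmod \<gamma> * norm V" by (metis norm_scaleC norm_mult_inner[OF g])
  moreover have "cmod \<gamma> < 1" unfolding \<gamma>_def by (rule nonconstant_inner_at_origin[OF g nc])
  ultimately have "V = 0" by (metis mult_cancel_right1 norm_eq_zero order_less_irrefl)
  then show ?thesis using c(1,2) unfolding V_def v_def by blast
qed

text \<open>
  As a function \<open>F\<close> of one variable, \<open>f\<close> has Taylor coefficients that satisfy a
  linear recurrence, so it is rational, \<open>P F = Q\<close>. The radial limits give
  \<open>\<bar>P\<bar> = \<bar>Q\<bar>\<close> almost everywhere on the circle, hence everywhere.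
\<close>
lemma finite_dim_imp_blaschke:
  assumes ij: "i \<noteq> (j :: 'n)" and nc: "\<not> constant_on_polydisc g"
    and B: "finite B" "\<And>x. joint_proj x \<in> hardy.span B"
    and nd: "\<And>l. l \<noteq> i \<Longrightarrow> \<not> depends_on f l"
  shows "finite_blaschke_product f"
proof -
  define F where "F = (\<lambda>w. f (axis i w))"
  have fF: "f z = F (z $ i)" if z: "z \<in> polydisc" for z
    unfolding F_def
  proof (rule eq_if_independent[of "UNIV - {i}"])
    show "axis i (z $ i) \<in> polydisc" using z by (simp add: polydisc_def axis_def)
  qed (use z nd in \<open>auto simp: axis_def\<close>)
  define a where "a = (\<lambda>n. coef (mult f one) ((\<lambda>_. 0)(i := n)))"
  have sums: "(\<lambda>n. a n * w ^ n) sums F w" if w: "cmod w < 1" for w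
  proof -
    have "axis i w \<in> polydisc" using w by (simp add: polydisc_def axis_def)
    then have "fn (mult f one) (axis i w) = F w" by (simp add: fn_mult[OF fH] fn_one F_def)
    then show ?thesis
      using one_variable_series[of i "mult f one" w] nd w by (simp add: depends_on_mult_one[OF fH] a_def)
  qed
  obtain d c k0 where c: "k0 < d" "c k0 \<noteq> 0" "(\<Sum>k<d. c k *\<^sub>C adj (coord i (Suc k)) (mult f one)) = 0"
    using finite_dim_imp_recurrence[OF ij nc B] by blast
  have "(\<Sum>k<d. c k * a (n + Suc k)) = 0" for n
  proof -
    have "coef (\<Sum>k<d. c k *\<^sub>C adj (coord i (Suc k)) (mult f one)) ((\<lambda>_. 0)(i := n)) = 0" using c(3) by simp
    then show ?thesis by (simp add: coef_adj_coord a_def)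
  qed
  then have "\<exists>P Q. P \<noteq> 0 \<and> (\<forall>w. cmod w < 1 \<longrightarrow> poly P w * F w = poly Q w)"
    using sums c(1,2) by (intro rational_of_recurrence[of a F c d k0])
  then obtain P Q where PQ: "P \<noteq> 0" "\<And>w. cmod w < 1 \<Longrightarrow> poly P w * F w = poly Q w"
    by blast
  have "F holomorphic_on ball 0 1"
  proof -
    have "(\<lambda>u. f (\<chi> j. if j = i then u else 0 $ j)) holomorphic_on ball 0 1"
      by (rule holomorphic_in_coordinate[OF HinfD[OF fH]]) simp
    moreover have "axis i u = (\<chi> j. if j = i then u else (0 :: complex ^ 'n) $ j)" for u
      by (simp add: axis_def vec_eq_iff)
    ultimately show ?thesis by (simp add: F_def)
  qed
  then have Fc: "continuous_on (ball 0 1) F" by (rule holomorphic_on_imp_continuous_on)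
  define D where "D = (\<lambda>t. cmod (poly P (cis t)) - cmod (poly Q (cis t)))"
  have Dc: "continuous_on UNIV D" unfolding D_def by (intro continuous_intros)
  have "AE \<theta> in angles. \<exists>w. ((\<lambda>r::real. f (r *\<^sub>R torus_point \<theta>)) \<longlongrightarrow> w) (at_left 1) \<and> cmod w = 1"
    using f unfolding inner_function_def torus_measure_eq by (auto dest: AE_distrD[OF measurable_torus_point])
  then have "AE \<theta> in angles. D (\<theta> i) = 0"
  proof (rule AE_mp, intro AE_I2 impI)
    fix \<theta> :: "'n \<Rightarrow> real"
    assume "\<exists>w. ((\<lambda>r::real. f (r *\<^sub>R torus_point \<theta>)) \<longlongrightarrow> w) (at_left 1) \<and> cmod w = 1"
    then obtain w where w: "((\<lambda>r::real. f (r *\<^sub>R torus_point \<theta>)) \<longlongrightarrow> w) (at_left 1)" "cmod w = 1" by blast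
    have lim: "((\<lambda>r. poly R (r *\<^sub>R cis (\<theta> i))) \<longlongrightarrow> poly R (1 *\<^sub>R cis (\<theta> i))) (at_left 1)" for R :: "complex poly"
      by (intro tendsto_intros)
    have "((\<lambda>r. poly P (r *\<^sub>R cis (\<theta> i)) * f (r *\<^sub>R torus_point \<theta>)) \<longlongrightarrow> poly P (1 *\<^sub>R cis (\<theta> i)) * w) (at_left 1)"
      by (rule tendsto_mult[OF lim w(1)])
    moreover have "\<forall>\<^sub>F r in at_left (1 :: real). poly P (r *\<^sub>R cis (\<theta> i)) * f (r *\<^sub>R torus_point \<theta>) = poly Q (r *\<^sub>R cis (\<theta> i))"
      using eventually_at_left_real[of 0 1]
    proof (rule eventually_mono)
      fix r :: real assume "r \<in> {0<..<1}"
      then have r: "0 \<le> r" "r < 1" by auto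
      have "f (r *\<^sub>R torus_point \<theta>) = F (r *\<^sub>R cis (\<theta> i))"
        by (subst fF[OF scaleR_torus_point_in_polydisc[OF r]]) (simp add: vector_scaleR_component)
      then show "poly P (r *\<^sub>R cis (\<theta> i)) * f (r *\<^sub>R torus_point \<theta>) = poly Q (r *\<^sub>R cis (\<theta> i))"
        using PQ(2)[of "r *\<^sub>R cis (\<theta> i)"] r by simp
    qed simp
    ultimately have "((\<lambda>r. poly Q (r *\<^sub>R cis (\<theta> i))) \<longlongrightarrow> poly P (1 *\<^sub>R cis (\<theta> i)) * w) (at_left 1)"
      by (rule Lim_transform_eventually)
    then have "poly P (cis (\<theta> i)) * w = poly Q (cis (\<theta> i))"
      using lim[of Q] tendsto_unique[OF trivial_limit_at_left_real] by fastforce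
    then show "D (\<theta> i) = 0" using w(2) by (simp add: D_def norm_mult flip: \<open>poly P (cis (\<theta> i)) * w = poly Q (cis (\<theta> i))\<close>)
  qed
  then have "AE t in distr angles circ (\<lambda>\<theta>. \<theta> i). D t = 0"
  proof (subst AE_distr_iff)
    show "(\<lambda>\<theta>. \<theta> i) \<in> measurable angles circ" by (rule measurable_component_singleton) simp
    have "{t. D t = 0} \<in> sets borel"
      by (intro borel_closed closed_Collect_eq Dc continuous_on_const)
    then show "{t \<in> space circ. D t = 0} \<in> sets circ" by simp
  qed
  moreover have "distr angles circ (\<lambda>\<theta> :: 'n \<Rightarrow> real. \<theta> i) = circ"
    by (rule distr_PiM_component) (auto simp: prob_space_circ)
  ultimately have ae: "AE t in circ. D t = 0" by metis
  have "cmod (poly P w) = cmod (poly Q w)" if w: "cmod w = 1" for w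
  proof -
    obtain t where t: "0 \<le> t" "t < 2 * pi" "w = Complex (cos t) (sin t)" using complex_unimodular_polar[OF w] by blast
    then have "D t = 0" using continuous_AE_circ_zero[OF Dc ae, of t] by simp
    moreover have "w = cis t" using t by (simp add: cis.code)
    ultimately show ?thesis by (simp add: D_def)
  qed
  then obtain c as where c: "cmod c = 1" "\<forall>a\<in>set as. cmod a < 1" "\<And>w. cmod w < 1 \<Longrightarrow> F w = blaschke c as w"
    using rational_inner_is_blaschke[OF Fc PQ] by blast
  have "f z = blaschke c as (z $ i)" if z: "z \<in> polydisc" for z
    using fF[OF z] c(3)[of "z $ i"] z by (simp add: polydisc_def)
  then show ?thesis using c(1,2) unfolding finite_blaschke_product_def by blast
qed

end

section \<open>Finite Blaschke products in separate variables\<close>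

definition poly_mult :: "'n::finite \<Rightarrow> complex poly \<Rightarrow> 'n hardy \<Rightarrow> 'n hardy" where
  "poly_mult i p x = (\<Sum>k\<le>degree p. coeff p k *\<^sub>C mult (coord i k) x)"

lemma fn_poly_mult: "fn (poly_mult i p x) z = poly p (z $ i) * fn x z"
  by (simp add: poly_mult_def fn_mult[OF coord_Hinf] coord_def poly_altdef sum_distrib_right mult.assoc)

lemma adj_poly_mult_independent:
  assumes f: "inner_function f" and nd: "\<not> depends_on f i"
  shows "adj f (poly_mult i p x) = poly_mult i p (adj f x)"
proof -
  have "adj f (\<Sum>k\<in>K. c k *\<^sub>C mult (coord i k) x) = (\<Sum>k\<in>K. c k *\<^sub>C mult (coord i k) (adj f x))" for K c
    by (induction K rule: infinite_finite_induct)
      (simp_all add: adj_zero adj_add adj_scaleC f adj_mult_independent[OF f nd])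
  then show ?thesis by (simp add: poly_mult_def)
qed

lemma blaschke_as_quotient:
  assumes "\<And>a. a \<in> set as \<Longrightarrow> cmod a < 1"
  shows "\<exists>p q. lead_coeff p = 1 \<and> (\<forall>w. cmod w < 1 \<longrightarrow> poly q w \<noteq> 0 \<and> poly q w * blaschke c as w = c * poly p w)"
  using assms
proof (induction as)
  case Nil
  show ?case by (intro exI[of _ 1]) (simp add: blaschke_def)
next
  case (Cons a as)
  then obtain p q where pq: "lead_coeff p = 1" "\<And>w. cmod w < 1 \<Longrightarrow> poly q w \<noteq> 0"
    "\<And>w. cmod w < 1 \<Longrightarrow> poly q w * blaschke c as w = c * poly p w" by auto
  define p' where "p' = [:- a, 1:] * p"
  define q' where "q' = [:1, - cnj a:] * q"
  have p'w: "poly p' w = (w - a) * poly p w" for w by (simp add: p'_def algebra_simps)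
  have q'w: "poly q' w = (1 - cnj a * w) * poly q w" for w by (simp add: q'_def algebra_simps)
  have "lead_coeff p' = 1" unfolding p'_def lead_coeff_mult using pq(1) by simp
  moreover have "poly q' w \<noteq> 0 \<and> poly q' w * blaschke c (a # as) w = c * poly p' w" if w: "cmod w < 1" for w
  proof -
    have n: "1 - cnj a * w \<noteq> 0"
    proof
      assume "1 - cnj a * w = 0"
      then have "cmod a * cmod w = 1" by (metis complex_mod_cnj eq_iff_diff_eq_0 norm_mult norm_one)
      moreover have "cmod a * cmod w < 1 * 1" using Cons.prems[of a] w by (intro mult_strict_mono) auto
      ultimately show False by simp
    qed
    have "blaschke c (a # as) w = (w - a) / (1 - cnj a * w) * blaschke c as w"
      by (simp add: blaschke_def mult_ac)
    then have "poly q' w * blaschke c (a # as) w = (w - a) * (poly q w * blaschke c as w)"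
      using n by (simp add: q'w)
    then show ?thesis using n pq(2,3)[OF w] by (simp add: q'w p'w mult_ac)
  qed
  ultimately show ?case by blast
qed

text \<open>
  The elements of the model space are orthogonal to all
  \<open>f q z\<^sup>\<alpha> = c p z\<^sup>\<alpha>\<close>, where \<open>q\<close> is the denominator and
  \<open>p\<close> the monic numerator of the Blaschke product. This is a linear recurrence for their Taylor
  coefficients in the direction \<open>i\<close>, so such an element is determined by finitely many slices.
\<close>
lemma blaschke_kernel_recurrence:
  fixes f :: "complex ^ 'n::finite \<Rightarrow> complex"
  assumes f: "inner_function f" and c: "c \<noteq> 0"
    and q: "\<And>w. cmod w < 1 \<Longrightarrow> poly q w * F w = c * poly p w"
    and fF: "\<And>z. z \<in> polydisc \<Longrightarrow> f z = F (z $ i)" and x: "adj f x = 0"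
  shows "(\<Sum>k\<le>degree p. cnj (coeff p k) * coef x (\<alpha>(i := \<alpha> i + k))) = 0"
proof -
  have "mult f (poly_mult i q (hmonomial \<alpha>)) = c *\<^sub>C poly_mult i p (hmonomial \<alpha>)"
  proof (rule hardy_eqI_fn)
    fix z :: "complex ^ 'n" assume z: "z \<in> polydisc"
    then have "poly q (z $ i) * F (z $ i) = c * poly p (z $ i)" by (intro q) (simp add: polydisc_def)
    then have "F (z $ i) * (poly q (z $ i) * fn (hmonomial \<alpha>) z) = c * poly p (z $ i) * fn (hmonomial \<alpha>) z"
      by (metis mult.assoc mult.commute)
    then show "fn (mult f (poly_mult i q (hmonomial \<alpha>))) z = fn (c *\<^sub>C poly_mult i p (hmonomial \<alpha>)) z"
      by (simp add: fn_mult[OF inner_Hinf[OF f]] fn_poly_mult fF[OF z] mult.assoc)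
  qed
  then have "cnj c * cinner x (poly_mult i p (hmonomial \<alpha>)) = 0"
    using cinner_adj_left[OF f, of x "poly_mult i q (hmonomial \<alpha>)"] x by simp
  then have "cinner x (poly_mult i p (hmonomial \<alpha>)) = 0" using c by simp
  then show ?thesis by (simp add: poly_mult_def cinner_sum_right mult_coord_hmonomial)
qed

lemma coef_zero_by_recurrence:
  fixes x :: "'n::finite hardy"
  assumes lead: "lead_coeff p = 1"
    and rec: "\<And>\<alpha>. (\<Sum>k\<le>degree p. cnj (coeff p k) * coef x (\<alpha>(i := \<alpha> i + k))) = 0"
    and start: "\<And>n. n < degree p \<Longrightarrow> coef x (\<beta>(i := n)) = 0"
  shows "coef x (\<beta>(i := n)) = 0"
proof (induction n rule: less_induct)
  case (less n)
  show ?case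
  proof (cases "n < degree p")
    case False
    let ?\<alpha> = "\<beta>(i := n - degree p)"
    have eq: "?\<alpha>(i := ?\<alpha> i + k) = \<beta>(i := n - degree p + k)" for k by simp
    have "(\<Sum>k\<le>degree p. cnj (coeff p k) * coef x (\<beta>(i := n - degree p + k))) = 0"
      using rec[of ?\<alpha>] unfolding eq .
    also have "(\<Sum>k\<le>degree p. cnj (coeff p k) * coef x (\<beta>(i := n - degree p + k))) =
        (\<Sum>k\<in>{degree p}. cnj (coeff p k) * coef x (\<beta>(i := n - degree p + k)))"
    proof (intro sum.mono_neutral_right ballI)
      fix k assume "k \<in> {..degree p} - {degree p}"
      then have "n - degree p + k < n" using False by auto
      then show "cnj (coeff p k) * coef x (\<beta>(i := n - degree p + k)) = 0" by (simp add: less del: fun_upd_apply)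
    qed auto
    finally have "coef x (\<beta>(i := n - degree p + degree p)) = 0" using lead by simp
    moreover have "n - degree p + degree p = n" using False by simp
    ultimately show ?thesis by (simp only:)
  qed (rule start)
qed

lemma span_of_injective_functionals:
  fixes E :: "'n::finite hardy set"
  assumes "finite \<Lambda>" and "0 \<in> E" and "\<And>x y. x \<in> E \<Longrightarrow> y \<in> E \<Longrightarrow> x + y \<in> E" and "\<And>c x. x \<in> E \<Longrightarrow> c *\<^sub>C x \<in> E"
    and "\<And>x. x \<in> E \<Longrightarrow> (\<And>\<alpha>. \<alpha> \<in> \<Lambda> \<Longrightarrow> coef x \<alpha> = 0) \<Longrightarrow> x = 0"
  shows "\<exists>B. finite B \<and> E = hardy.span B"
  using assms
proof (induction \<Lambda> arbitrary: E rule: finite_induct)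
  case empty
  then have "E = {0}" by auto
  then show ?case by (intro exI[of _ "{}"]) simp
next
  case (insert \<alpha> \<Lambda>)
  show ?case
  proof (cases "\<forall>x\<in>E. coef x \<alpha> = 0")
    case True
    show ?thesis
      by (rule insert.IH[OF insert.prems(1-3)]) (use True insert.prems(4) in auto)
  next
    case False
    then obtain e where e: "e \<in> E" "coef e \<alpha> \<noteq> 0" by blast
    define E' where "E' = {x \<in> E. coef x \<alpha> = 0}"
    have "\<exists>B. finite B \<and> E' = hardy.span B"
    proof (rule insert.IH)
      show "x = 0" if "x \<in> E'" "\<And>\<beta>. \<beta> \<in> \<Lambda> \<Longrightarrow> coef x \<beta> = 0" for x
        using that insert.prems(4)[of x] by (auto simp: E'_def)
    qed (use insert.prems(1-3) in \<open>auto simp: E'_def\<close>)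
    then obtain B where B: "finite B" "E' = hardy.span B" by blast
    have "E = hardy.span (insert e B)"
    proof (intro equalityI subsetI)
      fix x assume x: "x \<in> E"
      define k where "k = coef x \<alpha> / coef e \<alpha>"
      have "x + (- k) *\<^sub>C e \<in> E" using x e insert.prems(2,3) by blast
      then have "x - k *\<^sub>C e \<in> E'" using e(2) by (simp add: E'_def k_def)
      then show "x \<in> hardy.span (insert e B)" unfolding hardy.span_breakdown_eq B(2) by blast
    next
      fix x assume "x \<in> hardy.span (insert e B)"
      then obtain k where "x - k *\<^sub>C e \<in> E'" unfolding hardy.span_breakdown_eq B(2) by blast
      then have "(x - k *\<^sub>C e) + k *\<^sub>C e \<in> E" using e insert.prems(2,3) unfolding E'_def by blast
      then show "x \<in> E" by simp
    qed
    then show ?thesis using B(1) by blast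
  qed
qed

lemma model_proj_commute_of_doubly_commute:
  assumes f: "inner_function f" and g: "inner_function g"
    and dc: "\<And>x. adj f (mult g x) = mult g (adj f x)"
  shows "model_proj f (model_proj g x) = model_proj g (model_proj f x)"
proof -
  note fH = inner_Hinf[OF f] and gH = inner_Hinf[OF g]
  have dc': "adj g (mult f x) = mult f (adj g x)" for x
    by (rule cinner_eqI)
      (simp add: cinner_adj_left[OF g] cinner_adj_right[OF f, symmetric] dc cinner_adj_right[OF g] flip: cinner_adj_left[OF f])
  have "mult f (adj f (mult g (adj g x))) = mult g (adj g (mult f (adj f x)))"
    by (simp only: dc dc' mult_commute[OF fH gH] adj_commute[OF f g])
  then show ?thesis
    by (simp add: model_proj_def adj_diff[OF f] adj_diff[OF g] mult_diff[OF fH] mult_diff[OF gH] algebra_simps)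
qed

text \<open>
  The adjoint of multiplication by \<open>f\<close> commutes with polynomials in \<open>z\<^sub>j\<close>,
  hence also with the quotient \<open>g\<close> of two such polynomials: clear the denominator
  \<open>q\<close>, which has no zeros in the disc, and cancel it afterwards.
\<close>
lemma doubly_commute_of_separate_blaschke:
  fixes f g :: "complex ^ 'n::finite \<Rightarrow> complex"
  assumes f: "inner_function f" and g: "inner_function g" and nd: "\<not> depends_on f j"
    and q: "\<And>w. cmod w < 1 \<Longrightarrow> poly q w \<noteq> 0" "\<And>w. cmod w < 1 \<Longrightarrow> poly q w * G w = c * poly p w"
    and gG: "\<And>z. z \<in> polydisc \<Longrightarrow> g z = G (z $ j)"
  shows "adj f (mult g x) = mult g (adj f x)"
proof -
  have qg: "poly_mult j q (mult g y) = c *\<^sub>C poly_mult j p y" for y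
  proof (rule hardy_eqI_fn)
    fix z :: "complex ^ 'n" assume z: "z \<in> polydisc"
    then have "poly q (z $ j) * G (z $ j) = c * poly p (z $ j)" by (intro q) (simp add: polydisc_def)
    then show "fn (poly_mult j q (mult g y)) z = fn (c *\<^sub>C poly_mult j p y) z"
      by (simp add: fn_mult[OF inner_Hinf[OF g]] fn_poly_mult gG[OF z] flip: mult.assoc)
  qed
  have "poly_mult j q (adj f (mult g x)) = adj f (poly_mult j q (mult g x))"
    by (rule adj_poly_mult_independent[OF f nd, symmetric])
  also have "\<dots> = c *\<^sub>C poly_mult j p (adj f x)"
    by (simp add: qg adj_scaleC[OF f] adj_poly_mult_independent[OF f nd])
  also have "\<dots> = poly_mult j q (mult g (adj f x))" by (simp only: qg)
  finally have eq: "poly_mult j q (adj f (mult g x)) = poly_mult j q (mult g (adj f x))" .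
  show ?thesis
  proof (rule hardy_eqI_fn)
    fix z :: "complex ^ 'n" assume z: "z \<in> polydisc"
    have "poly q (z $ j) * fn (adj f (mult g x)) z = poly q (z $ j) * fn (mult g (adj f x)) z"
      using eq by (metis fn_poly_mult)
    moreover have "poly q (z $ j) \<noteq> 0" using z by (intro q) (simp add: polydisc_def)
    ultimately show "fn (adj f (mult g x)) z = fn (mult g (adj f x)) z" by simp
  qed
qed

text \<open>
  The two recurrences determine an element of the intersection from the finitely many coefficients with both
  exponents below the degrees.
\<close>
lemma finite_dim_of_blaschke:
  fixes f g :: "complex ^ 'n::finite \<Rightarrow> complex"
  assumes f: "inner_function f" and g: "inner_function g" and U: "(UNIV :: 'n set) = {i, j}" and ij: "i \<noteq> j"
    and F: "c \<noteq> 0" "lead_coeff p = 1" "\<And>w. cmod w < 1 \<Longrightarrow> poly q w * F w = c * poly p w"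
      "\<And>z. z \<in> polydisc \<Longrightarrow> f z = F (z $ i)"
    and G: "c' \<noteq> 0" "lead_coeff p' = 1" "\<And>w. cmod w < 1 \<Longrightarrow> poly q' w * G w = c' * poly p' w"
      "\<And>z. z \<in> polydisc \<Longrightarrow> g z = G (z $ j)"
  shows "\<exists>B. finite B \<and> {x. adj f x = 0 \<and> adj g x = 0} = hardy.span B"
proof (rule span_of_injective_functionals[of "(\<lambda>(m, n). (\<lambda>_. 0)(i := m, j := n)) ` ({..<degree p} \<times> {..<degree p'})"])
  show "0 \<in> {x. adj f x = 0 \<and> adj g x = 0}" by (simp add: adj_zero f g)
  show "x + y \<in> {x. adj f x = 0 \<and> adj g x = 0}"
    if "x \<in> {x. adj f x = 0 \<and> adj g x = 0}" "y \<in> {x. adj f x = 0 \<and> adj g x = 0}" for x y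
    using that by (simp add: adj_add f g)
  show "c *\<^sub>C x \<in> {x. adj f x = 0 \<and> adj g x = 0}" if "x \<in> {x. adj f x = 0 \<and> adj g x = 0}" for c x
    using that by (simp add: adj_scaleC f g)
  fix x assume x: "x \<in> {x. adj f x = 0 \<and> adj g x = 0}"
    and zero: "\<And>\<alpha>. \<alpha> \<in> (\<lambda>(m, n). (\<lambda>_. 0)(i := m, j := n)) ` ({..<degree p} \<times> {..<degree p'}) \<Longrightarrow> coef x \<alpha> = 0"
  have rf: "(\<Sum>k\<le>degree p. cnj (coeff p k) * coef x (\<alpha>(i := \<alpha> i + k))) = 0" for \<alpha>
    using blaschke_kernel_recurrence[OF f F(1,3,4)] x by blast
  have rg: "(\<Sum>k\<le>degree p'. cnj (coeff p' k) * coef x (\<alpha>(j := \<alpha> j + k))) = 0" for \<alpha>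
    using blaschke_kernel_recurrence[OF g G(1,3,4)] x by blast
  have 1: "coef x ((\<lambda>_. 0)(j := n, i := m)) = 0" if "n < degree p'" for m n
    by (rule coef_zero_by_recurrence[OF F(2) rf])
      (use that zero ij in \<open>auto simp: fun_upd_twist[OF ij]\<close>)
  have 2: "coef x ((\<lambda>_. 0)(i := m, j := n)) = 0" for m n
    by (rule coef_zero_by_recurrence[OF G(2) rg]) (use 1 in \<open>simp add: fun_upd_twist[OF ij]\<close>)
  have "coef x \<alpha> = 0" for \<alpha>
  proof -
    have "\<alpha> k = ((\<lambda>_. 0)(i := \<alpha> i, j := \<alpha> j)) k" for k
    proof -
      have "k = i \<or> k = j" using U by auto
      then show ?thesis using ij by auto
    qed
    then have "\<alpha> = (\<lambda>_. 0)(i := \<alpha> i, j := \<alpha> j)" by (rule ext)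
    then show ?thesis using 2[of "\<alpha> i" "\<alpha> j"] by metis
  qed
  then show "x = 0" by (intro hardy_eqI) simp
qed simp

lemma model_proj_constant:
  assumes f: "inner_function f" and "constant_on_polydisc f"
  shows "model_proj f x = 0"
proof -
  obtain c where c: "\<And>z. z \<in> polydisc \<Longrightarrow> f z = c" using assms(2) by (auto simp: constant_on_polydisc_def)
  have m: "mult f y = c *\<^sub>C y" for y
    by (rule hardy_eqI_fn) (simp add: fn_mult[OF inner_Hinf[OF f]] c)
  have "cmod c = 1"
    using norm_mult_inner[OF f, of one] by (simp add: m norm_hmonomial)
  then have "c * cnj c = 1" by (metis complex_norm_square of_real_1 one_power2)
  then have "mult f (cnj c *\<^sub>C x) = x" by (simp add: m)
  then show ?thesis using model_proj_mult[OF f, of "cnj c *\<^sub>C x"] by simp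
qed

text \<open>
  Finite rank of an operator on functions, restated for the operator that it induces on the type of Hardy
  space elements.
\<close>
lemma finite_rank_iff:
  fixes R :: "'n::finite hardy \<Rightarrow> 'n hardy"
  assumes T: "\<And>x. T (fn x) = fn (R x)"
  shows "finite_rank T \<longleftrightarrow> (\<exists>B. finite B \<and> range R = hardy.span B)"
proof -
  have TH: "T ` H2 = fn ` range R"
    unfolding range_fn[symmetric] by (auto simp: T image_image)
  have inj: "inj fn" by (rule injI) (simp add: fn_inject)
  have span: "{\<lambda>z. \<Sum>b\<in>fn ` B. c b * b z | c. True} = fn ` hardy.span B" if B: "finite B" for B :: "'n hardy set"
  proof -
    have eq: "(\<lambda>z. \<Sum>b\<in>fn ` B. c b * b z) = fn (\<Sum>v\<in>B. c (fn v) *\<^sub>C v)" for c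
      by (rule ext) (simp add: sum.reindex[OF inj_on_subset[OF inj subset_UNIV]])
    have "range (\<lambda>u. \<Sum>v\<in>B. u v *\<^sub>C v) = {\<Sum>v\<in>B. c (fn v) *\<^sub>C v | c. True}"
    proof (intro equalityI subsetI)
      fix y assume "y \<in> range (\<lambda>u. \<Sum>v\<in>B. u v *\<^sub>C v)"
      then obtain u where "y = (\<Sum>v\<in>B. u v *\<^sub>C v)" by blast
      then have "y = (\<Sum>v\<in>B. (\<lambda>h. u (inv fn h)) (fn v) *\<^sub>C v)" by (simp add: inv_f_f[OF inj])
      then show "y \<in> {\<Sum>v\<in>B. c (fn v) *\<^sub>C v | c. True}"
        by (intro CollectI exI[of _ "\<lambda>h. u (inv fn h)"] conjI TrueI)
    next
      fix y assume "y \<in> {\<Sum>v\<in>B. c (fn v) *\<^sub>C v | c. True}"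
      then obtain c where "y = (\<Sum>v\<in>B. c (fn v) *\<^sub>C v)" by blast
      then show "y \<in> range (\<lambda>u. \<Sum>v\<in>B. u v *\<^sub>C v)"
        by (intro range_eqI[of _ _ "\<lambda>v. c (fn v)"])
    qed
    moreover have "{h (G c) | c. True} = h ` {G c | c. True}" for h :: "'n hardy \<Rightarrow> complex ^ 'n \<Rightarrow> complex"
      and G :: "((complex ^ 'n \<Rightarrow> complex) \<Rightarrow> complex) \<Rightarrow> 'n hardy" by blast
    ultimately show ?thesis unfolding eq hardy.span_finite[OF B] by (simp only:)
  qed
  show ?thesis
  proof
    assume "finite_rank T"
    then obtain B where B: "finite B" "B \<subseteq> H2" "T ` H2 = {\<lambda>z. \<Sum>b\<in>B. c b * b z | c. True}"
      unfolding finite_rank_def by blast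
    define B' where "B' = Hardy ` B"
    have BB: "B = fn ` B'"
      unfolding B'_def image_image using B(2) by (force simp: Hardy_inverse)
    have fB: "finite B'" unfolding B'_def using B(1) by simp
    have "fn ` range R = fn ` hardy.span B'"
      using B(3) unfolding TH BB span[OF fB] .
    then have "range R = hardy.span B'" by (simp only: inj_image_eq_iff[OF inj])
    then show "\<exists>B. finite B \<and> range R = hardy.span B" using fB by blast
  next
    assume "\<exists>B. finite B \<and> range R = hardy.span B"
    then obtain B where B: "finite B" "range R = hardy.span B" by blast
    have "fn ` B \<subseteq> H2" using range_fn by blast
    moreover have "T ` H2 = {\<lambda>z. \<Sum>b\<in>fn ` B. c b * b z | c. True}"
      unfolding TH span[OF B(1)] B(2) ..
    ultimately show "finite_rank T" unfolding finite_rank_def using B(1) by blast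
  qed
qed

text \<open>
  A product of two orthogonal projections is selfadjoint exactly if they commute, and then it is idempotent.
\<close>
lemma is_projection_iff:
  fixes f g :: "complex ^ 'n::finite \<Rightarrow> complex"
  assumes f: "inner_function f" and g: "inner_function g"
    and T: "\<And>x. T (fn x) = fn (model_proj f (model_proj g x))"
  shows "is_projection T \<longleftrightarrow> (\<forall>x. model_proj f (model_proj g x) = model_proj g (model_proj f x))"
proof
  assume "is_projection T"
  then have sa: "hardy_inner (T (fn x)) (fn y) = hardy_inner (fn x) (T (fn y))" for x y
    unfolding is_projection_def range_fn[symmetric] by blast
  show "\<forall>x. model_proj f (model_proj g x) = model_proj g (model_proj f x)"
  proof (intro allI cinner_eqI)
    fix x y
    have "cinner (model_proj f (model_proj g x)) y = cinner x (model_proj f (model_proj g y))"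
      using sa[of x y] by (simp only: T hardy_inner_fn)
    then show "cinner (model_proj f (model_proj g x)) y = cinner (model_proj g (model_proj f x)) y"
      by (simp only: cinner_model_proj[OF f] cinner_model_proj[OF g])
  qed
next
  assume comm: "\<forall>x. model_proj f (model_proj g x) = model_proj g (model_proj f x)"
  let ?R = "\<lambda>x. model_proj f (model_proj g x)"
  have H: "(\<forall>h\<in>H2. P h) \<longleftrightarrow> (\<forall>x. P (fn x))" for P :: "(complex ^ 'n \<Rightarrow> complex) \<Rightarrow> bool"
    unfolding range_fn[symmetric] by blast
  have plus: "(\<lambda>z. fn x z + fn y z) = fn (x + y)" and scale: "(\<lambda>z. c * fn x z) = fn (c *\<^sub>C x)" for x y :: "'n hardy" and c
    by (simp_all add: fun_eq_iff)
  have "norm (?R x) \<le> 1 * norm x" for x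
    using norm_model_proj_le[OF f, of "model_proj g x"] norm_model_proj_le[OF g, of x] by simp
  then have K: "\<exists>K. \<forall>x. norm (?R x) \<le> K * norm x" by blast
  have "bounded_operator T"
    unfolding bounded_operator_def H plus scale T fn_inject hardy_norm_fn
  proof (intro conjI allI)
    show "fn (?R x) \<in> H2" for x by (rule fn)
    show "?R (x + y) = ?R x + ?R y" for x y by (simp add: model_proj_add f g)
    show "?R (c *\<^sub>C x) = c *\<^sub>C ?R x" for c x by (simp add: model_proj_scaleC f g)
  qed (rule K)
  moreover have "cinner (?R x) y = cinner x (?R y)" for x y
    using comm by (simp only: cinner_model_proj[OF f] cinner_model_proj[OF g])
  moreover have "?R (?R x) = ?R x" for x
  proof -
    have "model_proj f (model_proj f y) = model_proj f y" "model_proj g (model_proj g y) = model_proj g y" for y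
      by (simp_all add: model_proj_fixed_iff f g adj_model_proj)
    then show ?thesis using comm by metis
  qed
  ultimately show "is_projection T"
    unfolding is_projection_def H T hardy_inner_fn fn_inject by blast
qed

lemma two_elements:
  assumes "2 \<le> card S" obtains a b where "a \<in> S" "b \<in> S" "a \<noteq> b"
proof -
  have "finite S" "S \<noteq> {}" using assms by (auto intro: card_ge_0_finite)
  then obtain a where a: "a \<in> S" by blast
  have "card (S - {a}) = card S - 1" using a \<open>finite S\<close> by simp
  then have "S - {a} \<noteq> {}" using assms by (intro notI) simp
  then show ?thesis using a that by blast
qed

section \<open>Products of model projections of finite rank\<close>

theorem theorem1p4:
  fixes \<phi>1 \<phi>2 :: "complex ^ 'n::finite \<Rightarrow> complex"
  defines "T \<equiv> \<lambda>f. proj_onto (model_space \<phi>1) (proj_onto (model_space \<phi>2) f)"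
  assumes "CARD('n) \<ge> 2"
    and "inner_function \<phi>1" and "inner_function \<phi>2"
  shows "(CARD('n) = 2 \<longrightarrow>
            (finite_rank T \<and> is_projection T \<longleftrightarrow>
               (constant_on_polydisc \<phi>1 \<or> constant_on_polydisc \<phi>2) \<or>
               (separated \<phi>1 \<phi>2 \<and> finite_blaschke_product \<phi>1 \<and> finite_blaschke_product \<phi>2))) \<and>
         (CARD('n) > 2 \<longrightarrow>
            finite_rank T \<and> is_projection T \<longrightarrow> (\<forall>f\<in>H2. T f = (\<lambda>z. 0)))"
proof -
  note i1 = assms(3) and i2 = assms(4)
  define R where "R = (\<lambda>x. model_proj \<phi>1 (model_proj \<phi>2 x))"
  have T: "T (fn x) = fn (R x)" for x
    by (simp add: T_def R_def proj_onto_model_space i1 i2)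
  have fr: "finite_rank T \<longleftrightarrow> (\<exists>B. finite B \<and> range R = hardy.span B)"
    using T by (rule finite_rank_iff)
  have pr: "is_projection T \<longleftrightarrow> (\<forall>x. R x = model_proj \<phi>2 (model_proj \<phi>1 x))"
    unfolding R_def using i1 i2 T unfolding R_def by (rule is_projection_iff)
  obtain a b :: 'n where ab: "a \<noteq> b" using two_elements[of "UNIV :: 'n set"] assms(2) by metis
  have necessary: "commuting_models \<phi>1 \<phi>2 \<and> (\<exists>B. finite B \<and> (\<forall>x. R x \<in> hardy.span B))"
    if fp: "finite_rank T \<and> is_projection T"
  proof -
    obtain B where B: "finite B" "range R = hardy.span B" using fp fr by blast
    have "commuting_models \<phi>1 \<phi>2"
    proof (rule commuting_models.intro[OF i1 i2])
      show "model_proj \<phi>1 (model_proj \<phi>2 x) = model_proj \<phi>2 (model_proj \<phi>1 x)" for x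
        using fp pr by (simp add: R_def)
      fix i :: 'n and \<epsilon> :: real assume \<epsilon>: "0 < \<epsilon>"
      have "x \<in> hardy.span B" if "adj \<phi>1 x = 0" "adj \<phi>2 x = 0" for x
      proof -
        have "R x = x" using that by (simp add: R_def model_proj_fixed_iff[OF i1, THEN iffD2] model_proj_fixed_iff[OF i2, THEN iffD2])
        then show ?thesis using B(2) by (metis rangeI)
      qed
      then show "\<forall>\<^sub>F m in sequentially. \<forall>x. adj \<phi>1 x = 0 \<longrightarrow> adj \<phi>2 x = 0 \<longrightarrow> norm (adj (coord i m) x) \<le> \<epsilon> * norm x"
        using uniform_decay_of_finite_dim[OF B(1) \<epsilon>, of i] by (auto elim!: eventually_mono)
    qed
    then show ?thesis using B by blast
  qed
  show ?thesis
  proof (intro conjI impI)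
    assume two: "CARD('n) = 2"
    show "finite_rank T \<and> is_projection T \<longleftrightarrow>
               (constant_on_polydisc \<phi>1 \<or> constant_on_polydisc \<phi>2) \<or>
               (separated \<phi>1 \<phi>2 \<and> finite_blaschke_product \<phi>1 \<and> finite_blaschke_product \<phi>2)"
      (is "?L \<longleftrightarrow> ?const \<or> ?sep")
    proof
      assume ?L
      from necessary[OF this] obtain B where cm: "commuting_models \<phi>1 \<phi>2"
        and B: "finite B" "\<And>x. R x \<in> hardy.span B" by blast
      interpret commuting_models \<phi>1 \<phi>2 by (rule cm)
      interpret swap: commuting_models \<phi>2 \<phi>1 by (rule commuting_models_swap[OF cm])
      have j1: "joint_proj x = R x" and j2: "swap.joint_proj x = R x" for x
        by (simp_all add: joint_proj_def swap.joint_proj_def R_def commute)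
      show "?const \<or> ?sep"
      proof (rule disjCI)
        assume ns: "\<not> ?sep"
        show ?const
        proof (rule ccontr)
          assume nc: "\<not> ?const"
          have sep: "separated \<phi>1 \<phi>2"
            using separated_coordinate[OF ab] unfolding separated_def by blast
          obtain i where i: "depends_on \<phi>1 i" using nc constant_if_independent by blast
          obtain j where j: "depends_on \<phi>2 j" using nc constant_if_independent by blast
          have ij: "i \<noteq> j" using sep i j unfolding separated_def by blast
          have U: "UNIV = {i, j}"
            using two ij by (intro card_seteq[symmetric]) auto
          have Uor: "l = i \<or> l = j" for l using U UNIV_I[of l] by auto
          have d1: "\<not> depends_on \<phi>1 l" if "l \<noteq> i" for l
            using that Uor[of l] sep j unfolding separated_def by blast
          have d2: "\<not> depends_on \<phi>2 l" if "l \<noteq> j" for l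
            using that Uor[of l] sep i unfolding separated_def by blast
          have "finite_blaschke_product \<phi>1"
            using finite_dim_imp_blaschke[OF ij _ B(1) _ d1] nc B(2) by (simp add: j1)
          moreover have "finite_blaschke_product \<phi>2"
            using swap.finite_dim_imp_blaschke[OF ij[symmetric] _ B(1) _ d2] nc B(2) by (simp add: j2)
          ultimately show False using ns sep by blast
        qed
      qed
    next
      assume rhs: "?const \<or> ?sep"
      have const: ?L if ?const
      proof -
        have "R x = 0" for x
          using that model_proj_constant[OF i1] model_proj_constant[OF i2] model_proj_zero[OF i1] by (auto simp: R_def)
        moreover have "model_proj \<phi>2 (model_proj \<phi>1 x) = 0" for x
          using that model_proj_constant[OF i1] model_proj_constant[OF i2] model_proj_zero[OF i2] by auto
        moreover have "range (\<lambda>x. 0 :: 'n hardy) = hardy.span {}" by auto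
        ultimately show ?L unfolding fr pr by (metis (no_types, lifting) finite.emptyI image_cong)
      qed
      show ?L
      proof (cases ?const)
        case False
        then have sep: "separated \<phi>1 \<phi>2" "finite_blaschke_product \<phi>1" "finite_blaschke_product \<phi>2" using rhs by auto
        obtain i c as where 1: "cmod c = 1" "\<And>a. a \<in> set as \<Longrightarrow> cmod a < 1" "\<And>z. z \<in> polydisc \<Longrightarrow> \<phi>1 z = blaschke c as (z $ i)"
          using sep(2) unfolding finite_blaschke_product_def by blast
        obtain j c' as' where 2: "cmod c' = 1" "\<And>a. a \<in> set as' \<Longrightarrow> cmod a < 1" "\<And>z. z \<in> polydisc \<Longrightarrow> \<phi>2 z = blaschke c' as' (z $ j)"
          using sep(3) unfolding finite_blaschke_product_def by blast
        have d1: "\<not> depends_on \<phi>1 l" if "l \<noteq> i" for l using that 1(3) unfolding depends_on_def by metis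
        have d2: "\<not> depends_on \<phi>2 l" if "l \<noteq> j" for l using that 2(3) unfolding depends_on_def by metis
        have di: "depends_on \<phi>1 i" using False constant_if_independent[of \<phi>1] d1 by metis
        have dj: "depends_on \<phi>2 j" using False constant_if_independent[of \<phi>2] d2 by metis
        have ij: "i \<noteq> j" using sep(1) di dj unfolding separated_def by blast
        have U: "UNIV = {i, j}"
          using two ij by (intro card_seteq[symmetric]) auto
        obtain p q where pq: "lead_coeff p = 1" "\<And>w. cmod w < 1 \<Longrightarrow> poly q w \<noteq> 0"
          "\<And>w. cmod w < 1 \<Longrightarrow> poly q w * blaschke c as w = c * poly p w"
          using blaschke_as_quotient[of as c] 1(2) by metis
        obtain p' q' where pq': "lead_coeff p' = 1" "\<And>w. cmod w < 1 \<Longrightarrow> poly q' w \<noteq> 0"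
          "\<And>w. cmod w < 1 \<Longrightarrow> poly q' w * blaschke c' as' w = c' * poly p' w"
          using blaschke_as_quotient[of as' c'] 2(2) by metis
        have "adj \<phi>1 (mult \<phi>2 x) = mult \<phi>2 (adj \<phi>1 x)" for x
          using ij by (intro doubly_commute_of_separate_blaschke[OF i1 i2 d1 pq'(2,3) 2(3)]) auto
        then have comm: "model_proj \<phi>1 (model_proj \<phi>2 x) = model_proj \<phi>2 (model_proj \<phi>1 x)" for x
          by (rule model_proj_commute_of_doubly_commute[OF i1 i2])
        obtain B where B: "finite B" "{x. adj \<phi>1 x = 0 \<and> adj \<phi>2 x = 0} = hardy.span B"
          using finite_dim_of_blaschke[OF i1 i2 U ij _ pq(1,3) 1(3) _ pq'(1,3) 2(3)] 1(1) 2(1) by force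
        have "range R = {x. adj \<phi>1 x = 0 \<and> adj \<phi>2 x = 0}"
        proof (intro equalityI subsetI)
          fix y assume "y \<in> range R"
          then obtain x where y: "y = R x" by blast
          have "adj \<phi>1 y = 0" unfolding y R_def by (rule adj_model_proj[OF i1])
          moreover have "adj \<phi>2 y = 0" unfolding y R_def comm by (rule adj_model_proj[OF i2])
          ultimately show "y \<in> {x. adj \<phi>1 x = 0 \<and> adj \<phi>2 x = 0}" by simp
        next
          fix y assume "y \<in> {x. adj \<phi>1 x = 0 \<and> adj \<phi>2 x = 0}"
          then have "R y = y" by (simp add: R_def model_proj_fixed_iff[OF i1, THEN iffD2] model_proj_fixed_iff[OF i2, THEN iffD2])
          then show "y \<in> range R" by (metis rangeI)
        qed
        then show ?L unfolding fr pr using B comm by (metis R_def)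
      qed (rule const)
    qed
  next
    assume many: "2 < CARD('n)" and fp: "finite_rank T \<and> is_projection T"
    from necessary[OF fp] have cm: "commuting_models \<phi>1 \<phi>2" by blast
    interpret commuting_models \<phi>1 \<phi>2 by (rule cm)
    interpret swap: commuting_models \<phi>2 \<phi>1 by (rule commuting_models_swap[OF cm])
    \<comment> \<open>the sets of coordinates missing in each function cover all of them, so for more than two coordinates one set has two elements\<close>
    define I where "I = {l. \<not> depends_on \<phi>1 l}"
    define J where "J = {l. \<not> depends_on \<phi>2 l}"
    have "UNIV = I \<union> J" using separated_coordinate[OF ab] by (auto simp: I_def J_def)
    then have "CARD('n) \<le> card I + card J" by (metis card_Un_le)
    then consider "2 \<le> card I" | "2 \<le> card J" using many by linarith
    then have "R x = 0" for x
    proof cases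
      case 1
      then obtain k l where "k \<in> I" "l \<in> I" "k \<noteq> l" by (rule two_elements)
      then have "swap.joint_proj x = 0" by (intro swap.joint_proj_zero[of k l]) (auto simp: I_def)
      then show ?thesis by (simp add: R_def swap.joint_proj_def commute)
    next
      case 2
      then obtain k l where "k \<in> J" "l \<in> J" "k \<noteq> l" by (rule two_elements)
      then have "joint_proj x = 0" by (intro joint_proj_zero[of k l]) (auto simp: J_def)
      then show ?thesis by (simp add: R_def joint_proj_def)
    qed
    then show "\<forall>f\<in>H2. T f = (\<lambda>z. 0)"
      unfolding range_fn[symmetric] by (auto simp: T fun_eq_iff)
  qed
qed

end
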